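(* Let $G$ be a purely parabolic discrete group in $\mathrm{PSL}(3,\mathbb{C})$. Then $G$ is virtually finitely presented, torsion free and solvable. Also, $G$ is virtually either unipotent and conjugate to the projectivization of a subgroup of $\mathrm{Heis}(3,\mathbb{C})$, or else it is an Abelian group of rank at most two, with an irrational ellipto-parabolic element, and it is of the form $$\mathrm{Ell}(W,\mu)=\left\{\begin{bmatrix}\mu(w)&\mu(w)w&0\\0&\mu(w)&0\\0&0&\mu(w)^{-2}\end{bmatrix}:w\in W\right\},$$ where $W$ is a discrete additive subgroup of $\mathbb{C}$ and $\mu:W\to\mathbb{S}^1$ is a group morphism.
   Context: Square brackets around a matrix denote its class in $\mathrm{PSL}(3,\mathbb{C})$. An element of $\mathrm{PSL}(3,\mathbb{C})$ is parabolic if its lifts to $\mathrm{SL}(3,\mathbb{C})$ are non-diagonalizable with all eigenvalues of modulus $1$; a group is purely parabolic if all its elements other than the identity are parabolic. $\mathrm{Heis}(3,\mathbb{C})$ is the group of upper triangular $3\times3$ complex matrices with all diagonal entries $1$. An element is ellipto-parabolic if it has a lift whose Jordan form is $\left(\begin{smallmatrix}\lambda&1&0\\0&\lambda&0\\0&0&\lambda^{-2}\end{smallmatrix}\right)$ with $|\lambda|=1$, $\lambda\neq1$; it is irrational if $\lambda$ is not a root of unity. "Virtually $P$" means that some finite-index subgroup has property $P$ (here: up to conjugation in $\mathrm{PSL}(3,\mathbb{C})$ for the explicit form). Rank is the smallest number of generators. *)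

theory Defs
  imports
    "HOL-Analysis.Analysis"
    "HOL-Algebra.Solvable_Groups"
    "HOL-Algebra.Elementary_Groups"
begin

section \<open>Finitely presented groups, rank, torsion\<close>

text \<open>A letter \<open>(i, True)\<close> stands for the generator \<open>x_i\<close> and \<open>(i, False)\<close> for its inverse.\<close>

type_synonym word = "(nat \<times> bool) list"

definition free_words :: "nat \<Rightarrow> word set" where
  "free_words n = lists ({..<n} \<times> UNIV)"

inductive cancels :: "nat \<Rightarrow> word \<Rightarrow> word \<Rightarrow> bool" for n where
  "\<lbrakk>u \<in> free_words n; v \<in> free_words n; i < n\<rbrakk> \<Longrightarrow> cancels n (u @ [(i, b), (i, \<not> b)] @ v) (u @ v)"

definition free_rel :: "nat \<Rightarrow> (word \<times> word) set" where
  "free_rel n = {(u, v). u \<in> free_words n \<and> v \<in> free_words n \<and> equivclp (cancels n) u v}"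

definition free_group :: "nat \<Rightarrow> word set monoid" where
  "free_group n =
    \<lparr>carrier = free_words n // free_rel n,
     mult = (\<lambda>X Y. \<Union>u\<in>X. \<Union>v\<in>Y. free_rel n `` {u @ v}),
     one = free_rel n `` {[]}\<rparr>"

definition normal_closure :: "('a, 'b) monoid_scheme \<Rightarrow> 'a set \<Rightarrow> 'a set" where
  "normal_closure G R = generate G (\<Union>g\<in>carrier G. \<Union>r\<in>R. {g \<otimes>\<^bsub>G\<^esub> r \<otimes>\<^bsub>G\<^esub> inv\<^bsub>G\<^esub> g})"

definition finitely_presented :: "('a, 'b) monoid_scheme \<Rightarrow> bool" where
  "finitely_presented G \<longleftrightarrow>
    (\<exists>n R. finite R \<and> R \<subseteq> carrier (free_group n) \<and>
       G \<cong> free_group n Mod normal_closure (free_group n) R)"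

definition torsion_free :: "('a, 'b) monoid_scheme \<Rightarrow> bool" where
  "torsion_free G \<longleftrightarrow>
    (\<forall>x\<in>carrier G. x \<noteq> \<one>\<^bsub>G\<^esub> \<longrightarrow> (\<forall>n::nat. n > 0 \<longrightarrow> x [^]\<^bsub>G\<^esub> n \<noteq> \<one>\<^bsub>G\<^esub>))"

text \<open>The rank is \<open>\<infinity>\<close> when the group is not finitely generated.\<close>

definition group_rank :: "('a, 'b) monoid_scheme \<Rightarrow> enat" where
  "group_rank G = Inf {enat (card S) | S. finite S \<and> S \<subseteq> carrier G \<and> generate G S = carrier G}"

section \<open>The group PSL(3,C)\<close>

type_synonym cmat3 = "complex ^ 3 ^ 3"

text \<open>\<open>mat c\<close> is the scalar matrix with diagonal entries \<open>c\<close>.\<close>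

definition SL3 :: "cmat3 monoid" where
  "SL3 = \<lparr>carrier = {A. det A = 1}, mult = (**), one = mat 1\<rparr>"

definition SL3_scalars :: "cmat3 set" where
  "SL3_scalars = {A \<in> carrier SL3. \<exists>c. A = mat c}"

text \<open>An element of \<open>PSL3\<close> is a coset of the scalars, i.e. the set of all its lifts to \<open>SL3\<close>.\<close>

definition PSL3 :: "cmat3 set monoid" where
  "PSL3 = SL3 Mod SL3_scalars"

definition proj :: "cmat3 \<Rightarrow> cmat3 set" where
  "proj A = SL3_scalars #>\<^bsub>SL3\<^esub> A"

definition PSL3_topology :: "cmat3 set topology" where
  "PSL3_topology = topology (\<lambda>U. U \<subseteq> carrier PSL3 \<and>
     openin (top_of_set (carrier SL3)) {A \<in> carrier SL3. proj A \<in> U})"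

abbreviation PSL3_sub :: "cmat3 set set \<Rightarrow> cmat3 set monoid" where
  "PSL3_sub H \<equiv> PSL3\<lparr>carrier := H\<rparr>"

definition discrete_in_PSL3 :: "cmat3 set set \<Rightarrow> bool" where
  "discrete_in_PSL3 H \<longleftrightarrow> subtopology PSL3_topology H = discrete_topology H"

definition virtually :: "(cmat3 set set \<Rightarrow> bool) \<Rightarrow> cmat3 set set \<Rightarrow> bool" where
  "virtually P G \<longleftrightarrow>
    (\<exists>H. subgroup H (PSL3_sub G) \<and> finite (rcosets\<^bsub>PSL3_sub G\<^esub> H) \<and> P H)"

definition conjugate_in_PSL3 :: "cmat3 set set \<Rightarrow> cmat3 set set \<Rightarrow> bool" where
  "conjugate_in_PSL3 H K \<longleftrightarrow>
    (\<exists>g\<in>carrier PSL3. K = (\<lambda>h. g \<otimes>\<^bsub>PSL3\<^esub> h \<otimes>\<^bsub>PSL3\<^esub> inv\<^bsub>PSL3\<^esub> g) ` H)"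

section \<open>Types of elements\<close>

definition eigenvalue_of :: "cmat3 \<Rightarrow> complex \<Rightarrow> bool" where
  "eigenvalue_of A c \<longleftrightarrow> (\<exists>v. v \<noteq> 0 \<and> A *v v = c *s v)"

definition similar_matrices :: "cmat3 \<Rightarrow> cmat3 \<Rightarrow> bool" where
  "similar_matrices A B \<longleftrightarrow> (\<exists>P. invertible P \<and> A = P ** B ** matrix_inv P)"

definition diagonalizable :: "cmat3 \<Rightarrow> bool" where
  "diagonalizable A \<longleftrightarrow> (\<exists>D. (\<forall>i j. i \<noteq> j \<longrightarrow> D $ i $ j = 0) \<and> similar_matrices A D)"

definition parabolic :: "cmat3 set \<Rightarrow> bool" where
  "parabolic g \<longleftrightarrow> (\<forall>A\<in>g. \<not> diagonalizable A \<and> (\<forall>c. eigenvalue_of A c \<longrightarrow> cmod c = 1))"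

definition purely_parabolic :: "cmat3 set set \<Rightarrow> bool" where
  "purely_parabolic G \<longleftrightarrow> (\<forall>g\<in>G. g \<noteq> \<one>\<^bsub>PSL3\<^esub> \<longrightarrow> parabolic g)"

definition unipotent :: "cmat3 set \<Rightarrow> bool" where
  "unipotent g \<longleftrightarrow> (\<exists>A\<in>g. \<forall>c. eigenvalue_of A c \<longrightarrow> c = 1)"

definition ep_jordan_form :: "complex \<Rightarrow> cmat3" where
  "ep_jordan_form l =
    vector [vector [l, 1, 0],
            vector [0, l, 0],
            vector [0, 0, l powi (-2)]]"

definition ellipto_parabolic_with :: "complex \<Rightarrow> cmat3 set \<Rightarrow> bool" where
  "ellipto_parabolic_with l g \<longleftrightarrow>
    cmod l = 1 \<and> l \<noteq> 1 \<and> (\<exists>A\<in>g. similar_matrices A (ep_jordan_form l))"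

text \<open>The parameter \<open>l\<close> is determined by the element only up to a cube root of unity, which
  does not affect the following definition.\<close>

definition irrational_ellipto_parabolic :: "cmat3 set \<Rightarrow> bool" where
  "irrational_ellipto_parabolic g \<longleftrightarrow>
    (\<exists>l. ellipto_parabolic_with l g \<and> \<not> (\<exists>n::nat. n > 0 \<and> l ^ n = 1))"

section \<open>Heis(3,C) and Ell(W,mu)\<close>

definition Heis3 :: "cmat3 monoid" where
  "Heis3 = SL3\<lparr>carrier := {A. (\<forall>i. A $ i $ i = 1) \<and>
                             A $ 2 $ 1 = 0 \<and> A $ 3 $ 1 = 0 \<and> A $ 3 $ 2 = 0}\<rparr>"

definition complex_add_group :: "complex monoid" where
  "complex_add_group = \<lparr>carrier = UNIV, mult = (+), one = 0\<rparr>"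

definition circle_group :: "complex monoid" where
  "circle_group = \<lparr>carrier = {z. cmod z = 1}, mult = (*), one = 1\<rparr>"

definition Ell :: "complex set \<Rightarrow> (complex \<Rightarrow> complex) \<Rightarrow> cmat3 set set" where
  "Ell W \<mu> =
    (\<lambda>w. proj (vector [vector [\<mu> w, \<mu> w * w, 0],
                       vector [0, \<mu> w, 0],
                       vector [0, 0, \<mu> w powi (-2)]])) ` W"

section \<open>Basic facts\<close>

lemma group_SL3: "group SL3"
proof (rule groupI)
  fix A assume "A \<in> carrier SL3"
  then have d: "det A = 1" by (simp add: SL3_def)
  then have "invertible A" by (simp add: invertible_det_nz)
  then obtain B where B: "B ** A = mat 1" by (auto simp: invertible_def)
  then have "det B * det A = 1" by (metis det_I det_mul)
  with d B show "\<exists>y\<in>carrier SL3. y \<otimes>\<^bsub>SL3\<^esub> A = \<one>\<^bsub>SL3\<^esub>"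
    by (auto simp: SL3_def)
qed (auto simp: SL3_def det_mul matrix_mul_assoc)

lemma mat_mult_left: "(mat c ** (A::cmat3)) $ i $ j = c * A $ i $ j"
  using exhaust_3[of i] by (auto simp: matrix_matrix_mult_def mat_def sum_3)

lemma mat_mult_right: "((A::cmat3) ** mat c) $ i $ j = c * A $ i $ j"
  using exhaust_3[of j] by (auto simp: matrix_matrix_mult_def mat_def sum_3)

lemma mat_commute: "mat c ** (A::cmat3) = A ** mat c"
  by (simp add: vec_eq_iff mat_mult_left mat_mult_right)

lemma normal_SL3_scalars: "SL3_scalars \<lhd> SL3"
proof -
  interpret group SL3 by (rule group_SL3)
  have sub: "subgroup SL3_scalars SL3"
  proof (rule subgroupI)
    show "SL3_scalars \<noteq> {}"
    proof -
      have "mat 1 \<in> SL3_scalars" by (auto simp: SL3_scalars_def SL3_def)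
      then show ?thesis by blast
    qed
  next
    fix A assume A: "A \<in> SL3_scalars"
    then obtain c where c: "A = mat c" and dA: "det A = 1"
      by (auto simp: SL3_scalars_def SL3_def)
    have cn: "c \<noteq> 0"
      using c dA by (auto simp: det_3 mat_def)
    have m: "mat (inverse c) ** A = mat 1"
      using cn by (simp add: c vec_eq_iff mat_mult_left) (simp add: mat_def)
    then have "det (mat (inverse c) :: cmat3) * det A = 1"
      by (metis det_I det_mul)
    then have i: "mat (inverse c) \<in> carrier SL3" using dA by (simp add: SL3_def)
    have "inv\<^bsub>SL3\<^esub> A = mat (inverse c)"
      using m i dA by (intro inv_equality) (auto simp: SL3_def)
    with i show "inv\<^bsub>SL3\<^esub> A \<in> SL3_scalars" by (auto simp: SL3_scalars_def)
  next
    fix A B assume "A \<in> SL3_scalars" "B \<in> SL3_scalars"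
    then obtain a b where ab: "A = mat a" "B = mat b" and d: "det A = 1" "det B = 1"
      by (auto simp: SL3_scalars_def SL3_def)
    have "A ** B = mat (a * b)"
      by (simp add: ab vec_eq_iff mat_mult_left) (simp add: mat_def)
    moreover have "det (A ** B) = 1" using d by (simp add: det_mul)
    ultimately show "A \<otimes>\<^bsub>SL3\<^esub> B \<in> SL3_scalars"
      by (auto simp: SL3_scalars_def SL3_def)
  qed (auto simp: SL3_scalars_def)
  show ?thesis
    unfolding normal_inv_iff
  proof (intro conjI ballI sub)
    fix A B assume A: "A \<in> carrier SL3" and B: "B \<in> SL3_scalars"
    then obtain b where b: "B = mat b" and B': "B \<in> carrier SL3"
      by (auto simp: SL3_scalars_def)
    have "A \<otimes>\<^bsub>SL3\<^esub> B = B \<otimes>\<^bsub>SL3\<^esub> A"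
      by (simp add: SL3_def b mat_commute)
    then have "A \<otimes>\<^bsub>SL3\<^esub> B \<otimes>\<^bsub>SL3\<^esub> inv\<^bsub>SL3\<^esub> A = B"
      using A B' by (simp add: m_assoc)
    with B show "A \<otimes>\<^bsub>SL3\<^esub> B \<otimes>\<^bsub>SL3\<^esub> inv\<^bsub>SL3\<^esub> A \<in> SL3_scalars" by simp
  qed
qed

lemma group_PSL3: "group PSL3"
  unfolding PSL3_def by (rule normal.factorgroup_is_group[OF normal_SL3_scalars])

lemma carrier_PSL3: "carrier PSL3 = proj ` carrier SL3"
  by (auto simp: PSL3_def FactGroup_def RCOSETS_def proj_def)

lemma openin_PSL3_topology:
  "openin PSL3_topology U \<longleftrightarrow> U \<subseteq> carrier PSL3 \<and>
     openin (top_of_set (carrier SL3)) {A \<in> carrier SL3. proj A \<in> U}"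
proof -
  let ?P = "\<lambda>U. U \<subseteq> carrier PSL3 \<and>
     openin (top_of_set (carrier SL3)) {A \<in> carrier SL3. proj A \<in> U}"
  have "istopology ?P"
    unfolding istopology_def
  proof (intro conjI allI impI)
    fix S T assume "?P S" "?P T"
    then have "openin (top_of_set (carrier SL3))
        ({A \<in> carrier SL3. proj A \<in> S} \<inter> {A \<in> carrier SL3. proj A \<in> T})" and "S \<subseteq> carrier PSL3"
      by (auto simp del: openin_topspace)
    moreover have "{A \<in> carrier SL3. proj A \<in> S} \<inter> {A \<in> carrier SL3. proj A \<in> T} =
        {A \<in> carrier SL3. proj A \<in> S \<inter> T}" by auto
    ultimately show "S \<inter> T \<subseteq> carrier PSL3"
      "openin (top_of_set (carrier SL3)) {A \<in> carrier SL3. proj A \<in> S \<inter> T}" by auto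
  next
    fix \<U> assume *: "\<forall>K\<in>\<U>. ?P K"
    then show "\<Union>\<U> \<subseteq> carrier PSL3" by auto
    have "openin (top_of_set (carrier SL3)) (\<Union>K\<in>\<U>. {A \<in> carrier SL3. proj A \<in> K})"
      using * by (intro openin_Union) auto
    moreover have "(\<Union>K\<in>\<U>. {A \<in> carrier SL3. proj A \<in> K}) =
        {A \<in> carrier SL3. proj A \<in> \<Union>\<U>}" by auto
    ultimately show "openin (top_of_set (carrier SL3)) {A \<in> carrier SL3. proj A \<in> \<Union>\<U>}" by simp
  qed
  then show ?thesis by (simp add: PSL3_topology_def topology_inverse')
qed

lemma topspace_PSL3_topology: "topspace PSL3_topology = carrier PSL3"
proof
  show "topspace PSL3_topology \<subseteq> carrier PSL3"
    using openin_PSL3_topology[of "topspace PSL3_topology"] by simp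
  have "{A \<in> carrier SL3. proj A \<in> carrier PSL3} = carrier SL3"
    by (auto simp: carrier_PSL3)
  then have "openin PSL3_topology (carrier PSL3)"
    by (simp add: openin_PSL3_topology)
  then show "carrier PSL3 \<subseteq> topspace PSL3_topology" by (rule openin_subset)
qed

lemma quotient_map_proj: "quotient_map (top_of_set (carrier SL3)) PSL3_topology proj"
  by (simp add: quotient_map_def topspace_PSL3_topology openin_PSL3_topology flip: carrier_PSL3)

lemma group_complex_add_group: "group complex_add_group"
proof (rule groupI)
  fix x assume "x \<in> carrier complex_add_group"
  show "\<exists>y\<in>carrier complex_add_group. y \<otimes>\<^bsub>complex_add_group\<^esub> x = \<one>\<^bsub>complex_add_group\<^esub>"
    by (intro bexI[of _ "- x"]) (auto simp: complex_add_group_def)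
qed (auto simp: complex_add_group_def)

lemma group_circle_group: "group circle_group"
proof (rule groupI)
  fix x assume "x \<in> carrier circle_group"
  then have x: "cmod x = 1" by (simp add: circle_group_def)
  then have "x \<noteq> 0" by auto
  with x show "\<exists>y\<in>carrier circle_group. y \<otimes>\<^bsub>circle_group\<^esub> x = \<one>\<^bsub>circle_group\<^esub>"
    by (intro bexI[of _ "inverse x"]) (auto simp: circle_group_def norm_inverse)
qed (auto simp: circle_group_def norm_mult)

lemma subgroup_Heis3: "subgroup (carrier Heis3) SL3"
proof -
  interpret group SL3 by (rule group_SL3)
  show ?thesis
  proof (rule subgroupI)
    show sub: "carrier Heis3 \<subseteq> carrier SL3"
      by (auto simp: Heis3_def SL3_def det_3)
    have "mat 1 \<in> carrier Heis3" by (simp add: Heis3_def mat_def)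
    then show "carrier Heis3 \<noteq> {}" by blast
    fix A assume A: "A \<in> carrier Heis3"
    define B :: cmat3 where "B = vector
      [vector [1, - A$1$2, A$1$2 * A$2$3 - A$1$3], vector [0, 1, - A$2$3], vector [0, 0, 1]]"
    have B: "B \<in> carrier Heis3" by (simp add: Heis3_def B_def forall_3)
    have "B ** A = mat 1" using A
      by (simp add: Heis3_def B_def vec_eq_iff forall_3 matrix_matrix_mult_def sum_3 mat_def)
    then have "inv\<^bsub>SL3\<^esub> A = B"
      using A B sub by (intro inv_equality) (auto simp: SL3_def)
    with B show "inv\<^bsub>SL3\<^esub> A \<in> carrier Heis3" by simp
  next
    fix A B assume "A \<in> carrier Heis3" "B \<in> carrier Heis3"
    then show "A \<otimes>\<^bsub>SL3\<^esub> B \<in> carrier Heis3"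
      by (auto simp: Heis3_def SL3_def forall_3 matrix_matrix_mult_def sum_3)
  qed
qed

lemma equiv_free_rel: "equiv (free_words n) (free_rel n)"
proof (rule equivI)
  show "sym (free_rel n)" by (auto simp: free_rel_def sym_on_def intro: equivclp_sym)
  show "trans (free_rel n)" unfolding trans_on_def free_rel_def by (blast dest: equivclp_trans)
qed (auto simp: free_rel_def refl_on_def)

lemma free_words_append [simp]:
  "u @ v \<in> free_words n \<longleftrightarrow> u \<in> free_words n \<and> v \<in> free_words n"
  by (auto simp: free_words_def)

lemma cancels_append:
  assumes "cancels n u v" "a \<in> free_words n" "b \<in> free_words n"
  shows "cancels n (a @ u @ b) (a @ v @ b)"
  using assms(1)
proof cases
  case (1 x y i c)
  then show ?thesis
    using cancels.intros[of "a @ x" n "y @ b" i c] assms by simp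
qed

lemma equivclp_cancels_append:
  assumes "equivclp (cancels n) u v" "a \<in> free_words n" "b \<in> free_words n"
  shows "equivclp (cancels n) (a @ u @ b) (a @ v @ b)"
  using assms(1)
proof (induction rule: equivclp_induct)
  case (step y z)
  from step(2) have "equivclp (cancels n) (a @ y @ b) (a @ z @ b)"
  proof
    assume "cancels n y z"
    from r_into_equivclp[of "cancels n", OF cancels_append[OF this assms(2,3)]] show ?thesis .
  next
    assume "cancels n z y"
    from r_into_equivclp[of "cancels n", OF cancels_append[OF this assms(2,3)]]
    show ?thesis by (rule equivclp_sym)
  qed
  with step.IH show ?case by (rule equivclp_trans)
qed simp

lemma free_rel_append:
  assumes "(u, u') \<in> free_rel n" "(v, v') \<in> free_rel n"
  shows "(u @ v, u' @ v') \<in> free_rel n"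
proof -
  have w: "u \<in> free_words n" "u' \<in> free_words n" "v \<in> free_words n" "v' \<in> free_words n"
    using assms by (auto simp: free_rel_def)
  have nil: "[] \<in> free_words n" by (simp add: free_words_def)
  have 1: "equivclp (cancels n) (u @ v) (u' @ v)"
    using equivclp_cancels_append[of n u u' "[]" v] assms nil w by (simp add: free_rel_def)
  have 2: "equivclp (cancels n) (u' @ v) (u' @ v')"
    using equivclp_cancels_append[of n v v' u' "[]"] assms nil w by (simp add: free_rel_def)
  show ?thesis
    using w equivclp_trans[OF 1 2] by (simp add: free_rel_def)
qed

lemma mult_free_group:
  assumes "u \<in> free_words n" "v \<in> free_words n"
  shows "free_rel n `` {u} \<otimes>\<^bsub>free_group n\<^esub> free_rel n `` {v} = free_rel n `` {u @ v}"
proof -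
  have "free_rel n `` {u' @ v'} = free_rel n `` {u @ v}"
    if "(u, u') \<in> free_rel n" "(v, v') \<in> free_rel n" for u' v'
    using equiv_class_eq[OF equiv_free_rel free_rel_append[OF that]] by simp
  note * = this
  have ne: "u \<in> free_rel n `` {u}" "v \<in> free_rel n `` {v}"
    using assms by (simp_all add: free_rel_def)
  have "(\<Union>u'\<in>free_rel n `` {u}. \<Union>v'\<in>free_rel n `` {v}. free_rel n `` {u' @ v'}) =
      free_rel n `` {u @ v}" (is "(\<Union>u'\<in>?U. \<Union>v'\<in>?V. ?f u' v') = _")
  proof (rule SUP_eq_const)
    fix u' assume u': "u' \<in> ?U"
    show "(\<Union>v'\<in>?V. ?f u' v') = free_rel n `` {u @ v}"
    proof (rule SUP_eq_const)
      fix v' assume "v' \<in> ?V"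
      with u' show "?f u' v' = free_rel n `` {u @ v}" by (intro *) simp_all
    qed (use ne in blast)
  qed (use ne in blast)
  then show ?thesis by (simp add: free_group_def)
qed

lemma free_word_inverse:
  assumes "u \<in> free_words n"
  shows "\<exists>v\<in>free_words n. (v @ u, []) \<in> free_rel n"
  using assms
proof (induction u)
  case Nil
  then show ?case by (intro bexI[of _ "[]"]) (auto simp: free_rel_def)
next
  case (Cons x u)
  obtain i b where x: "x = (i, b)" by force
  have i: "i < n" and u: "u \<in> free_words n" using Cons.prems by (auto simp: free_words_def x)
  from Cons.IH[OF u] obtain v where v: "v \<in> free_words n" "(v @ u, []) \<in> free_rel n" by auto
  let ?w = "v @ [(i, \<not> b)]"
  have "?w \<in> free_words n" using v i by (auto simp: free_words_def)
  moreover have "cancels n (?w @ x # u) (v @ u)"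
    using cancels.intros[OF v(1) u i, of "\<not> b"] by (simp add: x)
  moreover have "(?w @ x # u, []) \<in> free_rel n"
  proof -
    have "equivclp (cancels n) (?w @ x # u) []"
      using equivclp_trans[OF r_into_equivclp[of "cancels n", OF calculation(2)]] v(2) by (simp add: free_rel_def)
    moreover have "?w @ x # u \<in> free_words n" "[] \<in> free_words n"
      using v(1) i Cons.prems by (auto simp: free_words_def)
    ultimately show ?thesis unfolding free_rel_def by blast
  qed
  ultimately show ?case by blast
qed

lemma group_free_group: "group (free_group n)"
proof (rule groupI)
  have nil: "[] \<in> free_words n" by (simp add: free_words_def)
  have carrier: "X \<in> carrier (free_group n) \<longleftrightarrow> (\<exists>u\<in>free_words n. X = free_rel n `` {u})" for X
    by (auto simp: free_group_def quotient_def)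
  have one: "\<one>\<^bsub>free_group n\<^esub> = free_rel n `` {[]}" by (simp add: free_group_def)
  show "\<one>\<^bsub>free_group n\<^esub> \<in> carrier (free_group n)" using nil by (auto simp: carrier one)
  fix X assume X: "X \<in> carrier (free_group n)"
  then show "\<one>\<^bsub>free_group n\<^esub> \<otimes>\<^bsub>free_group n\<^esub> X = X"
    using nil by (auto simp: carrier one mult_free_group)
  obtain u where u: "u \<in> free_words n" "X = free_rel n `` {u}" using X carrier by auto
  obtain v where v: "v \<in> free_words n" "(v @ u, []) \<in> free_rel n"
    using free_word_inverse[OF u(1)] by auto
  have "free_rel n `` {v} \<otimes>\<^bsub>free_group n\<^esub> X = \<one>\<^bsub>free_group n\<^esub>"
    using u v equiv_class_eq[OF equiv_free_rel v(2)] by (simp add: mult_free_group one)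
  then show "\<exists>Y\<in>carrier (free_group n). Y \<otimes>\<^bsub>free_group n\<^esub> X = \<one>\<^bsub>free_group n\<^esub>"
    using v(1) carrier by blast
  fix Y assume Y: "Y \<in> carrier (free_group n)"
  with X show "X \<otimes>\<^bsub>free_group n\<^esub> Y \<in> carrier (free_group n)"
    by (auto simp: carrier mult_free_group)
  fix Z assume "Z \<in> carrier (free_group n)"
  with X Y show "X \<otimes>\<^bsub>free_group n\<^esub> Y \<otimes>\<^bsub>free_group n\<^esub> Z =
      X \<otimes>\<^bsub>free_group n\<^esub> (Y \<otimes>\<^bsub>free_group n\<^esub> Z)"
    by (auto simp: carrier mult_free_group)
qed

end

theory Submission
  imports
    Defs
    "HOL-Computational_Algebra.Fundamental_Theorem_Algebra"
begin

text \<open>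
  Let \<open>\<Gamma>\<close> be the preimage of \<open>G\<close> in \<open>SL(3, \<complex>)\<close>. All eigenvalues have modulus 1, so traces on
  \<open>\<Gamma>\<close> are bounded, whereas the powers of a non-diagonalizable \<open>g\<close> grow: the leading
  coefficient of the trace of \<open>g\<^sup>n h\<close> has to vanish. Since that coefficient pairs \<open>h\<close> with a matrix of rank
  one, \<open>\<Gamma>\<close> is reducible; the same argument and an elementary trace identity split the remaining
  two-dimensional block, so \<open>\<Gamma>\<close> is triangularizable.

  For an upper triangular non-diagonalizable matrix two of the three diagonal entries agree, and as \<open>\<Gamma>\<close>
  is not a union of proper subgroups (up to an index 4 exception) it is the same two entries throughout.
  Conjugating a unipotent element by all of \<open>\<Gamma>\<close> often gives a bounded orbit, which is finite
  by discreteness, so that only finitely many eigenvalue ratios occur and \<open>\<Gamma>\<close> is virtually unipotent.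
  The remaining case of a translation sheared by an element with irrational eigenvalue ratio is excluded by
  Dirichlet's approximation theorem, which makes double commutators with high powers small. If there is no
  unipotent element to conjugate, \<open>\<Gamma>\<close> is commutative and splits as \<open>Ell(W, \<mu>)\<close>.

  Discrete subgroups of the Heisenberg group are polycyclic: if \<open>u\<close> and \<open>v\<close> do not commute,
  \<open>w \<mapsto> ([u, w], [v, w])\<close> is a homomorphism to a discrete additive group with central kernel.
\<close>

section \<open>Finite presentations of polycyclic groups\<close>

text \<open>Everything is decided by the pair of eigenvalue \<open>ratios\<close>, which ignores the
  scalar ambiguity of a lift. If only finitely many pairs occur, the elements with three equal
  eigenvalues have finite index, and dividing such a lift by its eigenvalue, a cube root of unity,
  puts it into the Heisenberg group. So infinitely many ratios are the only obstacle to being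
  virtually unipotent, and they are shown to force a common splitting into a two-dimensional block
  and a line. There non-diagonalizability makes the translation part injective modulo scalars, so a
  discrete subgroup of \<complex>, generated by two elements, carries the whole group. If all
  eigenvalues were roots of unity, two generators would again leave finitely many ratios; this is
  where the irrational element comes from. The abstract properties are proved for a matrix group in
  SL or for a lattice in \<complex>, and an injective homomorphism carries them to the subgroup of
  \<open>G\<close>. One and the same subgroup serves both halves of the conclusion.\<close>

primrec word_eval :: "('a, 'b) monoid_scheme \<Rightarrow> (nat \<Rightarrow> 'a) \<Rightarrow> word \<Rightarrow> 'a" where
  "word_eval G g [] = \<one>\<^bsub>G\<^esub>"
| "word_eval G g (l # w) = (if snd l then g (fst l) else inv\<^bsub>G\<^esub> g (fst l)) \<otimes>\<^bsub>G\<^esub> word_eval G g w"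

text \<open>Equality in the group presented by \<open>R\<close>, kept on words so that it can be
  established by rewriting; cosets of the normal closure enter only through
  \<open>word_congruence_normal_closure\<close>.\<close>

inductive word_congruence :: "nat \<Rightarrow> word set \<Rightarrow> word \<Rightarrow> word \<Rightarrow> bool" for n R where
  refl: "u \<in> free_words n \<Longrightarrow> word_congruence n R u u"
| sym: "word_congruence n R u v \<Longrightarrow> word_congruence n R v u"
| trans: "word_congruence n R u v \<Longrightarrow> word_congruence n R v w \<Longrightarrow> word_congruence n R u w"
| cancel: "i < n \<Longrightarrow> word_congruence n R [(i, b), (i, \<not> b)] []"
| relator: "r \<in> R \<Longrightarrow> r \<in> free_words n \<Longrightarrow> word_congruence n R r []"
| append: "word_congruence n R u v \<Longrightarrow> word_congruence n R u' v' \<Longrightarrow>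
    word_congruence n R (u @ u') (v @ v')"

definition word_inverse :: "word \<Rightarrow> word" where
  "word_inverse w = rev (map (\<lambda>(i, b). (i, \<not> b)) w)"

section \<open>Words, their congruences and their evaluation\<close>

lemma free_words_Nil [simp]: "[] \<in> free_words n"
  by (simp add: free_words_def)

lemma free_words_Cons [simp]: "l # w \<in> free_words n \<longleftrightarrow> fst l < n \<and> w \<in> free_words n"
  by (cases l) (auto simp: free_words_def)

lemma free_words_mono: "w \<in> free_words n \<Longrightarrow> n \<le> m \<Longrightarrow> w \<in> free_words m"
  by (induction w) auto

lemma word_inverse_in [simp]: "word_inverse w \<in> free_words n \<longleftrightarrow> w \<in> free_words n"
  by (induction w) (auto simp: word_inverse_def split: prod.splits)

lemma word_congruence_in:
  "word_congruence n R u v \<Longrightarrow> u \<in> free_words n \<and> v \<in> free_words n"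
  by (induction rule: word_congruence.induct) auto

lemma word_congruence_mono:
  assumes "word_congruence n R u v" "n \<le> m" "R \<subseteq> R'"
  shows "word_congruence m R' u v"
  using assms
proof (induction rule: word_congruence.induct)
  case (trans u v w)
  then show ?case by (meson word_congruence.trans)
qed (auto intro: word_congruence.intros free_words_mono)

lemma word_congruence_appL:
  "word_congruence n R u v \<Longrightarrow> w \<in> free_words n \<Longrightarrow> word_congruence n R (w @ u) (w @ v)"
  by (rule word_congruence.append[OF word_congruence.refl])

lemma word_congruence_appR:
  "word_congruence n R u v \<Longrightarrow> w \<in> free_words n \<Longrightarrow> word_congruence n R (u @ w) (v @ w)"
  by (rule word_congruence.append[OF _ word_congruence.refl])

lemma word_congruence_inverse:
  "w \<in> free_words n \<Longrightarrow> word_congruence n R (word_inverse w @ w) []"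
proof (induction w)
  case Nil
  then show ?case by (simp add: word_inverse_def word_congruence.refl)
next
  case (Cons l w)
  obtain i b where l: "l = (i, b)" by force
  have "word_congruence n R [(i, \<not> b), (i, \<not> \<not> b)] []"
    using Cons.prems l by (intro word_congruence.cancel) auto
  then have "word_congruence n R (word_inverse w @ [(i, \<not> b), (i, b)] @ w) (word_inverse w @ [] @ w)"
    using Cons.prems by (intro word_congruence_appL word_congruence_appR) auto
  then show ?case
    using Cons word_congruence.trans by (fastforce simp: l word_inverse_def)
qed

lemma (in group) word_eval_closed [simp]:
  "w \<in> free_words n \<Longrightarrow> \<forall>i<n. g i \<in> carrier G \<Longrightarrow> word_eval G g w \<in> carrier G"
  by (induction w) auto

lemma (in group) word_eval_append:
  assumes "u \<in> free_words n" "v \<in> free_words n" "\<forall>i<n. g i \<in> carrier G"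
  shows "word_eval G g (u @ v) = word_eval G g u \<otimes> word_eval G g v"
  using assms(1)
proof (induction u)
  case (Cons l u)
  have "word_eval G g u \<in> carrier G" "word_eval G g v \<in> carrier G"
    using Cons assms word_eval_closed by auto
  then show ?case using Cons assms by (auto simp: m_assoc)
qed (use assms word_eval_closed in auto)

lemma (in group) word_congruence_eval:
  assumes "word_congruence n R u v" "\<forall>i<n. g i \<in> carrier G" "\<forall>r\<in>R. word_eval G g r = \<one>"
  shows "word_eval G g u = word_eval G g v"
  using assms(1)
proof (induction rule: word_congruence.induct)
  case (append u v u' v')
  have "u \<in> free_words n" "v \<in> free_words n" "u' \<in> free_words n" "v' \<in> free_words n"
    using append word_congruence_in by blast+
  then show ?case using append.IH assms(2) by (simp add: word_eval_append)
qed (use assms in auto)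

text \<open>With \<open>R\<close> empty this yields that evaluation is constant on the classes of
  the free group.\<close>

lemma free_rel_word_congruence: 
  assumes "(u, v) \<in> free_rel n" shows "word_congruence n R u v"
proof -
  have c: "word_congruence n R x y" if "cancels n x y" for x y
    using that
  proof cases
    case (1 u v i b)
    have "word_congruence n R (u @ [(i, b), (i, \<not> b)] @ v) (u @ [] @ v)"
      using 1 by (intro word_congruence_appL word_congruence_appR word_congruence.cancel) auto
    then show ?thesis using 1 by simp
  qed
  have "equivclp (cancels n) u v" "u \<in> free_words n" using assms by (auto simp: free_rel_def)
  then show ?thesis
  proof (induction rule: equivclp_induct)
    case base
    then show ?case by (rule word_congruence.refl)
  next
    case (step y z)
    then show ?case using c word_congruence.sym word_congruence.trans by metis
  qed
qed

text \<open>A presentation relative to a chosen evaluation inside an ambient group, so that a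
  generator can be added while the old words are reused unchanged. The last clause is completeness
  of the relators.\<close>

definition (in group) presented_by :: "nat \<Rightarrow> word set \<Rightarrow> (nat \<Rightarrow> 'a) \<Rightarrow> 'a set \<Rightarrow> bool" where
  "presented_by n R g H \<longleftrightarrow> finite R \<and> R \<subseteq> free_words n \<and> (\<forall>i<n. g i \<in> carrier G) \<and>
     word_eval G g ` free_words n = H \<and> (\<forall>r\<in>R. word_eval G g r = \<one>) \<and>
     (\<forall>w\<in>free_words n. word_eval G g w = \<one> \<longrightarrow> word_congruence n R w [])"

text \<open>Each rule of the congruence is valid for cosets of a normal subgroup containing the
  relators; the generators of \<open>N\<close> are permuted by conjugation, so \<open>N\<close> is
  normal.\<close>

lemma word_congruence_normal_closure:
  fixes n R
  defines "F \<equiv> free_group n" and "c \<equiv> \<lambda>w. free_rel n `` {w}"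
  defines "N \<equiv> normal_closure F (c ` R)"
  assumes "R \<subseteq> free_words n" "word_congruence n R u v"
  shows "N #>\<^bsub>F\<^esub> c u = N #>\<^bsub>F\<^esub> c v"
proof -
  interpret F: group F unfolding F_def by (rule group_free_group)
  have cin: "c w \<in> carrier F" if "w \<in> free_words n" for w
    using that by (auto simp: c_def F_def free_group_def quotient_def)
  have S: "(\<Union>g\<in>carrier F. \<Union>r\<in>c ` R. {g \<otimes>\<^bsub>F\<^esub> r \<otimes>\<^bsub>F\<^esub> inv\<^bsub>F\<^esub> g}) \<subseteq> carrier F"
    using cin assms(4) by auto
  have "N \<lhd> F"
    unfolding N_def normal_closure_def
  proof (rule F.normal_generateI[OF S])
    fix h g assume h: "h \<in> (\<Union>g\<in>carrier F. \<Union>r\<in>c ` R. {g \<otimes>\<^bsub>F\<^esub> r \<otimes>\<^bsub>F\<^esub> inv\<^bsub>F\<^esub> g})"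
      and g: "g \<in> carrier F"
    then obtain k r where k: "k \<in> carrier F" "r \<in> c ` R" "h = k \<otimes>\<^bsub>F\<^esub> r \<otimes>\<^bsub>F\<^esub> inv\<^bsub>F\<^esub> k" by auto
    moreover have "r \<in> carrier F" using k cin assms(4) by auto
    ultimately have "g \<otimes>\<^bsub>F\<^esub> h \<otimes>\<^bsub>F\<^esub> inv\<^bsub>F\<^esub> g = (g \<otimes>\<^bsub>F\<^esub> k) \<otimes>\<^bsub>F\<^esub> r \<otimes>\<^bsub>F\<^esub> inv\<^bsub>F\<^esub> (g \<otimes>\<^bsub>F\<^esub> k)"
      using g by (simp add: F.m_assoc F.inv_mult_group)
    then show "g \<otimes>\<^bsub>F\<^esub> h \<otimes>\<^bsub>F\<^esub> inv\<^bsub>F\<^esub> g \<in> (\<Union>g\<in>carrier F. \<Union>r\<in>c ` R. {g \<otimes>\<^bsub>F\<^esub> r \<otimes>\<^bsub>F\<^esub> inv\<^bsub>F\<^esub> g})"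
      using k g by (auto intro!: bexI[of _ "g \<otimes>\<^bsub>F\<^esub> k"])
  qed
  then interpret N: normal N F .
  show ?thesis using assms(5)
  proof (induction rule: word_congruence.induct)
    case (cancel i b)
    have "cancels n ([] @ [(i, b), (i, \<not> b)] @ []) ([] @ [])"
      using cancel by (intro cancels.intros) auto
    then have "([(i, b), (i, \<not> b)], []) \<in> free_rel n"
      using cancel by (auto simp: free_rel_def intro: r_into_equivclp)
    then have "c [(i, b), (i, \<not> b)] = c []"
      unfolding c_def by (rule equiv_class_eq[OF equiv_free_rel])
    then show ?case by simp
  next
    case (relator r)
    have "c [] = \<one>\<^bsub>F\<^esub>" by (simp add: c_def F_def free_group_def)
    moreover have "c r \<in> N"
      unfolding N_def normal_closure_def
      using relator cin by (intro generate.incl) (auto intro!: bexI[of _ "\<one>\<^bsub>F\<^esub>"] bexI[of _ "r"])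
    moreover have "N #>\<^bsub>F\<^esub> \<one>\<^bsub>F\<^esub> = N" by (rule F.coset_mult_one[OF N.subset])
    ultimately show ?case
      using F.coset_join2[OF cin N.subgroup_axioms] relator by simp
  next
    case (append u v u' v')
    have w: "u \<in> free_words n" "v \<in> free_words n" "u' \<in> free_words n" "v' \<in> free_words n"
      using append word_congruence_in by blast+
    have "c (x @ y) = c x \<otimes>\<^bsub>F\<^esub> c y" if "x \<in> free_words n" "y \<in> free_words n" for x y
      unfolding c_def F_def using that by (simp add: mult_free_group)
    then have "N #>\<^bsub>F\<^esub> c (u @ u') = (N #>\<^bsub>F\<^esub> c u) <#>\<^bsub>F\<^esub> (N #>\<^bsub>F\<^esub> c u')"
      "N #>\<^bsub>F\<^esub> c (v @ v') = (N #>\<^bsub>F\<^esub> c v) <#>\<^bsub>F\<^esub> (N #>\<^bsub>F\<^esub> c v')"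
      using w cin by (simp_all add: N.rcos_sum)
    then show ?case using append.IH by simp
  qed auto
qed

text \<open>First isomorphism theorem: evaluation maps the free group onto \<open>H\<close>, and
  completeness of the relators says that the kernel is no larger than the normal closure.\<close>

lemma (in group) presented_by_imp_finitely_presented:
  assumes p: "presented_by n R g H" and H: "subgroup H G"
  shows "finitely_presented (G\<lparr>carrier := H\<rparr>)"
proof -
  let ?F = "free_group n" and ?c = "\<lambda>w. free_rel n `` {w}"
  let ?N = "normal_closure ?F (?c ` R)" and ?H = "G\<lparr>carrier := H\<rparr>"
  interpret F: group ?F by (rule group_free_group)
  interpret H: group ?H using H by (rule subgroup_imp_group)
  have R: "finite R" "R \<subseteq> free_words n" and g: "\<forall>i<n. g i \<in> carrier G"
    and im: "word_eval G g ` free_words n = H" and e1: "\<forall>r\<in>R. word_eval G g r = \<one>"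
    and cong: "\<And>w. w \<in> free_words n \<Longrightarrow> word_eval G g w = \<one> \<Longrightarrow> word_congruence n R w []"
    using p by (auto simp: presented_by_def)
  \<comment> \<open>Evaluation of a class through an arbitrary representative; \<open>fc\<close>
    shows that the choice is immaterial.\<close>
  define f where "f = (\<lambda>X. word_eval G g (SOME w. w \<in> X))"
  have cF: "X \<in> carrier ?F \<longleftrightarrow> (\<exists>w\<in>free_words n. X = ?c w)" for X
    by (auto simp: free_group_def quotient_def)
  have fc: "f (?c w) = word_eval G g w" if "w \<in> free_words n" for w
  proof -
    have "w \<in> ?c w" using that by (auto simp: free_rel_def)
    then have "(w, SOME w'. w' \<in> ?c w) \<in> free_rel n" by (metis Image_singleton_iff someI)
    from free_rel_word_congruence[OF this, of "{}"] show ?thesis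
      unfolding f_def using word_congruence_eval[OF _ g, of "{}"] by fastforce
  qed
  have fhom: "f \<in> hom ?F ?H"
  proof (rule homI)
    fix X Y assume "X \<in> carrier ?F" "Y \<in> carrier ?F"
    then show "f (X \<otimes>\<^bsub>?F\<^esub> Y) = f X \<otimes>\<^bsub>?H\<^esub> f Y"
      by (auto simp: cF mult_free_group fc word_eval_append[OF _ _ g])
  next
    fix X assume "X \<in> carrier ?F"
    then show "f X \<in> carrier ?H" using im by (auto simp: cF fc)
  qed
  interpret f: group_hom ?F ?H f
    by (simp add: group_hom_def group_hom_axioms_def F.group_axioms H.group_axioms fhom)
  have surj: "f ` carrier ?F = carrier ?H"
  proof -
    have "carrier ?F = ?c ` free_words n" by (auto simp: cF)
    then have "f ` carrier ?F = word_eval G g ` free_words n" by (simp add: image_image fc)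
    then show ?thesis using im by simp
  qed
  have cR: "?c ` R \<subseteq> carrier ?F" using R(2) cF by blast
  have ker: "kernel ?F ?H f = ?N"
  proof
    show "?N \<subseteq> kernel ?F ?H f"
      unfolding normal_closure_def
    proof (rule F.generate_subgroup_incl[OF _ f.subgroup_kernel])
      show "(\<Union>x\<in>carrier ?F. \<Union>r\<in>?c ` R. {x \<otimes>\<^bsub>?F\<^esub> r \<otimes>\<^bsub>?F\<^esub> inv\<^bsub>?F\<^esub> x}) \<subseteq> kernel ?F ?H f"
      proof safe
        fix x r assume x: "x \<in> carrier ?F" and r: "r \<in> R"
        have "f (?c r) = \<one>\<^bsub>?H\<^esub>" using r R e1 by (auto simp: fc)
        moreover have "?c r \<in> carrier ?F" using r cR by auto
        ultimately show "x \<otimes>\<^bsub>?F\<^esub> ?c r \<otimes>\<^bsub>?F\<^esub> inv\<^bsub>?F\<^esub> x \<in> kernel ?F ?H f"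
          using x f.hom_closed[OF x] unfolding kernel_def
          by (simp only: mem_Collect_eq f.hom_mult f.hom_inv F.m_closed F.inv_closed H.r_one H.r_inv)
      qed
    qed
    show "kernel ?F ?H f \<subseteq> ?N"
    proof
      fix X assume "X \<in> kernel ?F ?H f"
      then obtain w where w: "w \<in> free_words n" "X = ?c w" "word_eval G g w = \<one>"
        by (auto simp: kernel_def cF fc)
      have 1: "?N #>\<^bsub>?F\<^esub> ?c w = ?N #>\<^bsub>?F\<^esub> ?c []"
        by (rule word_congruence_normal_closure[OF R(2) cong[OF w(1,3)]])
      have S: "(\<Union>x\<in>carrier ?F. \<Union>r\<in>?c ` R. {x \<otimes>\<^bsub>?F\<^esub> r \<otimes>\<^bsub>?F\<^esub> inv\<^bsub>?F\<^esub> x}) \<subseteq> carrier ?F"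
        using cR by auto
      have N: "subgroup ?N ?F" unfolding normal_closure_def by (rule F.generate_is_subgroup[OF S])
      have one: "?c [] = \<one>\<^bsub>?F\<^esub>" by (simp add: free_group_def)
      have "?N #>\<^bsub>?F\<^esub> \<one>\<^bsub>?F\<^esub> = ?N" using F.coset_mult_one[OF subgroup.subset[OF N]] .
      then show "X \<in> ?N" using F.coset_join1[OF _ _ N, of "?c w"] 1 w one by (auto simp: cF)
    qed
  qed
  have "?F Mod ?N \<cong> ?H" using f.FactGroup_iso[OF surj] by (simp add: ker)
  moreover have "group (?F Mod ?N)"
    using normal.factorgroup_is_group[OF f.normal_kernel] by (simp add: ker)
  ultimately have "?H \<cong> ?F Mod ?N" using group.iso_sym by blast
  moreover have "finite (?c ` R)" using R by simp
  ultimately show ?thesis unfolding finitely_presented_def using cR by blast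
qed

lemma (in group) word_eval_inverse:
  assumes "w \<in> free_words n" "\<forall>i<n. g i \<in> carrier G"
  shows "word_eval G g (word_inverse w) = inv (word_eval G g w)"
proof -
  have "word_eval G g (word_inverse w @ w) = \<one>"
    using word_congruence_eval[OF word_congruence_inverse[OF assms(1), of "{}"] assms(2)] by simp
  then show ?thesis
    using assms by (intro inv_equality[symmetric]) (auto simp: word_eval_append)
qed

lemma (in group) word_eval_cong:
  "w \<in> free_words n \<Longrightarrow> (\<And>i. i < n \<Longrightarrow> g i = g' i) \<Longrightarrow> word_eval G g w = word_eval G g' w"
  by (induction w) auto

lemma replicate_in_free_words [simp]: "replicate m l \<in> free_words n \<longleftrightarrow> m = 0 \<or> fst l < n"
  by (induction m) auto

lemma (in group) word_eval_replicate:
  assumes "g i \<in> carrier G"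
  shows "word_eval G g (replicate m (i, b)) = (if b then g i else inv g i) [^] m"
  using assms by (induction m) (auto, (metis inv_closed nat_pow_Suc nat_pow_Suc2)+)

lemma (in group) presented_by_trivial: "presented_by 0 {} g {\<one>}"
proof -
  have "free_words 0 = {[]}" by (auto simp: free_words_def)
  then show ?thesis by (auto simp: presented_by_def word_congruence.refl)
qed

section \<open>Adding one generator: presentations of cyclic extensions\<close>

definition (in group) cyclic_extension :: "'a set \<Rightarrow> 'a \<Rightarrow> 'a set" where
  "cyclic_extension N t = {t [^] (k::int) \<otimes> x | k x. x \<in> N}"

text \<open>The hypothesis is the relation x t = t (inv t x t): a letter of the new generator
  travels to the front, at the price of replacing the old letters that it passes.\<close>

lemma word_congruence_shift:
  assumes step: "\<And>i b c. i < n \<Longrightarrow>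
      \<exists>v\<in>free_words n. word_congruence (Suc n) R [(i, b), (n, c)] ((n, c) # v)"
    and "w \<in> free_words n"
  shows "\<exists>v\<in>free_words n. word_congruence (Suc n) R (w @ [(n, c)]) ((n, c) # v)"
  using assms(2)
proof (induction w)
  case Nil
  then show ?case
    by (intro bexI[of _ "[]"]) (auto intro: word_congruence.refl)
next
  case (Cons l w)
  obtain i b where l: "l = (i, b)" by force
  obtain v where v: "v \<in> free_words n" "word_congruence (Suc n) R (w @ [(n, c)]) ((n, c) # v)"
    using Cons by auto
  obtain v' where v': "v' \<in> free_words n"
    "word_congruence (Suc n) R [(i, b), (n, c)] ((n, c) # v')"
    using step[of i b c] Cons.prems l by auto
  have "word_congruence (Suc n) R ([l] @ (w @ [(n, c)])) ([l] @ ((n, c) # v))"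
    using v(2) Cons.prems l by (intro word_congruence_appL) auto
  moreover have "word_congruence (Suc n) R ([(i, b), (n, c)] @ v) (((n, c) # v') @ v)"
    using v' v(1) by (intro word_congruence_appR) (auto intro: free_words_mono)
  ultimately have "word_congruence (Suc n) R ((l # w) @ [(n, c)]) ((n, c) # (v' @ v))"
    using l by (auto intro: word_congruence.trans)
  then show ?case using v v' by auto
qed

text \<open>Collection: letters of the new generator are gathered at the front, where opposite ones
  cancel, so a single block of constant sign remains.\<close>

lemma word_congruence_normal_form:
  assumes step: "\<And>i b c. i < n \<Longrightarrow>
      \<exists>v\<in>free_words n. word_congruence (Suc n) R [(i, b), (n, c)] ((n, c) # v)"
    and "w \<in> free_words (Suc n)"
  shows "\<exists>m c. \<exists>v\<in>free_words n. word_congruence (Suc n) R w (replicate m (n, c) @ v)"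
  using assms(2)
proof (induction w rule: rev_induct)
  case Nil
  then show ?case
    by (intro exI[of _ "0::nat"] exI[of _ True] bexI[of _ "[]"]) (auto intro: word_congruence.refl)
next
  case (snoc l w)
  obtain i b where l: "l = (i, b)" by force
  obtain m c v where v: "v \<in> free_words n" "word_congruence (Suc n) R w (replicate m (n, c) @ v)"
    using snoc by auto
  have 1: "word_congruence (Suc n) R (w @ [l]) ((replicate m (n, c) @ v) @ [l])"
    using v(2) snoc.prems by (intro word_congruence_appR) auto
  show ?case
  proof (cases "i = n")
    case False
    then have "v @ [l] \<in> free_words n" using v(1) snoc.prems l by auto
    moreover have "word_congruence (Suc n) R (w @ [l]) (replicate m (n, c) @ (v @ [l]))"
      using 1 by simp
    ultimately show ?thesis by blast
  next
    case True
    obtain v' where v': "v' \<in> free_words n" "word_congruence (Suc n) R (v @ [(n, b)]) ((n, b) # v')"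
      using word_congruence_shift[OF step v(1)] by blast
    have 2: "word_congruence (Suc n) R (replicate m (n, c) @ (v @ [(n, b)])) (replicate m (n, c) @ ((n, b) # v'))"
      using v'(2) by (intro word_congruence_appL) auto
    have 3: "word_congruence (Suc n) R (w @ [l]) (replicate m (n, c) @ ((n, b) # v'))"
      using word_congruence.trans[OF 1, of "replicate m (n, c) @ ((n, b) # v')"] 2 l True by simp
    consider "b = c" | "m = 0" | m' where "m = Suc m'" "c = (\<not> b)" by (metis not0_implies_Suc)
    then show ?thesis
    proof cases
      case 1
      then have "replicate m (n, c) @ ((n, b) # v') = replicate (Suc m) (n, c) @ v'"
        by (simp add: replicate_app_Cons_same)
      with 3 have "word_congruence (Suc n) R (w @ [l]) (replicate (Suc m) (n, c) @ v')" by (simp only:)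
      then show ?thesis using v'(1) by blast
    next
      case 2
      then have "replicate m (n, c) @ ((n, b) # v') = replicate 1 (n, b) @ v'" by simp
      with 3 have "word_congruence (Suc n) R (w @ [l]) (replicate 1 (n, b) @ v')" by (simp only:)
      then show ?thesis using v'(1) by blast
    next
      case m': 3
      have "word_congruence (Suc n) R (replicate m' (n, c) @ ([(n, \<not> b), (n, \<not> \<not> b)] @ v'))
          (replicate m' (n, c) @ ([] @ v'))"
        using v'(1)
        by (intro word_congruence_appL word_congruence_appR word_congruence.cancel) (auto intro: free_words_mono)
      moreover have "replicate m (n, c) @ ((n, b) # v') = replicate m' (n, c) @ ([(n, \<not> b), (n, \<not> \<not> b)] @ v')"
        using m' by (simp add: replicate_app_Cons_same)
      ultimately have "word_congruence (Suc n) R (replicate m (n, c) @ ((n, b) # v')) (replicate m' (n, c) @ v')"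
        by simp
      with 3 have "word_congruence (Suc n) R (w @ [l]) (replicate m' (n, c) @ v')"
        by (rule word_congruence.trans)
      then show ?thesis using v'(1) by blast
    qed
  qed
qed

lemma word_congruence_replicate_mult:
  assumes "word_congruence n R (replicate m l) v" "v \<in> free_words k" "k \<le> n"
  shows "\<exists>v'\<in>free_words k. word_congruence n R (replicate (q * m) l) v'"
proof (induction q)
  case 0
  then show ?case by (intro bexI[of _ "[]"]) (auto intro: word_congruence.refl)
next
  case (Suc q)
  then obtain v' where "v' \<in> free_words k" "word_congruence n R (replicate (q * m) l) v'" by auto
  then show ?case using word_congruence.append[OF assms(1)] assms(2)
    by (intro bexI[of _ "v @ v'"]) (auto simp: replicate_add)
qed

text \<open>New relators record how \<open>t\<close> conjugates the old generators and, if some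
  positive power of \<open>t\<close> lies in \<open>N\<close>, the value of the smallest such power.
  A normal form that evaluates to one has its power of \<open>t\<close> in \<open>N\<close>; the
  power relator turns it into an old word, for which the old relators suffice.\<close>

lemma (in group) presented_by_cyclic_extension:
  assumes p: "presented_by n R g N" and N: "subgroup N G" and t: "t \<in> carrier G"
    and conj: "\<And>x. x \<in> N \<Longrightarrow> t \<otimes> x \<otimes> inv t \<in> N" "\<And>x. x \<in> N \<Longrightarrow> inv t \<otimes> x \<otimes> t \<in> N"
  shows "\<exists>R' g'. presented_by (Suc n) R' g' (cyclic_extension N t)"
proof -
  have R: "finite R" "R \<subseteq> free_words n" and g: "\<forall>i<n. g i \<in> carrier G"
    and im: "word_eval G g ` free_words n = N" and e1: "\<forall>r\<in>R. word_eval G g r = \<one>"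
    and cong: "\<And>w. w \<in> free_words n \<Longrightarrow> word_eval G g w = \<one> \<Longrightarrow> word_congruence n R w []"
    using p by (auto simp: presented_by_def)
  define h where "h = g(n := t)"
  have h: "\<forall>i<Suc n. h i \<in> carrier G" using g t by (simp add: h_def less_Suc_eq)
  have hg: "word_eval G h w = word_eval G g w" if "w \<in> free_words n" for w
    using that by (rule word_eval_cong) (simp add: h_def)
  have mono: "w \<in> free_words (Suc n)" if "w \<in> free_words n" for w
    using that by (rule free_words_mono) simp
  have hn: "h n = t" by (simp add: h_def)
  define s where "s = (\<lambda>c::bool. if c then t else inv t)"
  have s: "s c \<in> carrier G" for c using t by (simp add: s_def)
  have invs: "inv (s c) = s (\<not> c)" for c using t by (simp add: s_def)
  have sconj: "s (\<not> c) \<otimes> x \<otimes> s c \<in> N" if "x \<in> N" for c x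
    using conj[OF that] by (simp add: s_def)
  have pre: "\<exists>w\<in>free_words n. word_eval G g w = x" if "x \<in> N" for x
    using that im by auto
  \<comment> \<open>\<open>W i b c\<close> spells the conjugate of an old letter by \<open>t\<close>
    or its inverse; both signs occur because letters of either sign are moved to the front.\<close>
  define W where "W = (\<lambda>i b c. SOME w. w \<in> free_words n \<and>
    word_eval G g w = s (\<not> c) \<otimes> word_eval G g [(i, b)] \<otimes> s c)"
  have W: "W i b c \<in> free_words n" 
    "word_eval G g (W i b c) = s (\<not> c) \<otimes> word_eval G g [(i, b)] \<otimes> s c" if "i < n" for i b c
  proof -
    have "word_eval G g [(i, b)] \<in> N" using im that by (auto simp del: word_eval.simps)
    from pre[OF sconj[OF this]] have "\<exists>w. w \<in> free_words n \<and>
      word_eval G g w = s (\<not> c) \<otimes> word_eval G g [(i, b)] \<otimes> s c" by blast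
    from someI_ex[OF this] show "W i b c \<in> free_words n" 
    "word_eval G g (W i b c) = s (\<not> c) \<otimes> word_eval G g [(i, b)] \<otimes> s c"
      unfolding W_def by auto
  qed
  \<comment> \<open>Empty exactly when \<open>t\<close> has infinite order modulo \<open>N\<close>;
    then \<open>m0\<close> and \<open>V\<close> carry no information and \<open>Q\<close> adds no
    relator.\<close>
  define M where "M = {m. 0 < m \<and> t [^] (m::nat) \<in> N}"
  define m0 where "m0 = (LEAST m. m \<in> M)"
  define V where "V = (SOME w. w \<in> free_words n \<and> word_eval G g w = t [^] m0)"
  have V: "V \<in> free_words n" "word_eval G g V = t [^] m0" and m0: "0 < m0" if "M \<noteq> {}"
  proof -
    have "m0 \<in> M" unfolding m0_def using that by (meson LeastI ex_in_conv)
    then show "0 < m0" by (simp add: M_def)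
    have "\<exists>w. w \<in> free_words n \<and> word_eval G g w = t [^] m0"
      using pre \<open>m0 \<in> M\<close> by (auto simp: M_def)
    from someI_ex[OF this] show "V \<in> free_words n" "word_eval G g V = t [^] m0"
      unfolding V_def by auto
  qed
  define rel where "rel = (\<lambda>(i, b, c). [(i, b), (n, c)] @ word_inverse (W i b c) @ [(n, \<not> c)])"
  define Q where "Q = (if M = {} then {} else {replicate m0 (n, True) @ word_inverse V})"
  define R' where "R' = R \<union> rel ` ({..<n} \<times> UNIV \<times> UNIV) \<union> Q"
  have R'in: "R' \<subseteq> free_words (Suc n)"
  proof -
    have "R \<subseteq> free_words (Suc n)" using R(2) mono by blast
    moreover have "rel ` ({..<n} \<times> UNIV \<times> UNIV) \<subseteq> free_words (Suc n)"
      using mono[OF W(1)] by (auto simp: rel_def)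
    moreover have "Q \<subseteq> free_words (Suc n)"
      using mono[OF V(1)] by (simp add: Q_def)
    ultimately show ?thesis by (simp add: R'_def)
  qed
  have RR': "R \<subseteq> R'" by (auto simp: R'_def)
  have ev1: "word_eval G h [(i, b)] = word_eval G g [(i, b)]" if "i < n" for i b
    using that by (intro hg) auto
  have evn: "word_eval G h [(n, c)] = s c" for c using t by (simp add: hn s_def)
  have gin: "word_eval G g w \<in> carrier G" if "w \<in> free_words n" for w
    using that g by (rule word_eval_closed)
  have R'1: "\<forall>r\<in>R'. word_eval G h r = \<one>"
  proof
    fix r assume "r \<in> R'"
    then consider "r \<in> R" | i b c where "i < n" "r = rel (i, b, c)" 
      | "M \<noteq> {}" "r = replicate m0 (n, True) @ word_inverse V"
      by (auto simp: R'_def Q_def split: if_splits)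
    then show "word_eval G h r = \<one>"
    proof cases
      case 1
      then show ?thesis using R(2) e1 hg by auto
    next
      case 2
      let ?x = "word_eval G g [(i, b)]"
      have x: "?x \<in> carrier G" using 2 by (intro gin) auto
      have "word_eval G h r = word_eval G h ([(i, b)] @ [(n, c)] @ word_inverse (W i b c) @ [(n, \<not> c)])"
        by (simp add: 2 rel_def)
      also have "\<dots> = ?x \<otimes> (s c \<otimes> (inv (s (\<not> c) \<otimes> ?x \<otimes> s c) \<otimes> s (\<not> c)))"
        using 2 W[OF 2(1), of b c] mono
        by (subst word_eval_append[OF _ _ h], simp, simp)+
           (simp only: ev1 evn hg word_inverse_in word_eval_inverse[OF W(1)[OF 2(1)] g] W(2)[OF 2(1)])
      also have "inv (s (\<not> c) \<otimes> ?x \<otimes> s c) = s (\<not> c) \<otimes> inv ?x \<otimes> s c"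
        using x s by (simp add: inv_mult_group invs m_assoc)
      also have "?x \<otimes> (s c \<otimes> (s (\<not> c) \<otimes> inv ?x \<otimes> s c \<otimes> s (\<not> c))) = \<one>"
      proof -
        have i: "s c \<otimes> s (\<not> c) = \<one>" using s[of c] by (simp flip: invs)
        have "s c \<otimes> (s (\<not> c) \<otimes> inv ?x \<otimes> s c \<otimes> s (\<not> c)) = (s c \<otimes> s (\<not> c)) \<otimes> inv ?x \<otimes> (s c \<otimes> s (\<not> c))"
          using x s by (simp add: m_assoc del: word_eval.simps)
        then show ?thesis using x by (simp add: i del: word_eval.simps)
      qed
      finally show ?thesis .
    next
      case 3
      have "word_eval G h r = t [^] m0 \<otimes> inv (t [^] m0)"
        using 3 V[OF 3(1)] mono h t g hn
        by (simp add: word_eval_append[OF _ _ h] word_eval_replicate hg word_eval_inverse)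
      then show ?thesis using t by simp
    qed
  qed
  let ?wc = "word_congruence (Suc n) R'"
  have move: "?wc u v" if "?wc (u @ word_inverse v) []" "u \<in> free_words (Suc n)" "v \<in> free_words (Suc n)" for u v
  proof -
    have 1: "?wc ((u @ word_inverse v) @ v) ([] @ v)" using that by (intro word_congruence_appR) auto
    have 2: "?wc (u @ (word_inverse v @ v)) (u @ [])"
      using that by (intro word_congruence_appL word_congruence_inverse) auto
    show ?thesis using word_congruence.trans[OF word_congruence.sym[OF 2], of v] 1 by simp
  qed
  have step: "\<exists>v\<in>free_words n. ?wc [(i, b), (n, c)] ((n, c) # v)" if "i < n" for i b c
  proof -
    have "rel (i, b, c) \<in> R'" using that by (auto simp: R'_def)
    then have "?wc (rel (i, b, c)) []" using R'in by (intro word_congruence.relator) auto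
    moreover have "rel (i, b, c) = [(i, b), (n, c)] @ word_inverse ((n, c) # W i b c)"
      by (simp add: rel_def word_inverse_def)
    ultimately have "?wc ([(i, b), (n, c)] @ word_inverse ((n, c) # W i b c)) []" by simp
    then have "?wc [(i, b), (n, c)] ((n, c) # W i b c)"
      by (rule move) (use mono[OF W(1)[OF that]] that in auto)
    then show ?thesis using W(1)[OF that] by blast
  qed
  have tpow: "\<exists>v\<in>free_words n. ?wc (replicate m (n, c)) v" if "s c [^] m \<in> N" for m c
  proof (cases "m = 0")
    case True
    then show ?thesis by (intro bexI[of _ "[]"]) (auto intro: word_congruence.refl)
  next
    case False
    have tm: "t [^] m \<in> N"
    proof (cases c)
      case False
      then have "inv (t [^] m) \<in> N" using that t by (simp add: s_def nat_pow_inv)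
      then show ?thesis using N t by (metis inv_inv nat_pow_closed subgroup.m_inv_closed)
    qed (use that in \<open>simp add: s_def\<close>)
    then have M: "M \<noteq> {}" using False by (auto simp: M_def)
    \<comment> \<open>Division with remainder: a nonzero remainder would be a smaller exponent in
      \<open>M\<close>.\<close>
    have dvd: "m0 dvd m"
    proof (rule ccontr)
      assume "\<not> m0 dvd m"
      then have pos: "0 < m mod m0" by (simp add: dvd_eq_mod_eq_0)
      have lt: "m mod m0 < m0" using m0[OF M] by simp
      have "t [^] m0 \<in> N" using V[OF M] im by force
      then have q: "(t [^] m0) [^] (k::nat) \<in> N" for k
        by (induction k) (use N in \<open>auto intro: subgroup.one_closed subgroup.m_closed\<close>)
      have "t [^] m = (t [^] m0) [^] (m div m0) \<otimes> t [^] (m mod m0)"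
        using t by (simp add: nat_pow_pow nat_pow_mult)
      then have "t [^] (m mod m0) = inv ((t [^] m0) [^] (m div m0)) \<otimes> t [^] m"
        using t by (simp add: inv_solve_left)
      then have "t [^] (m mod m0) \<in> N" using N q tm by (simp add: subgroup.m_closed subgroup.m_inv_closed)
      then have "m mod m0 \<in> M" using pos by (simp add: M_def)
      then have "m0 \<le> m mod m0" unfolding m0_def by (rule Least_le)
      then show False using lt by simp
    qed
    have rT: "?wc (replicate m0 (n, True)) V"
    proof -
      have "replicate m0 (n, True) @ word_inverse V \<in> R'" using M by (simp add: R'_def Q_def)
      then have "?wc (replicate m0 (n, True) @ word_inverse V) []"
        using R'in by (intro word_congruence.relator) auto
      then show ?thesis by (rule move) (use mono[OF V(1)[OF M]] in auto)
    qed
    \<comment> \<open>For the inverse letter the power relator is inverted within the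
      congruence.\<close>
    have "\<exists>v\<in>free_words n. ?wc (replicate m0 (n, c)) v"
    proof (cases c)
      case False
      have inv: "word_inverse (replicate m0 (n, True)) = replicate m0 (n, False)"
        by (simp add: word_inverse_def)
      have "?wc (replicate m0 (n, False) @ replicate m0 (n, True)) []"
        using word_congruence_inverse[of "replicate m0 (n, True)" "Suc n" R'] by (simp add: inv)
      moreover have "?wc (replicate m0 (n, False) @ replicate m0 (n, True)) (replicate m0 (n, False) @ V)"
        using rT by (intro word_congruence_appL) auto
      ultimately have "?wc (replicate m0 (n, False) @ V) []"
        by (metis word_congruence.sym word_congruence.trans)
      moreover have "word_inverse (word_inverse V) = V"
        by (simp add: word_inverse_def rev_map case_prod_beta comp_def)
      ultimately have "?wc (replicate m0 (n, False) @ word_inverse (word_inverse V)) []" by simp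
      then have "?wc (replicate m0 (n, False)) (word_inverse V)"
        by (rule move) (use mono[OF V(1)[OF M]] in auto)
      then show ?thesis using False V(1)[OF M] by auto
    qed (use rT V(1)[OF M] in auto)
    then obtain v where v: "v \<in> free_words n" "?wc (replicate m0 (n, c)) v" by blast
    from word_congruence_replicate_mult[OF v(2,1), of "m div m0"] show ?thesis using dvd by simp
  qed
  have main: "?wc w []" if w: "w \<in> free_words (Suc n)" and e: "word_eval G h w = \<one>" for w
  proof -
    obtain m c v where v: "v \<in> free_words n" "?wc w (replicate m (n, c) @ v)"
      using word_congruence_normal_form[OF step w] by blast
    have "word_eval G h (replicate m (n, c) @ v) = \<one>"
      using word_congruence_eval[OF v(2) h R'1] e by simp
    then have 0: "s c [^] m \<otimes> word_eval G g v = \<one>"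
      using v(1) mono t by (cases c) (simp_all add: word_eval_append[OF _ _ h] word_eval_replicate hg hn s_def)
    have "word_eval G g v \<in> N" using v(1) im by auto
    moreover have "s c [^] m = inv (word_eval G g v)"
      using 0 gin[OF v(1)] s by (simp add: inv_equality)
    ultimately have "s c [^] m \<in> N" using N by (simp add: subgroup.m_inv_closed)
    from tpow[OF this] obtain v' where v': "v' \<in> free_words n" "?wc (replicate m (n, c)) v'" by blast
    have "?wc (replicate m (n, c) @ v) (v' @ v)"
      using v' mono[OF v(1)] mono[OF v'(1)] by (intro word_congruence_appR) auto
    then have w': "?wc w (v' @ v)" by (rule word_congruence.trans[OF v(2)])
    have "word_eval G g (v' @ v) = \<one>"
      using word_congruence_eval[OF w' h R'1] e hg[of "v' @ v"] v(1) v'(1) by simp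
    then have "word_congruence n R (v' @ v) []" using v(1) v'(1) by (intro cong) auto
    then have "?wc (v' @ v) []" by (rule word_congruence_mono) (use RR' in auto)
    with w' show ?thesis by (rule word_congruence.trans)
  qed
  have image: "word_eval G h ` free_words (Suc n) = cyclic_extension N t"
  proof
    show "word_eval G h ` free_words (Suc n) \<subseteq> cyclic_extension N t"
    proof safe
      fix w assume w: "w \<in> free_words (Suc n)"
      obtain m c v where v: "v \<in> free_words n" "?wc w (replicate m (n, c) @ v)"
        using word_congruence_normal_form[OF step w] by blast
      have "word_eval G h w = s c [^] m \<otimes> word_eval G g v"
        using word_congruence_eval[OF v(2) h R'1] v(1) mono t
        by (cases c) (simp_all add: word_eval_append[OF _ _ h] word_eval_replicate hg hn s_def)
      moreover have "s c [^] m = t [^] (if c then int m else - int m)"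
        using t by (simp add: s_def int_pow_int int_pow_neg nat_pow_inv)
      ultimately have "word_eval G h w = t [^] (if c then int m else - int m) \<otimes> word_eval G g v"
        by simp
      moreover have "word_eval G g v \<in> N" using v(1) im by blast
      ultimately show "word_eval G h w \<in> cyclic_extension N t"
        unfolding cyclic_extension_def by blast
    qed
    show "cyclic_extension N t \<subseteq> word_eval G h ` free_words (Suc n)"
    proof
      fix y assume "y \<in> cyclic_extension N t"
      then obtain k :: int and x where y: "y = t [^] k \<otimes> x" "x \<in> N" by (auto simp: cyclic_extension_def)
      obtain v where v: "v \<in> free_words n" "word_eval G g v = x" using pre[OF y(2)] by blast
      define w where "w = replicate (nat \<bar>k\<bar>) (n, 0 \<le> k) @ v"
      have "word_eval G h (replicate (nat \<bar>k\<bar>) (n, 0 \<le> k)) = t [^] k"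
      proof (cases "0 \<le> k")
        case True
        then obtain m where "k = int m" using zero_le_imp_eq_int by blast
        then show ?thesis using t by (simp add: word_eval_replicate hn int_pow_int)
      next
        case False
        define m where "m = nat (- k)"
        have "k = - int m" "m \<noteq> 0" using False by (auto simp: m_def)
        moreover have "t [^] (- int m) = inv t [^] m"
          using t by (simp add: int_pow_neg int_pow_int nat_pow_inv)
        ultimately show ?thesis using t by (simp add: word_eval_replicate hn)
      qed
      then have "word_eval G h w = y"
        using v mono by (simp add: w_def word_eval_append[OF _ _ h] hg y)
      moreover have "w \<in> free_words (Suc n)" using v mono by (simp add: w_def)
      ultimately show "y \<in> word_eval G h ` free_words (Suc n)" by blast
    qed
  qed
  have fin: "finite R'" unfolding R'_def Q_def using R(1) by simp
  have "presented_by (Suc n) R' h (cyclic_extension N t)"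
    unfolding presented_by_def by (intro conjI fin R'in h image R'1 ballI impI main)
  then show ?thesis by blast
qed

section \<open>Polycyclic groups\<close>

lemma (in group) presented_by_imp_subgroup:
  assumes "presented_by n R g H"
  shows "subgroup H G"
proof -
  have g: "\<forall>i<n. g i \<in> carrier G" and im: "H = word_eval G g ` free_words n"
    using assms by (auto simp: presented_by_def)
  show ?thesis
  proof (rule subgroupI)
    show "H \<subseteq> carrier G" using g by (auto simp: im)
    show "H \<noteq> {}" using free_words_Nil[of n] im by blast
    fix x assume "x \<in> H"
    then obtain u where u: "u \<in> free_words n" "x = word_eval G g u" by (auto simp: im)
    then have "inv x = word_eval G g (word_inverse u)" using g by (simp add: word_eval_inverse)
    then show "inv x \<in> H" using u by (auto simp: im)
    fix y assume "y \<in> H"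
    then obtain v where v: "v \<in> free_words n" "y = word_eval G g v" by (auto simp: im)
    then have "x \<otimes> y = word_eval G g (u @ v)" using u g by (simp add: word_eval_append)
    then show "x \<otimes> y \<in> H" using u v im by (metis free_words_append imageI)
  qed
qed

text \<open>Conjugation is required to preserve \<open>N\<close> in both directions, because one
  inclusion alone allows \<open>t\<close> to carry \<open>N\<close> onto a proper subgroup of
  itself.\<close>

inductive (in group) polycyclic :: "'a set \<Rightarrow> bool" where
  trivial: "polycyclic {\<one>}"
| extension: "polycyclic N \<Longrightarrow> t \<in> carrier G \<Longrightarrow> (\<And>x. x \<in> N \<Longrightarrow> t \<otimes> x \<otimes> inv t \<in> N) \<Longrightarrow>
    (\<And>x. x \<in> N \<Longrightarrow> inv t \<otimes> x \<otimes> t \<in> N) \<Longrightarrow> polycyclic (cyclic_extension N t)"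

lemma (in group) polycyclic_presented:
  "polycyclic H \<Longrightarrow> \<exists>n R g. presented_by n R g H"
proof (induction rule: polycyclic.induct)
  case trivial
  show ?case using presented_by_trivial by blast
next
  case (extension N t)
  then show ?case using presented_by_cyclic_extension presented_by_imp_subgroup by metis
qed

lemma (in group) polycyclic_imp_subgroup: "polycyclic H \<Longrightarrow> subgroup H G"
  using polycyclic_presented presented_by_imp_subgroup by blast

lemma (in group) polycyclic_imp_finitely_presented:
  "polycyclic H \<Longrightarrow> finitely_presented (G\<lparr>carrier := H\<rparr>)"
  using polycyclic_presented presented_by_imp_subgroup presented_by_imp_finitely_presented by blast

text \<open>A subgroup between \<open>N\<close> and \<open>K\<close> contains all commutators of
  \<open>K\<close>, hence is normal in \<open>K\<close>, so the elements of \<open>F\<close> can be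
  adjoined one at a time, each by a cyclic extension.\<close>

lemma (in group) polycyclic_if_fg_over_commutators:
  assumes N: "polycyclic N" and K: "subgroup K G" "N \<subseteq> K" and F: "finite F" "F \<subseteq> K"
    and comm: "\<And>x y. x \<in> K \<Longrightarrow> y \<in> K \<Longrightarrow> x \<otimes> y \<otimes> inv x \<otimes> inv y \<in> N"
    and gen: "\<And>S. subgroup S G \<Longrightarrow> N \<subseteq> S \<Longrightarrow> F \<subseteq> S \<Longrightarrow> K \<subseteq> S"
  shows "polycyclic K"
proof -
  have "\<exists>M. polycyclic M \<and> N \<subseteq> M \<and> M \<subseteq> K \<and> F \<subseteq> M" using F
  proof (induction rule: finite_induct)
    case empty
    show ?case using N K by blast
  next
    case (insert t F)
    then obtain M where M: "polycyclic M" "N \<subseteq> M" "M \<subseteq> K" "F \<subseteq> M" and tK: "t \<in> K" by auto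
    have sM: "subgroup M G" using polycyclic_imp_subgroup[OF M(1)] .
    have t: "t \<in> carrier G" by (rule subgroup.mem_carrier[OF K(1) tK])
    have conj: "s \<otimes> x \<otimes> inv s \<in> M" if x: "x \<in> M" and s: "s \<in> K" for x s
    proof -
      have "x \<in> K" using x M(3) by blast
      then have c: "s \<in> carrier G" "x \<in> carrier G"
        using subgroup.mem_carrier[OF K(1)] s by auto
      have "s \<otimes> x \<otimes> inv s \<otimes> inv x \<in> M" 
        using comm[OF s \<open>x \<in> K\<close>] M(2) by blast
      then have "(s \<otimes> x \<otimes> inv s \<otimes> inv x) \<otimes> x \<in> M" using x by (rule subgroup.m_closed[OF sM])
      then show ?thesis using c by (simp add: m_assoc)
    qed
    have "inv t \<in> K" by (rule subgroup.m_inv_closed[OF K(1) tK])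
    then have "polycyclic (cyclic_extension M t)"
      using conj[OF _ tK] conj[of _ "inv t"] t M(1) by (intro polycyclic.extension) auto
    moreover have "M \<subseteq> cyclic_extension M t"
    proof
      fix x assume x: "x \<in> M"
      then have "x = t [^] (0::int) \<otimes> x" using subgroup.mem_carrier[OF sM x] by simp
      then show "x \<in> cyclic_extension M t" using x unfolding cyclic_extension_def by blast
    qed
    moreover have "t \<in> cyclic_extension M t"
    proof -
      have "t = t [^] (1::int) \<otimes> \<one>" using t by (simp add: int_pow_1)
      then show ?thesis using subgroup.one_closed[OF sM] unfolding cyclic_extension_def by blast
    qed
    moreover have "cyclic_extension M t \<subseteq> K"
      using K(1) tK M(3) unfolding cyclic_extension_def
      by (auto intro!: subgroup.m_closed subgroup_int_pow_closed)
    ultimately show ?case using M by (intro exI[of _ "cyclic_extension M t"]) auto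
  qed
  then obtain M where M: "polycyclic M" "N \<subseteq> M" "M \<subseteq> K" "F \<subseteq> M" by blast
  then have "K = M" using gen[OF polycyclic_imp_subgroup[OF M(1)]] by blast
  then show ?thesis using M by simp
qed

lemma finitely_presented_iso:
  assumes "finitely_presented G" "group G" "G \<cong> H"
  shows "finitely_presented H"
proof -
  obtain n R where "finite R" "R \<subseteq> carrier (free_group n)"
    "G \<cong> free_group n Mod normal_closure (free_group n) R"
    using assms(1) by (auto simp: finitely_presented_def)
  moreover have "H \<cong> G" using assms(2,3) by (simp add: group.iso_sym)
  ultimately show ?thesis unfolding finitely_presented_def using iso_trans by blast
qed

section \<open>Discrete additive subgroups\<close>

text \<open>Discreteness in its locally finite form, which is what bounds on matrix entries deliver
  and what the choice of shortest vectors uses.\<close>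

locale discrete_additive =
  fixes L :: "'a::euclidean_space set"
  assumes zero: "0 \<in> L"
    and diff: "\<And>x y. x \<in> L \<Longrightarrow> y \<in> L \<Longrightarrow> x - y \<in> L"
    and fin: "\<And>r. finite {x \<in> L. norm x \<le> r}"

lemma additive_closure:
  fixes S :: "'a::real_vector set"
  assumes "0 \<in> S" "\<And>x y. x \<in> S \<Longrightarrow> y \<in> S \<Longrightarrow> x - y \<in> S"
  shows "\<And>x. x \<in> S \<Longrightarrow> - x \<in> S" "\<And>x y. x \<in> S \<Longrightarrow> y \<in> S \<Longrightarrow> x + y \<in> S"
    "\<And>x k. x \<in> S \<Longrightarrow> real_of_int k *\<^sub>R x \<in> S"
    "\<And>f B. (\<And>b. b \<in> B \<Longrightarrow> f b \<in> S) \<Longrightarrow> sum f B \<in> S"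
proof -
  show m: "- x \<in> S" if "x \<in> S" for x using assms(2)[OF assms(1) that] by simp
  show p: "x + y \<in> S" if "x \<in> S" "y \<in> S" for x y using assms(2)[OF that(1) m[OF that(2)]] by simp
  have n: "real n *\<^sub>R x \<in> S" if "x \<in> S" for x n
    using that by (induction n) (auto simp: assms(1) p scaleR_add_left)
  show "real_of_int k *\<^sub>R x \<in> S" if x: "x \<in> S" for x k
  proof (cases "0 \<le> k")
    case True
    then show ?thesis using n[OF x, of "nat k"] by simp
  next
    case False
    then show ?thesis using m[OF n[OF x, of "nat (- k)"]] by simp
  qed
  show "sum f B \<in> S" if "\<And>b. b \<in> B \<Longrightarrow> f b \<in> S" for f B
    using that by (induction B rule: infinite_finite_induct) (auto simp: assms(1) p)
qed

text \<open>Subtracting the integer parts of the coordinates with respect to a maximal independent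
  subset \<open>B\<close> moves every element into a fixed ball, and that ball contains only
  finitely many elements.\<close>

lemma (in discrete_additive) finitely_generated:
  obtains F where "finite F" "F \<subseteq> L"
    "\<And>S. 0 \<in> S \<Longrightarrow> (\<And>x y. x \<in> S \<Longrightarrow> y \<in> S \<Longrightarrow> x - y \<in> S) \<Longrightarrow> F \<subseteq> S \<Longrightarrow> L \<subseteq> S"
proof -
  obtain B where B: "B \<subseteq> L" "independent B" "L \<subseteq> span B"
    using maximal_independent_subset[of L] by blast
  have fB: "finite B" using independent_imp_finite B(2) by blast
  define F where "F = B \<union> {x \<in> L. norm x \<le> (\<Sum>b\<in>B. norm b)}"
  show thesis
  proof
    show "finite F" using fB fin by (simp add: F_def)
    show "F \<subseteq> L" using B(1) by (auto simp: F_def)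
    fix S :: "'a set"
    assume S: "0 \<in> S" "\<And>x y. x \<in> S \<Longrightarrow> y \<in> S \<Longrightarrow> x - y \<in> S" "F \<subseteq> S"
    show "L \<subseteq> S"
    proof
      fix x assume x: "x \<in> L"
      then have "x \<in> range (\<lambda>u. \<Sum>v\<in>B. u v *\<^sub>R v)" using B(3) span_finite[OF fB] by auto
      then obtain u where u: "x = (\<Sum>v\<in>B. u v *\<^sub>R v)" by auto
      define y where "y = (\<Sum>v\<in>B. real_of_int \<lfloor>u v\<rfloor> *\<^sub>R v)"
      have "y \<in> L" unfolding y_def using B(1) by (intro additive_closure[of L] zero diff) auto
      have yS: "y \<in> S" unfolding y_def using S(3)
        by (intro additive_closure[of S] S(1,2)) (auto simp: F_def)
      have "norm (x - y) = norm (\<Sum>v\<in>B. (u v - \<lfloor>u v\<rfloor>) *\<^sub>R v)"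
        by (simp add: u y_def sum_subtractf scaleR_diff_left)
      also have "\<dots> \<le> (\<Sum>v\<in>B. norm ((u v - \<lfloor>u v\<rfloor>) *\<^sub>R v))" by (rule norm_sum)
      also have "\<dots> \<le> (\<Sum>v\<in>B. norm v)"
      proof (rule sum_mono)
        fix v
        have "\<bar>u v - \<lfloor>u v\<rfloor>\<bar> \<le> 1" by linarith
        then show "norm ((u v - \<lfloor>u v\<rfloor>) *\<^sub>R v) \<le> norm v" by (simp add: mult_left_le_one_le)
      qed
      finally have "x - y \<in> F" using diff[OF x \<open>y \<in> L\<close>] by (simp add: F_def)
      then have "x - y + y \<in> S" using S(3) yS by (intro additive_closure(2)[OF S(1,2)]) auto
      then show "x \<in> S" by simp
    qed
  qed
qed

lemma (in discrete_additive) minimal_norm: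
  assumes "x \<in> L" "P x"
  obtains a where "a \<in> L" "P a" "\<And>y. y \<in> L \<Longrightarrow> P y \<Longrightarrow> norm a \<le> norm y"
proof -
  let ?A = "{y \<in> L. norm y \<le> norm x} \<inter> {y. P y}"
  have f: "finite ?A" "?A \<noteq> {}" using fin assms by auto
  obtain a where a: "a \<in> ?A" "\<And>y. y \<in> ?A \<Longrightarrow> norm a \<le> norm y"
    using ex_min_if_finite[of "norm ` ?A"] f by (auto simp: not_less)
  then show thesis by (intro that[of a]) (auto, force)
qed

text \<open>Gauss reduction of a planar lattice: \<open>a\<close> is a shortest nonzero vector and
  \<open>b\<close> a shortest one off the real line through \<open>a\<close>. The number two is what
  later bounds the rank.\<close>

lemma discrete_complex_two_generators:
  fixes W :: "complex set"
  assumes "discrete_additive W"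
  obtains a b where "a \<in> W" "b \<in> W" "\<And>w. w \<in> W \<Longrightarrow> \<exists>i j::int. w = of_int i * a + of_int j * b"
proof -
  interpret discrete_additive W by fact
  have int: "of_int k * x \<in> W" if "x \<in> W" for k x
    using additive_closure(3)[of W x k] zero diff that by (simp add: scaleR_conv_of_real)
  show thesis
  proof (cases "W = {0}")
    case True
    then show thesis using that[of 0 0] by auto
  next
    case False
    then obtain x where "x \<in> W" "x \<noteq> 0" using zero by auto
    then obtain a where a: "a \<in> W" "a \<noteq> 0" "\<And>y. y \<in> W \<Longrightarrow> y \<noteq> 0 \<Longrightarrow> norm a \<le> norm y"
      using minimal_norm[of x "\<lambda>y. y \<noteq> 0"] by metis
    have real: "\<exists>i::int. w = of_int i * a" if w: "w \<in> W" "Im (w / a) = 0" for w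
    proof -
      define s where "s = Re (w / a)"
      have "w / a = of_real s" using w(2) by (simp add: s_def complex_eq_iff)
      then have ws: "w = of_real s * a" using a(2) by (simp add: field_simps)
      have "w - of_int (round s) * a \<in> W" by (intro diff int w(1) a(1))
      moreover have "w - of_int (round s) * a = of_real (s - round s) * a"
        by (simp add: ws algebra_simps)
      moreover have "norm (of_real (s - round s) * a) < norm a"
        using of_int_round_abs_le[of s] a(2) by (simp add: norm_mult abs_minus_commute mult_less_cancel_right2 flip: of_real_diff)
      ultimately have "w - of_int (round s) * a = 0" using a(3) by (metis not_le)
      then show ?thesis by auto
    qed
    show thesis
    proof (cases "\<exists>w\<in>W. Im (w / a) \<noteq> 0")
      case False
      then show thesis using real a zero that[of a 0] by fastforce
    next
      case True
      then obtain b where b: "b \<in> W" "Im (b / a) \<noteq> 0"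
        "\<And>y. y \<in> W \<Longrightarrow> Im (y / a) \<noteq> 0 \<Longrightarrow> norm b \<le> norm y"
        using minimal_norm[of _ "\<lambda>y. Im (y / a) \<noteq> 0"] by metis
      define z where "z = b / a"
      have "b \<noteq> 0" using b(2) by auto
      then have z1: "1 \<le> cmod z" using a(2) a(3)[OF b(1)] by (simp add: z_def norm_divide)
      have Imz: "Im z \<noteq> 0" using b(2) by (simp add: z_def)
      have "\<exists>i j::int. w = of_int i * a + of_int j * b" if w: "w \<in> W" for w
      proof -
        \<comment> \<open>Real coordinates of \<open>w\<close> with respect to \<open>a\<close> and
          \<open>b\<close>; rounding leaves remainders \<open>s'\<close> and \<open>t'\<close> of
          modulus at most 1/2.\<close>
        define t where "t = Im (w / a) / Im z"
        define s where "s = Re (w / a) - t * Re z"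
        have wst: "w / a = of_real s + of_real t * z"
          using Imz by (simp add: s_def t_def complex_eq_iff)
        define s' t' where "s' = s - round s" and "t' = t - round t"
        define v where "v = w - of_int (round s) * a - of_int (round t) * b"
        have vW: "v \<in> W" unfolding v_def by (intro diff int w a(1) b(1))
        have va: "v / a = of_real s' + of_real t' * z"
          using wst a(2) by (simp add: v_def s'_def t'_def z_def diff_divide_distrib add_divide_distrib algebra_simps)
        have st: "\<bar>s'\<bar> \<le> 1/2" "\<bar>t'\<bar> \<le> 1/2"
          using of_int_round_abs_le[of s] of_int_round_abs_le[of t] by (auto simp: s'_def t'_def abs_minus_commute)
        have "t' = 0"
        proof (rule ccontr)
          assume "t' \<noteq> 0"
          then have "Im (v / a) \<noteq> 0" using Imz by (simp add: va)
          then have "norm b \<le> norm v" using b(3) vW by blast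
          then have "cmod z \<le> cmod (v / a)" using a(2) by (simp add: z_def norm_divide divide_right_mono)
          then have "(cmod z)\<^sup>2 \<le> (cmod (v / a))\<^sup>2" by (simp add: power_mono)
          also have "\<dots> = s'\<^sup>2 + 2 * (s' * t') * Re z + t'\<^sup>2 * (cmod z)\<^sup>2"
            unfolding va cmod_power2 by (simp add: power2_eq_square algebra_simps)
          also have "\<dots> \<le> 1/4 + \<bar>Re z\<bar> / 2 + (cmod z)\<^sup>2 / 4"
          proof -
            have "s'\<^sup>2 \<le> (1/2)\<^sup>2" "t'\<^sup>2 \<le> (1/2)\<^sup>2" using st by (simp_all add: abs_le_square_iff[symmetric])
            then have "s'\<^sup>2 \<le> 1/4" "t'\<^sup>2 \<le> 1/4" by (simp_all add: power2_eq_square)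
            moreover from this(2) have "t'\<^sup>2 * (cmod z)\<^sup>2 \<le> (1/4) * (cmod z)\<^sup>2"
              by (rule mult_right_mono) simp
            moreover have "\<bar>s' * t'\<bar> \<le> 1/4"
              using mult_mono[OF st] by (simp add: abs_mult)
            then have "\<bar>s' * t' * Re z\<bar> \<le> (1/4) * \<bar>Re z\<bar>"
              unfolding abs_mult[of "s' * t'"] by (rule mult_right_mono) simp
            then have "2 * (s' * t') * Re z \<le> \<bar>Re z\<bar> / 2" by linarith
            ultimately show ?thesis by linarith
          qed
          \<comment> \<open>Strict because \<open>Im z\<close> is nonzero. As \<open>cmod z\<close>
            is at least 1, the bound is then less than (1/4 + 1/2 + 1/4) times its square, a
            contradiction.\<close>
          also have "\<bar>Re z\<bar> < cmod z" using Imz by (simp add: cmod_def real_less_rsqrt)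
          finally have "(cmod z)\<^sup>2 < 1/4 + cmod z / 2 + (cmod z)\<^sup>2 / 4" by simp
          moreover have "cmod z \<le> (cmod z)\<^sup>2" "1 \<le> (cmod z)\<^sup>2" using z1 by (simp_all add: self_le_power)
          ultimately show False by linarith
        qed
        then have "Im (v / a) = 0" by (simp add: va)
        then obtain i :: int where "v = of_int i * a" using real vW by blast
        then have "w = of_int (i + round s) * a + of_int (round t) * b" by (simp add: v_def algebra_simps)
        then show ?thesis by blast
      qed
      then show thesis using that a b by blast
    qed
  qed
qed

section \<open>Groups of block matrices\<close>

text \<open>Dirichlet approximation of the angle. The product bound is the point: an entry growing
  linearly in \<open>q\<close> stays bounded after multiplication by
  \<open>w ^ q - 1\<close>.\<close>

lemma unit_power_near_one:
  fixes w :: complex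
  assumes "cmod w = 1" "N > 0"
  obtains q :: nat where "q > 0" "real q * cmod (w ^ q - 1) \<le> 2 * pi" "cmod (w ^ q - 1) < 2 * pi / real N"
proof -
  obtain t where t: "w = exp (\<i> * of_real t)"
    using assms(1) by (metis cis_conv_exp complex_norm_eq_1_exp)
  obtain h k :: int where hk: "0 < k" "k \<le> int N" "\<bar>of_int k * (t / (2 * pi)) - of_int h\<bar> < 1 / N"
    using Dirichlet_approx[OF assms(2), of "t / (2 * pi)"] by blast
  define q where "q = nat k"
  have q: "0 < q" "real q = of_int k" "q \<le> N" using hk by (auto simp: q_def)
  define s where "s = q * t - 2 * pi * h"
  have s: "\<bar>s\<bar> < 2 * pi / N"
  proof -
    have "s = 2 * pi * (of_int k * (t / (2 * pi)) - of_int h)"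
      by (simp add: s_def q field_simps)
    then have "\<bar>s\<bar> = 2 * pi * \<bar>of_int k * (t / (2 * pi)) - of_int h\<bar>" by (simp add: abs_mult)
    then show ?thesis using mult_strict_left_mono[OF hk(3), of "2 * pi"] by simp
  qed
  have "w ^ q = exp (\<i> * of_real (q * t))" by (simp add: t exp_of_nat_mult[symmetric] algebra_simps)
  also have "\<dots> = exp (\<i> * of_real s + of_int h * (of_real (2 * pi) * \<i>))"
    by (simp add: s_def algebra_simps)
  also have "\<dots> = exp (\<i> * of_real s)" by (simp add: exp_add exp_integer_2pi mult_ac)
  finally have "cmod (w ^ q - 1) = 2 * \<bar>sin (s / 2)\<bar>" by (simp add: dist_exp_i_1)
  also have "\<dots> \<le> \<bar>s\<bar>" using abs_sin_x_le_abs_x[of "s / 2"] by simp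
  finally have le: "cmod (w ^ q - 1) \<le> \<bar>s\<bar>" .
  have "q * cmod (w ^ q - 1) \<le> N * (2 * pi / N)"
    using le s q(3) by (intro mult_mono) auto
  then show thesis using that[of q] q(1) le s assms(2) by auto
qed

text \<open>\<open>(n, a, b, c)\<close> stands for the matrix with rows (1, a, b), (0, 1, c), (0, 0,
  n), that is, a triangular matrix whose equal first two diagonal entries are scaled to 1.
  \<open>par\<close> is what non-diagonalizability leaves in these coordinates.\<close>

locale block_group =
  fixes S :: "(complex \<times> complex \<times> complex \<times> complex) set"
  assumes one: "(1, 0, 0, 0) \<in> S"
    and mult: "\<And>n a b c n' a' b' c'. (n, a, b, c) \<in> S \<Longrightarrow> (n', a', b', c') \<in> S \<Longrightarrow>
      (n * n', a + a', b' + a * c' + b * n', c' + c * n') \<in> S"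
    and inv: "\<And>n a b c. (n, a, b, c) \<in> S \<Longrightarrow> (1 / n, - a, (a * c - b) / n, - c / n) \<in> S"
    and unit: "\<And>n a b c. (n, a, b, c) \<in> S \<Longrightarrow> cmod n = 1"
    and fin: "\<And>r. finite {(n, a, b, c) \<in> S. cmod a \<le> r \<and> cmod b \<le> r \<and> cmod c \<le> r}"
    and par: "\<And>n a b c. (n, a, b, c) \<in> S \<Longrightarrow> n \<noteq> 1 \<Longrightarrow> a \<noteq> 0"
begin

lemma nonzero: "(n, a, b, c) \<in> S \<Longrightarrow> n \<noteq> 0"
  using unit by fastforce

lemma conj:
  assumes "(n, a, b, c) \<in> S" "(1, a', b', c') \<in> S"
  shows "(1, a', (b' + a * c' - a' * c) / n, c' / n) \<in> S"
proof -
  have "n \<noteq> 0" using assms nonzero by blast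
  then have "(n * 1 * (1 / n), a + a' + - a, (a * c - b) / n + (a + a') * (- c / n) + (b' + a * c' + b * 1) * (1 / n),
      - c / n + (c' + c * 1) * (1 / n)) = (1, a', (b' + a * c' - a' * c) / n, c' / n)"
    by (simp add: field_simps)
  then show ?thesis using mult[OF mult[OF assms] inv[OF assms(1)]] by (simp only:)
qed

lemma power: "(n, a, b, c) \<in> S \<Longrightarrow> \<exists>b' c'. (n ^ q, of_nat q * a, b', c') \<in> S"
proof (induction q)
  case 0
  then show ?case using one by auto
next
  case (Suc q)
  then obtain b' c' where "(n ^ q, of_nat q * a, b', c') \<in> S" by blast
  from mult[OF Suc.prems this] show ?case by (auto simp: algebra_simps)
qed

lemma translation_diff:
  assumes "(1, 0, b, c) \<in> S" "(1, 0, b', c') \<in> S"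
  shows "(1, 0, b - b', c - c') \<in> S"
  using mult[OF assms(1) inv[OF assms(2)]] by simp

text \<open>With \<open>w = 1 / n ^ q\<close>, a single commutator with the power \<open>q\<close>
  has a first coordinate growing like \<open>q\<close>. The double commutator has coordinates
  \<open>(w - 1)\<^sup>2 * b0 + 2 * w * a * c0 * q * (w - 1)\<close> and
  \<open>(w - 1)\<^sup>2 * c0\<close>: the first is bounded by the Dirichlet estimate, the second is
  nonzero and as small as desired, against discreteness.\<close>

lemma no_skew_translation:
  assumes g: "(n, a, b, c) \<in> S" "\<And>m. 0 < m \<Longrightarrow> n ^ m \<noteq> 1" and u: "(1, 0, b0, c0) \<in> S"
  shows "c0 = 0"
proof (rule ccontr)
  assume c0: "c0 \<noteq> 0"
  \<comment> \<open>The first two summands bound \<open>x'\<close>, the third bounds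
    \<open>y'\<close>, from \<open>cmod (w - 1) <= 2\<close> and
    \<open>q * cmod (w - 1) <= 2 * pi\<close>.\<close>
  define R where "R = 4 * cmod b0 + 4 * pi * cmod a * cmod c0 + 4 * cmod c0"
  define F where "F = {(n, a, b, c) \<in> S. cmod a \<le> R \<and> cmod b \<le> R \<and> cmod c \<le> R}"
  have F: "finite F" unfolding F_def by (rule fin)
  obtain e where e: "e > 0" "\<And>n a b c. (n, a, b, c) \<in> F \<Longrightarrow> c \<noteq> 0 \<Longrightarrow> e \<le> cmod c"
  proof -
    \<comment> \<open>The inserted 1 keeps the minimum meaningful if no nonzero entry
      occurs.\<close>
    let ?D = "insert 1 ((\<lambda>(n, a, b, c). cmod c) ` F - {0})"
    have f: "finite ?D" using F by simp
    show thesis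
    proof (rule that[of "Min ?D"])
      have "\<forall>x\<in>?D. 0 < x" by auto
      then show "0 < Min ?D" using f by (subst Min_gr_iff) auto
      show "Min ?D \<le> cmod c" if "(n, a, b, c) \<in> F" "c \<noteq> 0" for n a b c
        using f that by (intro Min_le) (force simp: image_iff)+
    qed
  qed
  have n: "cmod n = 1" "n \<noteq> 0" using g unit nonzero by auto
  \<comment> \<open>Chosen so that the final bound \<open>4 * pi * pi * cmod c0 / N\<close> falls
    below \<open>e\<close>.\<close>
  obtain N :: nat where N: "4 * pi * pi * cmod c0 / e < real N" "N > 0"
    by (metis reals_Archimedean2 less_trans of_nat_0_less_iff gr0I not_less_iff_gr_or_eq
        of_nat_0 divide_nonneg_pos e(1) mult_nonneg_nonneg norm_ge_zero pi_ge_zero zero_le_numeral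
        le_less_trans)
  obtain q where q: "q > 0" "real q * cmod ((1 / n) ^ q - 1) \<le> 2 * pi" "cmod ((1 / n) ^ q - 1) < 2 * pi / N"
    using unit_power_near_one[of "1 / n" N] n N by (auto simp: norm_divide)
  define w where "w = (1 / n) ^ q"
  have w: "cmod w = 1" using n by (simp add: w_def norm_power norm_divide)
  have w1: "w \<noteq> 1" using g(2)[OF q(1)] by (simp add: w_def power_one_over)
  obtain b' c' where gq: "(n ^ q, of_nat q * a, b', c') \<in> S" using power[OF g(1)] by blast
  have step: "(1, 0, w * (x + of_nat q * a * y) - x, w * y - y) \<in> S" if "(1, 0, x, y) \<in> S" for x y
  proof -
    have "(1, 0, w * (x + of_nat q * a * y), w * y) \<in> S"
      using conj[OF gq that] n(2) by (simp add: w_def power_one_over field_simps)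
    from translation_diff[OF this that] show ?thesis .
  qed
  define x y where "x = w * (b0 + of_nat q * a * c0) - b0" and "y = w * c0 - c0"
  define x' y' where "x' = w * (x + of_nat q * a * y) - x" and "y' = w * y - y"
  have xy: "(1, 0, x', y') \<in> S"
    unfolding x'_def y'_def by (rule step) (unfold x_def y_def, rule step[OF u])
  have x': "x' = (w - 1)\<^sup>2 * b0 + 2 * w * a * c0 * (of_nat q * (w - 1))"
    by (simp add: x'_def x_def y_def power2_eq_square algebra_simps)
  have y': "y' = (w - 1)\<^sup>2 * c0"
    by (simp add: y'_def y_def power2_eq_square algebra_simps)
  have w2: "cmod (w - 1) \<le> 2" using norm_triangle_ineq4[of w 1] w by simp
  have w4: "(cmod (w - 1))\<^sup>2 \<le> 4" using power_mono[OF w2, of 2] by simp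
  have "cmod x' \<le> cmod ((w - 1)\<^sup>2 * b0) + cmod (2 * w * a * c0 * (of_nat q * (w - 1)))"
    unfolding x' by (rule norm_triangle_ineq)
  also have "\<dots> = (cmod (w - 1))\<^sup>2 * cmod b0 + 2 * cmod a * cmod c0 * (q * cmod (w - 1))"
    using w by (simp add: norm_mult norm_power)
  also have "\<dots> \<le> 4 * cmod b0 + 2 * cmod a * cmod c0 * (2 * pi)"
    using q(2) w4 by (intro add_mono mult_right_mono mult_left_mono) (auto simp: w_def)
  also have "\<dots> \<le> R" by (simp add: R_def)
  finally have "cmod x' \<le> R" .
  moreover have "cmod y' \<le> R"
  proof -
    have "cmod y' \<le> 4 * cmod c0" using w4 by (simp add: y' norm_mult norm_power mult_right_mono)
    also have "\<dots> \<le> R" by (simp add: R_def)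
    finally show ?thesis .
  qed
  ultimately have "(1, 0, x', y') \<in> F" using xy by (simp add: F_def) (simp add: R_def)
  moreover have "y' \<noteq> 0" using c0 w1 by (simp add: y')
  ultimately have "e \<le> cmod y'" using e(2) by blast
  also have "\<dots> = cmod (w - 1) * cmod (w - 1) * cmod c0" by (simp add: y' norm_mult power2_eq_square)
  also have "\<dots> \<le> (2 * pi) * (2 * pi / N) * cmod c0"
  proof -
    have "1 * cmod (w - 1) \<le> real q * cmod (w - 1)" using q(1) by (intro mult_right_mono) auto
    then have "cmod (w - 1) \<le> 2 * pi" using q(2) by (simp add: w_def)
    then show ?thesis using q(3) by (intro mult_right_mono mult_mono) (auto simp: w_def)
  qed
  also have "\<dots> = (4 * pi * pi * cmod c0) / N" by simp
  also have "\<dots> < e" using N e(1) by (simp add: field_simps)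
  finally show False by simp
qed

text \<open>A nonzero \<open>(1, 0, b0, 0)\<close> is divided by \<open>n\<close> under conjugation,
  so its finite orbit determines \<open>n\<close>. Without such elements all commutators with a
  fixed element having \<open>n \<noteq> 1\<close> are trivial, and its eigenvector for the simple
  eigenvalue is shared by the group.\<close>

theorem finite_or_split:
  "finite (fst ` S) \<or> (\<exists>p q. \<forall>(n, a, b, c)\<in>S. c = (1 - n) * q \<and> b = (1 - n) * p + a * q)"
proof (cases "\<exists>b0. b0 \<noteq> 0 \<and> (1, 0, b0, 0) \<in> S")
  case True
  then obtain b0 where b0: "b0 \<noteq> 0" "(1, 0, b0, 0) \<in> S" by blast
  let ?F = "{(n, a, b, c) \<in> S. cmod a \<le> cmod b0 \<and> cmod b \<le> cmod b0 \<and> cmod c \<le> cmod b0}"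
  have "n \<in> (\<lambda>(n, a, b, c). b0 / b) ` ?F" if s: "(n, a, b, c) \<in> S" for n a b c
  proof -
    have "(1, 0, b0 / n, 0) \<in> ?F" using conj[OF s b0(2)] unit[OF s] by (auto simp: norm_divide)
    then show ?thesis using b0(1) nonzero[OF s] by (force simp: image_iff)
  qed
  note mem = this
  have "fst ` S \<subseteq> (\<lambda>(n, a, b, c). b0 / b) ` ?F"
  proof
    fix m assume "m \<in> fst ` S"
    then obtain s where "s \<in> S" "m = fst s" by (rule imageE)
    moreover obtain n a b c where "s = (n, a, b, c)" by (cases s)
    ultimately show "m \<in> (\<lambda>(n, a, b, c). b0 / b) ` ?F" using mem[of n a b c] by (simp only: fst_conv)
  qed
  then have "finite (fst ` S)" by (rule finite_subset) (intro finite_imageI fin)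
  then show ?thesis ..
next
  case False
  then have Z: "b0 = 0" if "(1, 0, b0, 0) \<in> S" for b0 using that by blast
  show ?thesis
  proof (cases "\<forall>(n, a, b, c)\<in>S. n = 1")
    case True
    then have "fst ` S \<subseteq> {1}" by auto
    then show ?thesis using finite_subset by blast
  next
    case False
    then obtain n0 a0 b0 c0 where g: "(n0, a0, b0, c0) \<in> S" "n0 \<noteq> 1" by auto
    have a0: "a0 \<noteq> 0" using par g by blast
    have T: "b' = 0 \<and> c' = 0" if u: "(1, 0, b', c') \<in> S" for b' c'
    proof -
      have "c' = 0"
      proof (rule ccontr)
        assume c': "c' \<noteq> 0"
        \<comment> \<open>Conjugating the translation by a unipotent element changes it by
          \<open>(1, 0, a * c', 0)\<close>, which \<open>Z\<close> allows only for
          \<open>a = 0\<close>.\<close>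
        have unip: "a = 0" if "(1, a, b, c) \<in> S" for a b c
        proof -
          have "(1, 0, b' + a * c' - b', c' - c') \<in> S"
            using translation_diff[OF conj[OF that u] u] by simp
          then show "a = 0" using Z[of "a * c'"] c' by simp
        qed
        \<comment> \<open>A root of unity would give a unipotent power of the chosen element with
          nonzero second coordinate, against \<open>unip\<close>.\<close>
        have "n0 ^ m \<noteq> 1" if "0 < m" for m
        proof
          assume "n0 ^ m = 1"
          then obtain b c where "(1, of_nat m * a0, b, c) \<in> S" using power[OF g(1), of m] by auto
          then have "of_nat m * a0 = 0" by (rule unip)
          then show False using that a0 by simp
        qed
        then show False using no_skew_translation[OF g(1) _ u] c' by blast
      qed
      then show ?thesis using Z u by blast
    qed
    \<comment> \<open>The commutator has first coordinate 1 and second coordinate 0, so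
      \<open>T\<close> makes it trivial; the claim compares the entries of the two products.\<close>
    have comm: "b + a0 * c + b0 * n = b0 + a * c0 + b * n0 \<and> c + c0 * n = c0 + c * n0"
      if h: "(n, a, b, c) \<in> S" for n a b c
    proof -
      note gh = mult[OF g(1) h] and hg = mult[OF h g(1)]
      have nz: "n \<noteq> 0" "n0 \<noteq> 0" using nonzero h g by auto
      let ?b = "b + a0 * c + b0 * n" and ?c = "c + c0 * n" and ?b' = "b0 + a * c0 + b * n0" and ?c' = "c0 + c * n0"
      have "(1, 0, ((a + a0) * ?c' - ?b') / (n * n0) + (a0 + a) * (- ?c' / (n * n0)) + ?b / (n * n0),
          - ?c' / (n * n0) + ?c / (n * n0)) \<in> S"
        using mult[OF gh inv[OF hg]] nz by (simp add: mult.commute)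
      moreover have "((a + a0) * ?c' - ?b') / (n * n0) + (a0 + a) * (- ?c' / (n * n0)) + ?b / (n * n0) = (?b - ?b') / (n * n0)"
        "- ?c' / (n * n0) + ?c / (n * n0) = (?c - ?c') / (n * n0)"
      proof -
        have "(A * C' - B') / d + A * (- C' / d) + B / d = (B - B') / d" "- C' / d + C / d = (C - C') / d"
          for A B C B' C' d :: complex by (simp_all add: diff_divide_distrib)
        then show "((a + a0) * ?c' - ?b') / (n * n0) + (a0 + a) * (- ?c' / (n * n0)) + ?b / (n * n0) = (?b - ?b') / (n * n0)"
          "- ?c' / (n * n0) + ?c / (n * n0) = (?c - ?c') / (n * n0)"
          unfolding add.commute[of a0 a] by blast+
      qed
      ultimately have "(1, 0, (?b - ?b') / (n * n0), (?c - ?c') / (n * n0)) \<in> S" by (simp only:)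
      from T[OF this] show ?thesis using nz by simp
    qed
    \<comment> \<open>The column (-p, -q, 1) is the eigenvector of the chosen element for
      \<open>n0\<close>.\<close>
    define q where "q = c0 / (1 - n0)"
    define p where "p = (b0 - a0 * q) / (1 - n0)"
    have c0: "c0 = q * (1 - n0)" and b0: "b0 = p * (1 - n0) + a0 * q"
      using g(2) by (simp_all add: q_def p_def)
    have "c = (1 - n) * q \<and> b = (1 - n) * p + a * q" if h: "(n, a, b, c) \<in> S" for n a b c
    proof -
      have "(1 - n0) * c = (1 - n0) * ((1 - n) * q)" using comm[OF h] by (simp add: c0 algebra_simps)
      then have c: "c = (1 - n) * q" using g(2) by simp
      have "(1 - n0) * b = (1 - n0) * ((1 - n) * p + a * q)"
        using comm[OF h] by (simp add: c c0 b0 algebra_simps)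
      then show ?thesis using c g(2) by simp
    qed
    then show ?thesis by blast
  qed
qed

end

text \<open>\<open>(n, a, b, c)\<close> stands for rows (1, a, b), (0, n, c), (0, 0, 1). With the
  simple eigenvalue in the middle, conjugating a unipotent element divides its \<open>a\<close> by
  \<open>n\<close> but multiplies its \<open>c\<close> by \<open>n\<close>.\<close>

locale middle_block_group =
  fixes S :: "(complex \<times> complex \<times> complex \<times> complex) set"
  assumes one: "(1, 0, 0, 0) \<in> S"
    and mult: "\<And>n a b c n' a' b' c'. (n, a, b, c) \<in> S \<Longrightarrow> (n', a', b', c') \<in> S \<Longrightarrow>
      (n * n', a' + a * n', b' + a * c' + b, n * c' + c) \<in> S"
    and inv: "\<And>n a b c. (n, a, b, c) \<in> S \<Longrightarrow> (1 / n, - a / n, a * c / n - b, - c / n) \<in> S"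
    and unit: "\<And>n a b c. (n, a, b, c) \<in> S \<Longrightarrow> cmod n = 1"
    and fin: "\<And>r. finite {(n, a, b, c) \<in> S. cmod a \<le> r \<and> cmod b \<le> r \<and> cmod c \<le> r}"
begin

lemma nonzero: "(n, a, b, c) \<in> S \<Longrightarrow> n \<noteq> 0"
  using unit by fastforce

lemma conj:
  assumes "(n, a, b, c) \<in> S" "(1, x, t, y) \<in> S"
  shows "(1, x / n, t + a * y - x * c / n, n * y) \<in> S"
proof -
  have "n \<noteq> 0" using assms nonzero by blast
  then have "(n * 1 * (1 / n), - a / n + (x + a * 1) * (1 / n), (a * c / n - b) + (x + a * 1) * (- c / n) + (t + a * y + b),
      n * 1 * (- c / n) + (n * y + c)) = (1, x / n, t + a * y - x * c / n, n * y)"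
    by (simp add: field_simps)
  then show ?thesis using mult[OF mult[OF assms] inv[OF assms(1)]] by (simp only:)
qed

lemma commutator:
  assumes "(1, x, t, y) \<in> S" "(1, x', t', y') \<in> S"
  shows "(1, 0, x * y' - x' * y, 0) \<in> S"
  using mult[OF mult[OF assms] inv[OF mult[OF assms(2,1)]]] by (simp add: algebra_simps)

lemma commutator_component:
  assumes g: "(n, a, b, c) \<in> S" and h: "(n', a', b', c') \<in> S"
  shows "\<exists>t. (1, ((a' + a * n') - (a + a' * n)) / (n * n'), t, (n * c' + c) - (n' * c + c')) \<in> S"
proof -
  have nz: "n \<noteq> 0" "n' \<noteq> 0" using nonzero g h by auto
  have "- A' / N + A * (1 / N) = (A - A') / N" "N * (- C' / N) + C = C - C'" "N * (1 / N) = 1" 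
    if "N \<noteq> 0" for A A' N C C' :: complex
    using that by (simp_all add: field_simps)
  note e = this[of "n * n'"]
  have "n * n' \<noteq> 0" using nz by simp
  from mult[OF mult[OF g h] inv[OF mult[OF h g]]] show ?thesis
    unfolding mult.commute[of n' n] e[OF \<open>n * n' \<noteq> 0\<close>] by blast
qed

lemma finite_fst:
  assumes "finite T" "\<And>n a b c. (n, a, b, c) \<in> S \<Longrightarrow> n \<in> T"
  shows "finite (fst ` S)"
proof (rule finite_subset[OF _ assms(1)])
  show "fst ` S \<subseteq> T"
  proof
    fix m assume "m \<in> fst ` S"
    then obtain s where "s \<in> S" "m = fst s" by (rule imageE)
    moreover obtain n a b c where "s = (n, a, b, c)" by (cases s)
    ultimately show "m \<in> T" using assms(2)[of n a b c] by (simp only: fst_conv)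
  qed
qed

text \<open>The commutator of \<open>u\<close> with a conjugate of \<open>v\<close> is central with
  entry \<open>x * n * y' - x' * y / n\<close>, bounded since \<open>n\<close> has modulus 1. So it
  takes finitely many values, each of which is a nontrivial quadratic equation for
  \<open>n\<close>.\<close>

lemma finite_if_nonabelian:
  assumes u: "(1, x, t, y) \<in> S" and v: "(1, x', t', y') \<in> S" and "x * y' \<noteq> x' * y"
  shows "finite (fst ` S)"
proof -
  define r where "r = cmod (x * y') + cmod (x' * y)"
  let ?F = "{(n, a, b, c) \<in> S. cmod a \<le> r \<and> cmod b \<le> r \<and> cmod c \<le> r}"
  define D where "D = (\<lambda>(n, a, b, c). b) ` ?F"
  have D: "finite D" unfolding D_def by (intro finite_imageI fin)
  define p where "p d = [:- (x' * y), - d, x * y':]" for d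
  show ?thesis
  proof (rule finite_fst)
    show "finite (\<Union>d\<in>D. {z. poly (p d) z = 0})"
    proof (intro finite_UN_I D poly_roots_finite)
      show "p d \<noteq> 0" for d using assms(3) by (auto simp: p_def)
    qed
    fix n a b c assume s: "(n, a, b, c) \<in> S"
    have n: "n \<noteq> 0" "cmod n = 1" using s nonzero unit by auto
    define d where "d = x * (n * y') - x' / n * y"
    have "(1, 0, d, 0) \<in> S" unfolding d_def by (rule commutator[OF u conj[OF s v]])
    moreover have "cmod d \<le> r"
      unfolding d_def r_def by (rule norm_triangle_le_diff) (simp add: norm_mult norm_divide n)
    moreover have "0 \<le> r" by (simp add: r_def)
    ultimately have "(1, 0, d, 0) \<in> ?F" by simp
    then have "d \<in> D" unfolding D_def by (rule rev_image_eqI) simp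
    moreover have "poly (p d) n = 0" using n by (simp add: p_def d_def field_simps)
    ultimately show "n \<in> (\<Union>d\<in>D. {z. poly (p d) z = 0})" by blast
  qed
qed

text \<open>Commutators have vanishing last coordinate, which forces \<open>c = (1 - n) * q\<close>
  throughout unless every \<open>n\<close> is 1. Hence the conjugates of \<open>u\<close> are
  bounded, and their finitely many entries \<open>x / n\<close> determine \<open>n\<close>.\<close>

lemma finite_if_row:
  assumes u: "(1, x, t, 0) \<in> S" "x \<noteq> 0" and row: "\<And>a b c. (1, a, b, c) \<in> S \<Longrightarrow> c = 0"
  shows "finite (fst ` S)"
proof (cases "\<forall>(n, a, b, c)\<in>S. n = 1")
  case True
  then have "fst ` S \<subseteq> {1}" by auto
  then show ?thesis using finite_subset by blast
next
  case False
  then obtain n0 a0 b0 c0 where g: "(n0, a0, b0, c0) \<in> S" "n0 \<noteq> 1" by auto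
  define q where "q = c0 / (1 - n0)"
  have c0: "c0 = q * (1 - n0)" using g(2) by (simp add: q_def)
  have c: "c = (1 - n) * q" if h: "(n, a, b, c) \<in> S" for n a b c
  proof -
    have "(n0 * c + c0) - (n * c0 + c) = 0" using commutator_component[OF g(1) h] row by blast
    then have "(1 - n0) * c = (1 - n0) * ((1 - n) * q)" by (simp add: c0 algebra_simps)
    then show ?thesis using g(2) by simp
  qed
  define r where "r = cmod x + cmod t + 2 * cmod x * cmod q"
  let ?F = "{(n, a, b, c) \<in> S. cmod a \<le> r \<and> cmod b \<le> r \<and> cmod c \<le> r}"
  show ?thesis
  proof (rule finite_fst)
    show "finite ((\<lambda>(n, a, b, c). x / a) ` ?F)" by (intro finite_imageI fin)
    fix n a b c assume s: "(n, a, b, c) \<in> S"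
    have n: "n \<noteq> 0" "cmod n = 1" using s nonzero unit by auto
    define t' where "t' = t - x * c / n"
    have in_S: "(1, x / n, t', 0) \<in> S" using conj[OF s u(1)] by (simp add: t'_def)
    have "cmod c \<le> 2 * cmod q"
    proof -
      have "cmod (1 - n) \<le> 2" using norm_triangle_ineq4[of 1 n] n by simp
      then show ?thesis by (simp add: c[OF s] norm_mult mult_right_mono)
    qed
    then have "cmod x * cmod c \<le> 2 * cmod x * cmod q"
      using mult_left_mono[of "cmod c" "2 * cmod q" "cmod x"] by simp
    moreover have "cmod t' \<le> cmod t + cmod x * cmod c"
      unfolding t'_def by (rule norm_triangle_le_diff) (simp add: norm_mult norm_divide n)
    moreover have "0 \<le> 2 * cmod x * cmod q" by simp
    ultimately have "cmod t' \<le> r" "cmod x \<le> r" "0 \<le> r"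
      unfolding r_def using norm_ge_zero[of x] norm_ge_zero[of t] by linarith+
    moreover have "cmod (x / n) = cmod x" using n by (simp add: norm_divide)
    ultimately have "(1, x / n, t', 0) \<in> ?F" using in_S by simp
    then show "n \<in> (\<lambda>(n, a, b, c). x / a) ` ?F"
      by (rule rev_image_eqI) (use n u(2) in simp)
  qed
qed

text \<open>Reflection in the antidiagonal exchanges \<open>a\<close> with \<open>c\<close> and
  reverses products, so the column case reduces to the row case.\<close>

lemma swap: "middle_block_group {(n, c, b, a) | n a b c. (n, a, b, c) \<in> S}" (is "middle_block_group ?S")
proof
  have in_iff: "(n, c, b, a) \<in> ?S \<longleftrightarrow> (n, a, b, c) \<in> S" for n a b c by blast
  show "(1, 0, 0, 0) \<in> ?S" using one in_iff by blast
  show "(n * n', a' + a * n', b' + a * c' + b, n * c' + c) \<in> ?S"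
    if "(n, a, b, c) \<in> ?S" "(n', a', b', c') \<in> ?S" for n a b c n' a' b' c'
    using mult[of n' c' b' a' n c b a] that unfolding in_iff by (simp add: algebra_simps)
  show "(1 / n, - a / n, a * c / n - b, - c / n) \<in> ?S" if "(n, a, b, c) \<in> ?S" for n a b c
    using inv[of n c b a] that unfolding in_iff by (simp add: mult.commute)
  show "cmod n = 1" if "(n, a, b, c) \<in> ?S" for n a b c
    using unit[of n c b a] that unfolding in_iff by simp
  show "finite {(n, a, b, c) \<in> ?S. cmod a \<le> r \<and> cmod b \<le> r \<and> cmod c \<le> r}" for r
  proof (rule finite_subset)
    show "finite ((\<lambda>(n, a, b, c). (n, c, b, a)) ` {(n, a, b, c) \<in> S. cmod a \<le> r \<and> cmod b \<le> r \<and> cmod c \<le> r})"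
      by (intro finite_imageI fin)
    show "{(n, a, b, c) \<in> ?S. cmod a \<le> r \<and> cmod b \<le> r \<and> cmod c \<le> r} \<subseteq>
      (\<lambda>(n, a, b, c). (n, c, b, a)) ` {(n, a, b, c) \<in> S. cmod a \<le> r \<and> cmod b \<le> r \<and> cmod c \<le> r}"
    proof (clarify)
      fix n a b c assume "(n, c, b, a) \<in> S" "cmod a \<le> r" "cmod b \<le> r" "cmod c \<le> r"
      then have "(n, c, b, a) \<in> {(n, a, b, c) \<in> S. cmod a \<le> r \<and> cmod b \<le> r \<and> cmod c \<le> r}" by simp
      then show "(n, a, b, c) \<in> (\<lambda>(n, a, b, c). (n, c, b, a)) ` {(n, a, b, c) \<in> S. cmod a \<le> r \<and> cmod b \<le> r \<and> cmod c \<le> r}"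
        by (rule rev_image_eqI) simp
    qed
  qed
qed

text \<open>If the unipotent elements are parallel, conjugation preserves their direction
  \<open>(x, y)\<close>: two nonzero coordinates give \<open>n\<^sup>2 = 1\<close>, one zero
  coordinate is the row case or its mirror image. If all of them are central, commutators with one
  element having \<open>n \<noteq> 1\<close> determine \<open>p\<close> and
  \<open>q\<close>.\<close>

theorem finite_or_split:
  "finite (fst ` S) \<or> (\<exists>p q. \<forall>(n, a, b, c)\<in>S. a = (n - 1) * p \<and> c = (1 - n) * q)"
proof (cases "\<exists>x t y. (1, x, t, y) \<in> S \<and> (x \<noteq> 0 \<or> y \<noteq> 0)")
  case True
  then obtain x t y where u: "(1, x, t, y) \<in> S" "x \<noteq> 0 \<or> y \<noteq> 0" by blast
  have "finite (fst ` S)"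
  proof (cases "\<exists>x' t' y'. (1, x', t', y') \<in> S \<and> x * y' \<noteq> x' * y")
    case True
    then show ?thesis using finite_if_nonabelian[OF u(1)] by blast
  next
    case False
    then have par: "x * y' = x' * y" if "(1, x', t', y') \<in> S" for x' t' y' using that by blast
    consider "x \<noteq> 0" "y \<noteq> 0" | "x \<noteq> 0" "y = 0" | "x = 0" "y \<noteq> 0" using u(2) by blast
    then show ?thesis
    proof cases
      case 1
      show ?thesis
      proof (rule finite_fst)
        show "finite {1, - 1 :: complex}" by simp
        fix n a b c assume s: "(n, a, b, c) \<in> S"
        have "x * (n * y) = (x / n) * y" by (rule par[OF conj[OF s u(1)]])
        then have "n\<^sup>2 = 1" using 1 nonzero[OF s] by (simp add: field_simps power2_eq_square)
        then show "n \<in> {1, - 1}" by (simp add: power2_eq_1_iff)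
      qed
    next
      case 2
      have "c = 0" if "(1, a, b, c) \<in> S" for a b c using par[OF that] 2 by simp
      then show ?thesis using finite_if_row[of x t] u 2 by blast
    next
      case 3
      let ?S = "{(n, c, b, a) | n a b c. (n, a, b, c) \<in> S}"
      interpret T: middle_block_group ?S by (rule swap)
      have "c = 0" if "(1, a, b, c) \<in> ?S" for a b c using par[of c b a] 3 that by simp
      moreover have "(1, y, t, 0) \<in> ?S" using u 3 by blast
      ultimately have "finite (fst ` ?S)" using T.finite_if_row[of y t] 3 by blast
      moreover have "fst ` ?S = fst ` S" by force
      ultimately show ?thesis by simp
    qed
  qed
  then show ?thesis ..
next
  case False
  then have central: "x = 0 \<and> y = 0" if "(1, x, t, y) \<in> S" for x t y using that by blast
  show ?thesis
  proof (cases "\<forall>(n, a, b, c)\<in>S. n = 1")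
    case True
    then have "fst ` S \<subseteq> {1}" by auto
    then show ?thesis using finite_subset by blast
  next
    case False
    then obtain n0 a0 b0 c0 where g: "(n0, a0, b0, c0) \<in> S" "n0 \<noteq> 1" by auto
    define p q where "p = a0 / (n0 - 1)" and "q = c0 / (1 - n0)"
    have c0: "c0 = q * (1 - n0)" and a0: "a0 = p * (n0 - 1)" using g(2) by (simp_all add: q_def p_def)
    have "a = (n - 1) * p \<and> c = (1 - n) * q" if h: "(n, a, b, c) \<in> S" for n a b c
    proof -
      obtain t where t: "(1, ((a + a0 * n) - (a0 + a * n0)) / (n0 * n), t, (n0 * c + c0) - (n * c0 + c)) \<in> S"
        using commutator_component[OF g(1) h] by blast
      have "(n0 * c + c0) - (n * c0 + c) = 0" "(a + a0 * n) - (a0 + a * n0) = 0"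
        using central[OF t] nonzero[OF g(1)] nonzero[OF h] by simp_all
      then have "(1 - n0) * c = (1 - n0) * ((1 - n) * q)" "(1 - n0) * a = (1 - n0) * ((n - 1) * p)"
        by (simp_all add: c0 a0 algebra_simps)
      then show ?thesis using g(2) by simp
    qed
    then show ?thesis by blast
  qed
qed

end

section \<open>Matrices of size three\<close>

lemma matrix_mult_entry3: "((A::cmat3) ** B) $ i $ j = A$i$1 * B$1$j + A$i$2 * B$2$j + A$i$3 * B$3$j"
  by (simp add: matrix_matrix_mult_def sum_3)

lemma matrix_vector_entry3: "((A::cmat3) *v v) $ i = A$i$1 * v$1 + A$i$2 * v$2 + A$i$3 * v$3"
  by (simp add: matrix_vector_mult_def sum_3)

lemma mat_entry: "(mat c :: cmat3) $ i $ j = (if i = j then c else 0)"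
  by (simp add: mat_def)

lemma trace3: "trace (A::cmat3) = A$1$1 + A$2$2 + A$3$3"
  by (simp add: trace_def sum_3)

text \<open>A pair in place of \<open>matrix_inv\<close>, so that inverses can be written down
  explicitly and conjugations compose.\<close>

definition mutual_inverse :: "cmat3 \<Rightarrow> cmat3 \<Rightarrow> bool" where
  "mutual_inverse P Q \<longleftrightarrow> P ** Q = mat 1 \<and> Q ** P = mat 1"

lemma mutual_inverse_sym: "mutual_inverse P Q \<Longrightarrow> mutual_inverse Q P"
  by (simp add: mutual_inverse_def)

lemma mutual_inverse_mult:
  assumes "mutual_inverse P P'" "mutual_inverse Q Q'"
  shows "mutual_inverse (P ** Q) (Q' ** P')"
proof -
  have "P ** Q ** (Q' ** P') = P ** (Q ** Q') ** P'" "Q' ** P' ** (P ** Q) = Q' ** (P' ** P) ** Q"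
    by (simp_all add: matrix_mul_assoc)
  then show ?thesis using assms by (simp add: mutual_inverse_def)
qed

lemma mutual_inverse_if_det: "det (Q::cmat3) \<noteq> 0 \<Longrightarrow> \<exists>P. mutual_inverse P Q"
  using invertible_det_nz[of Q] by (auto simp: invertible_def mutual_inverse_def)

lemma matrix_inv_mutual: "mutual_inverse P Q \<Longrightarrow> matrix_inv P = Q \<and> invertible P"
proof -
  assume PQ: "mutual_inverse P Q"
  then have i: "invertible P" by (auto simp: mutual_inverse_def invertible_def)
  have "matrix_inv P ** P = mat 1"
    using someI_ex[OF i[unfolded invertible_def]] by (simp add: matrix_inv_def)
  then have "matrix_inv P ** (P ** Q) = Q" by (simp add: matrix_mul_assoc)
  then show ?thesis using i PQ by (simp add: mutual_inverse_def)
qed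

lemma conj_mult:
  assumes "mutual_inverse P Q"
  shows "(P ** A ** Q) ** (P ** B ** Q) = P ** (A ** B) ** Q"
proof -
  have "(P ** A ** Q) ** (P ** B ** Q) = P ** A ** (Q ** P) ** B ** Q"
    by (simp add: matrix_mul_assoc)
  also have "\<dots> = P ** A ** B ** Q" using assms by (simp only: mutual_inverse_def matrix_mul_rid)
  finally show ?thesis by (simp add: matrix_mul_assoc)
qed

lemma conj_conj: "P2 ** (P ** A ** Q) ** Q2 = (P2 ** P) ** A ** (Q ** Q2)" for A :: cmat3
  by (simp add: matrix_mul_assoc)

lemma conj_back:
  assumes "mutual_inverse P Q" shows "Q ** (P ** A ** Q) ** P = A"
  using assms unfolding conj_conj by (simp add: mutual_inverse_def)

lemma conj_mat: "mutual_inverse P Q \<Longrightarrow> P ** mat c ** Q = mat c"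
  by (metis mat_commute matrix_mul_assoc matrix_mul_rid mutual_inverse_def)

lemma similar_matrices_iff:
  "similar_matrices A B \<longleftrightarrow> (\<exists>P Q. mutual_inverse P Q \<and> A = P ** B ** Q)"
proof
  assume "similar_matrices A B"
  then obtain P where P: "invertible P" "A = P ** B ** matrix_inv P" by (auto simp: similar_matrices_def)
  then obtain Q where Q: "mutual_inverse P Q" by (auto simp: invertible_def mutual_inverse_def)
  then show "\<exists>P Q. mutual_inverse P Q \<and> A = P ** B ** Q" using P matrix_inv_mutual[OF Q] by auto
next
  assume "\<exists>P Q. mutual_inverse P Q \<and> A = P ** B ** Q"
  then show "similar_matrices A B"
    unfolding similar_matrices_def using matrix_inv_mutual by metis
qed

lemma diagonalizableI:
  assumes "\<And>i j. i \<noteq> j \<Longrightarrow> D $ i $ j = 0" "mutual_inverse P Q" "A = P ** D ** Q"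
  shows "diagonalizable A"
proof -
  have "similar_matrices A D" using assms(2,3) similar_matrices_iff by metis
  then show ?thesis unfolding diagonalizable_def using assms(1) by (intro exI[of _ D]) simp
qed

lemma diagonalizableE:
  assumes "diagonalizable A"
  obtains D P Q where "\<And>i j. i \<noteq> j \<Longrightarrow> D $ i $ j = 0" "mutual_inverse P Q" "A = P ** D ** Q"
proof -
  obtain D where D: "\<forall>i j. i \<noteq> j \<longrightarrow> D $ i $ j = 0" "similar_matrices A D"
    using assms unfolding diagonalizable_def by (elim exE conjE)
  obtain P Q where "mutual_inverse P Q" "A = P ** D ** Q"
    using D(2) similar_matrices_iff by metis
  then show thesis using D(1) by (intro that) auto
qed

lemma diagonalizable_conj:
  assumes "mutual_inverse P Q" "diagonalizable (P ** A ** Q)"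
  shows "diagonalizable A"
proof -
  obtain D R S where D: "\<And>i j. i \<noteq> j \<Longrightarrow> D $ i $ j = 0" "mutual_inverse R S" "P ** A ** Q = R ** D ** S"
    using diagonalizableE[OF assms(2)] by metis
  have "A = Q ** (R ** D ** S) ** P" using conj_back[OF assms(1), of A] by (simp only: D(3))
  then have "A = (Q ** R) ** D ** (S ** P)" by (simp add: matrix_mul_assoc)
  moreover have "mutual_inverse (Q ** R) (S ** P)"
    using mutual_inverse_mult[OF mutual_inverse_sym[OF assms(1)] D(2)] .
  ultimately show ?thesis by (intro diagonalizableI[OF D(1)])
qed

lemma transpose_mutual_inverse:
  "mutual_inverse P Q \<Longrightarrow> mutual_inverse (transpose Q) (transpose P)"
  unfolding mutual_inverse_def by (metis matrix_transpose_mul transpose_mat)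

lemma diagonalizable_transpose:
  assumes "diagonalizable (transpose A)" shows "diagonalizable A"
proof -
  obtain D R S where D: "\<And>i j. i \<noteq> j \<Longrightarrow> D $ i $ j = 0" "mutual_inverse R S" "transpose A = R ** D ** S"
    using diagonalizableE[OF assms] by metis
  then have "A = transpose (R ** D ** S)" by (metis transpose_transpose)
  then have "A = transpose S ** transpose D ** transpose R"
    by (simp add: matrix_transpose_mul matrix_mul_assoc)
  moreover have "transpose D $ i $ j = 0" if "i \<noteq> j" for i j using D(1) that by (simp add: transpose_def)
  ultimately show ?thesis using transpose_mutual_inverse[OF D(2)] by (intro diagonalizableI)
qed

lemma eigenvalue_of_det: "eigenvalue_of A c \<longleftrightarrow> det (A - mat c) = 0"
proof -
  have "(A - mat c) *v v = A *v v - c *s v" for v :: "complex ^ 3"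
    by (simp add: matrix_vector_mult_diff_rdistrib vec_eq_iff matrix_vector_entry3 mat_entry forall_3)
  then have "eigenvalue_of A c \<longleftrightarrow> (\<exists>v. v \<noteq> 0 \<and> (A - mat c) *v v = 0)"
    by (simp add: eigenvalue_of_def)
  also have "\<dots> \<longleftrightarrow> \<not> invertible (A - mat c)"
    by (metis invertible_left_inverse matrix_left_invertible_ker)
  finally show ?thesis by (simp add: invertible_det_nz)
qed

lemma eigenvalue_of_conj:
  assumes "mutual_inverse P Q" shows "eigenvalue_of (P ** A ** Q) c \<longleftrightarrow> eigenvalue_of A c"
proof -
  have "P ** A ** Q - mat c = P ** (A - mat c) ** Q"
  proof -
    have "P ** (A - mat c) = P ** A - P ** mat c" "(P ** A - P ** mat c) ** Q = P ** A ** Q - P ** mat c ** Q"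
      by (simp_all add: vec_eq_iff matrix_mult_entry3 algebra_simps)
    then show ?thesis using conj_mat[OF assms, of c] by simp
  qed
  moreover have "det P * det Q = 1" using assms by (metis det_I det_mul mutual_inverse_def)
  ultimately show ?thesis unfolding eigenvalue_of_det by (auto simp: det_mul)
qed

lemma eigenvalue_of_transpose: "eigenvalue_of (transpose A) c \<longleftrightarrow> eigenvalue_of A c"
proof -
  have "transpose A - mat c = transpose (A - mat c)"
    by (simp add: vec_eq_iff transpose_def mat_entry)
  then show ?thesis by (simp add: eigenvalue_of_det det_transpose)
qed

lemma eigenvalue_exists: "\<exists>c. eigenvalue_of A c"
proof -
  define p where "p = [: det A, A$1$2 * A$2$1 + A$1$3 * A$3$1 + A$2$3 * A$3$2 - A$1$1 * A$2$2 - A$1$1 * A$3$3 - A$2$2 * A$3$3,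
      A$1$1 + A$2$2 + A$3$3, -1 :]"
  have p: "poly p c = det (A - mat c)" for c
    by (simp add: p_def det_3 mat_entry algebra_simps)
  have "\<not> constant (poly p)" by (simp add: constant_degree p_def)
  then show ?thesis using fundamental_theorem_of_algebra[of p] by (simp add: eigenvalue_of_det p)
qed

definition upper :: "cmat3 \<Rightarrow> bool" where
  "upper A \<longleftrightarrow> A$2$1 = 0 \<and> A$3$1 = 0 \<and> A$3$2 = 0"

lemma upper_diag_eigenvalue: "upper A \<Longrightarrow> eigenvalue_of A (A$i$i)"
  using exhaust_3[of i] by (auto simp: eigenvalue_of_det det_3 upper_def mat_entry)

text \<open>The hypotheses are the equations for an upper unitriangular matrix
  with off-diagonal entries \<open>p\<close>, \<open>q\<close>, \<open>r\<close> whose columns are eigenvectors.\<close>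

lemma upper_diagonalizable:
  assumes "upper A"
    and "A$1$1 * p + A$1$2 = p * A$2$2" "A$2$2 * r + A$2$3 = r * A$3$3"
      "A$1$1 * q + A$1$2 * r + A$1$3 = q * A$3$3"
  shows "diagonalizable A"
proof -
  define P :: cmat3 where "P = vector [vector [1, p, q], vector [0, 1, r], vector [0, 0, 1]]"
  define D :: cmat3 where "D = (\<chi> i j. if i = j then A $ i $ i else 0)"
  have "det P \<noteq> 0" by (simp add: P_def det_3)
  then obtain Q where Q: "mutual_inverse Q P" using mutual_inverse_if_det by blast
  have "A ** P = P ** D"
    using assms by (simp add: vec_eq_iff forall_3 matrix_mult_entry3 P_def D_def upper_def)
  then have "A ** (P ** Q) = P ** D ** Q" by (simp add: matrix_mul_assoc)
  then have "A = P ** D ** Q" using Q by (simp only: mutual_inverse_def matrix_mul_rid)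
  then show ?thesis using mutual_inverse_sym[OF Q] by (intro diagonalizableI[of D]) (simp_all add: D_def)
qed

text \<open>Each equation for an eigenvector basis is solvable if it involves two different diagonal
  entries or if its inhomogeneous term vanishes.\<close>

lemma upper_nondiagonalizable_cases:
  assumes "upper A" "\<not> diagonalizable A"
  shows "A$1$1 = A$2$2 \<or> A$2$2 = A$3$3 \<or> A$1$1 = A$3$3"
    and "A$1$1 = A$2$2 \<Longrightarrow> A$2$2 \<noteq> A$3$3 \<Longrightarrow> A$1$2 \<noteq> 0"
    and "A$2$2 = A$3$3 \<Longrightarrow> A$1$1 \<noteq> A$2$2 \<Longrightarrow> A$2$3 \<noteq> 0"
proof -
  define x y z a b c where d: "x = A$1$1" "y = A$2$2" "z = A$3$3" "a = A$1$2" "b = A$1$3" "c = A$2$3"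
  have nd: False if "x * p + a = p * y" "y * r + c = r * z" "x * q + (a * r + b) = q * z" for p q r
    using upper_diagonalizable[OF assms(1), of p r q] assms(2) that by (simp add: d add.assoc)
  have s: "u * (e / (v - u)) + e = e / (v - u) * v" if "u \<noteq> v" for u v e :: complex
  proof -
    define w where "w = e / (v - u)"
    have "w * (v - u) = e" using that by (simp add: w_def)
    then have e: "e = w * v - w * u" by (simp add: right_diff_distrib)
    show ?thesis unfolding w_def[symmetric] by (simp add: e)
  qed
  show "A$1$1 = A$2$2 \<or> A$2$2 = A$3$3 \<or> A$1$1 = A$3$3"
  proof (rule ccontr)
    assume "\<not> ?thesis"
    then have "x \<noteq> y" "y \<noteq> z" "x \<noteq> z" by (auto simp: d)
    then show False using nd[OF s s s] by blast
  qed
  show "A$1$2 \<noteq> 0" if "A$1$1 = A$2$2" "A$2$2 \<noteq> A$3$3"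
  proof
    assume "A$1$2 = 0"
    then have "x * 0 + a = 0 * y" "y \<noteq> z" "x \<noteq> z" using that by (auto simp: d)
    then show False using nd[OF _ s s] by blast
  qed
  show "A$2$3 \<noteq> 0" if "A$2$2 = A$3$3" "A$1$1 \<noteq> A$2$2"
  proof
    assume "A$2$3 = 0"
    then have "y * 0 + c = 0 * z" "x \<noteq> y" "x \<noteq> z" using that by (auto simp: d)
    then show False using nd[OF s _ s] by blast
  qed
qed

section \<open>Simultaneous triangularization\<close>

definition triangularizable :: "cmat3 set \<Rightarrow> bool" where
  "triangularizable \<Gamma> \<longleftrightarrow> (\<exists>P Q. mutual_inverse P Q \<and> (\<forall>A\<in>\<Gamma>. upper (P ** A ** Q)))"

lemma triangularizable_conj:
  assumes "mutual_inverse P Q" "triangularizable ((\<lambda>A. P ** A ** Q) ` \<Gamma>)"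
  shows "triangularizable \<Gamma>"
proof -
  obtain R S where RS: "mutual_inverse R S" "\<And>A. A \<in> \<Gamma> \<Longrightarrow> upper (R ** (P ** A ** Q) ** S)"
    using assms(2) unfolding triangularizable_def by blast
  have "mutual_inverse (R ** P) (Q ** S)" by (rule mutual_inverse_mult[OF RS(1) assms(1)])
  moreover have "upper ((R ** P) ** A ** (Q ** S))" if "A \<in> \<Gamma>" for A
    using RS(2)[OF that] by (simp only: conj_conj)
  ultimately show ?thesis unfolding triangularizable_def by blast
qed

text \<open>Transposition makes upper matrices lower; conjugation with the reversal \<open>J\<close>
  restores the upper shape.\<close>

lemma triangularizable_transpose:
  assumes "triangularizable (transpose ` \<Gamma>)" shows "triangularizable \<Gamma>"
proof -
  obtain R S where RS: "mutual_inverse R S" "\<And>A. A \<in> \<Gamma> \<Longrightarrow> upper (R ** transpose A ** S)"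
    using assms unfolding triangularizable_def by blast
  define J :: cmat3 where "J = vector [vector [0, 0, 1], vector [0, 1, 0], vector [1, 0, 0]]"
  have J: "mutual_inverse J J"
    by (simp add: mutual_inverse_def vec_eq_iff forall_3 matrix_mult_entry3 J_def mat_entry)
  have "mutual_inverse (J ** transpose S) (transpose R ** J)"
    by (rule mutual_inverse_mult[OF J transpose_mutual_inverse[OF RS(1)]])
  moreover have "upper ((J ** transpose S) ** A ** (transpose R ** J))" if "A \<in> \<Gamma>" for A
  proof -
    have "transpose (R ** transpose A ** S) = transpose S ** A ** transpose R"
      by (simp add: matrix_transpose_mul matrix_mul_assoc)
    then have "(J ** transpose S) ** A ** (transpose R ** J) = J ** transpose (R ** transpose A ** S) ** J"
      by (simp add: matrix_mul_assoc)
    then show ?thesis using RS(2)[OF that]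
      by (simp add: upper_def matrix_mult_entry3 J_def transpose_def)
  qed
  ultimately show ?thesis unfolding triangularizable_def by blast
qed

section \<open>Matrices with a common eigenvector and their lower right block\<close>

definition first_col :: "cmat3 \<Rightarrow> bool" where
  "first_col A \<longleftrightarrow> A$2$1 = 0 \<and> A$3$1 = 0"

text \<open>The characteristic polynomial of the lower right block, evaluated at the first diagonal entry.\<close>

definition block_char :: "cmat3 \<Rightarrow> complex" where
  "block_char A = (A$2$2 - A$1$1) * (A$3$3 - A$1$1) - A$2$3 * A$3$2"

text \<open>The determinant factors as \<open>A$1$1 - c\<close> times a monic quadratic q(c), and
  q(x - 1) + q(x + 1) = 2 q(x) + 2. So the value is read off the characteristic polynomial, which
  makes it invariant under conjugation.\<close>

lemma block_char_det:
  assumes "first_col A"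
  shows "2 * block_char A = det (A - mat (A$1$1 - 1)) - det (A - mat (A$1$1 + 1)) - 2"
  using assms by (simp add: first_col_def block_char_def det_3 mat_entry algebra_simps)

lemma block_char_conj:
  assumes "mutual_inverse P Q" "first_col A" "first_col (P ** A ** Q)" "(P ** A ** Q)$1$1 = A$1$1"
  shows "block_char (P ** A ** Q) = block_char A"
proof -
  have "det (P ** A ** Q - mat c) = det (A - mat c)" for c
  proof -
    have "P ** (A - mat c) = P ** A - P ** mat c" "(P ** A - P ** mat c) ** Q = P ** A ** Q - P ** mat c ** Q"
      by (simp_all add: vec_eq_iff matrix_mult_entry3 algebra_simps)
    then have "P ** A ** Q - mat c = P ** (A - mat c) ** Q" using conj_mat[OF assms(1), of c] by simp
    moreover have "det P * det Q = 1" using assms(1) by (metis det_I det_mul mutual_inverse_def)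
    ultimately show ?thesis by (simp add: det_mul)
  qed
  then have "2 * block_char (P ** A ** Q) = 2 * block_char A"
    using block_char_det[OF assms(2)] block_char_det[OF assms(3)] assms(4) by simp
  then show ?thesis by simp
qed

lemma common_eigenvector_first_col:
  assumes "v \<noteq> 0"
  obtains P Q where "mutual_inverse P Q" "\<And>A c. A *v v = c *s v \<Longrightarrow> first_col (P ** A ** Q)"
proof -
  have "\<exists>Q::cmat3. det Q \<noteq> 0 \<and> (\<forall>i. Q$i$1 = v$i)"
  proof -
    consider "v$1 \<noteq> 0" | "v$2 \<noteq> 0" | "v$3 \<noteq> 0" using assms by (auto simp: vec_eq_iff forall_3)
    then show ?thesis
    proof cases
      case 1
      then show ?thesis
        by (intro exI[of _ "vector [vector [v$1, 0, 0], vector [v$2, 1, 0], vector [v$3, 0, 1]]"])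
           (simp add: det_3 forall_3)
    next
      case 2
      then show ?thesis
        by (intro exI[of _ "vector [vector [v$1, 1, 0], vector [v$2, 0, 0], vector [v$3, 0, 1]]"])
           (simp add: det_3 forall_3)
    next
      case 3
      then show ?thesis
        by (intro exI[of _ "vector [vector [v$1, 1, 0], vector [v$2, 0, 1], vector [v$3, 0, 0]]"])
           (simp add: det_3 forall_3)
    qed
  qed
  then obtain Q :: cmat3 where Q: "det Q \<noteq> 0" "\<And>i. Q$i$1 = v$i" by blast
  obtain P where P: "mutual_inverse P Q" using mutual_inverse_if_det[OF Q(1)] by blast
  have "first_col (P ** A ** Q)" if A: "A *v v = c *s v" for A c
  proof -
    have AQ: "(A ** Q) $ i $ 1 = c * Q $ i $ 1" for i
      using A by (simp add: vec_eq_iff matrix_vector_entry3 matrix_mult_entry3 Q(2))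
    have "(P ** (A ** Q)) $ i $ 1 = c * (P ** Q) $ i $ 1" for i
      unfolding matrix_mult_entry3[of P] AQ by (simp add: algebra_simps)
    then show ?thesis using P by (simp add: mutual_inverse_def first_col_def mat_entry matrix_mul_assoc)
  qed
  then show thesis using that P by blast
qed

lemma block_eigenvector:
  fixes p q r s :: complex
  shows "\<exists>y z t. (y \<noteq> 0 \<or> z \<noteq> 0) \<and> p * y + q * z = t * y \<and> r * y + s * z = t * z"
proof (cases "q = 0")
  case True
  then show ?thesis by (intro exI[of _ 0] exI[of _ 1] exI[of _ s]) simp
next
  case False
  \<comment> \<open>A square root of the discriminant; the root \<open>t\<close> has the eigenvector
    (q, t - p).\<close>
  define d where "d = csqrt ((p - s)\<^sup>2 + 4 * q * r)"
  define t where "t = (p + s + d) / 2"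
  have "d\<^sup>2 = (p - s)\<^sup>2 + 4 * q * r" by (simp add: d_def)
  moreover have "4 * ((t - p) * (t - s)) = d\<^sup>2 - (p - s)\<^sup>2"
    by (simp add: t_def power2_eq_square field_simps)
  ultimately have "(t - p) * (t - s) = q * r" by simp
  then have "r * q + s * (t - p) = t * (t - p)" by (simp add: algebra_simps)
  then show ?thesis using False by (intro exI[of _ q] exI[of _ "t - p"] exI[of _ t]) (simp add: algebra_simps)
qed

text \<open>\<open>Q\<close> takes the second basis vector to (0, y, z), so an eigenvector of the
  block becomes a basis vector. The last clause serves to conjugate back: a scalar block cannot come
  from a block with nonzero lower left entry.\<close>

lemma block_conjugation:
  assumes "y \<noteq> 0 \<or> z \<noteq> (0::complex)"
  obtains P Q where "mutual_inverse P Q"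
    "\<And>A. first_col A \<Longrightarrow> first_col (P ** A ** Q) \<and> (P ** A ** Q)$1$1 = A$1$1"
    "\<And>A t. first_col A \<Longrightarrow> A$2$2 * y + A$2$3 * z = t * y \<Longrightarrow> A$3$2 * y + A$3$3 * z = t * z \<Longrightarrow>
       upper (P ** A ** Q)"
    "\<And>A. first_col A \<Longrightarrow> A$2$3 = 0 \<Longrightarrow> A$3$2 = 0 \<Longrightarrow> A$2$2 = A$3$3 \<Longrightarrow> (Q ** A ** P)$3$2 = 0"
proof (cases "y = 0")
  case False
  define Q :: cmat3 where "Q = vector [vector [1, 0, 0], vector [0, y, 0], vector [0, z, 1]]"
  define P :: cmat3 where "P = vector [vector [1, 0, 0], vector [0, 1 / y, 0], vector [0, - z / y, 1]]"
  show thesis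
  proof (rule that[of P Q])
    show "mutual_inverse P Q"
      using False by (simp add: mutual_inverse_def vec_eq_iff forall_3 matrix_mult_entry3 P_def Q_def mat_entry)
    show "first_col (P ** A ** Q) \<and> (P ** A ** Q)$1$1 = A$1$1" if "first_col A" for A
      using that by (simp add: first_col_def matrix_mult_entry3 P_def Q_def)
    show "(Q ** A ** P)$3$2 = 0" if "first_col A" "A$2$3 = 0" "A$3$2 = 0" "A$2$2 = A$3$3" for A
      using that False by (simp add: first_col_def matrix_mult_entry3 P_def Q_def)
    show "upper (P ** A ** Q)" if "first_col A" "A$2$2 * y + A$2$3 * z = t * y" "A$3$2 * y + A$3$3 * z = t * z" for A t
    proof -
      have "(P ** A ** Q)$3$2 = (- z / y) * (A$2$2 * y + A$2$3 * z) + (A$3$2 * y + A$3$3 * z)"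
        by (simp add: matrix_mult_entry3 P_def Q_def algebra_simps)
      also have "\<dots> = 0" unfolding that(2,3) using False by simp
      finally show ?thesis using that(1) by (simp add: upper_def first_col_def matrix_mult_entry3 P_def Q_def)
    qed
  qed
next
  case True
  then have z: "z \<noteq> 0" using assms by simp
  define Q :: cmat3 where "Q = vector [vector [1, 0, 0], vector [0, 0, 1], vector [0, z, 0]]"
  define P :: cmat3 where "P = vector [vector [1, 0, 0], vector [0, 0, 1 / z], vector [0, 1, 0]]"
  show thesis
  proof (rule that[of P Q])
    show "mutual_inverse P Q"
      using z by (simp add: mutual_inverse_def vec_eq_iff forall_3 matrix_mult_entry3 P_def Q_def mat_entry)
    show "first_col (P ** A ** Q) \<and> (P ** A ** Q)$1$1 = A$1$1" if "first_col A" for A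
      using that by (simp add: first_col_def matrix_mult_entry3 P_def Q_def)
    show "(Q ** A ** P)$3$2 = 0" if "first_col A" "A$2$3 = 0" "A$3$2 = 0" "A$2$2 = A$3$3" for A
      using that by (simp add: first_col_def matrix_mult_entry3 P_def Q_def)
    show "upper (P ** A ** Q)" if "first_col A" "A$2$2 * y + A$2$3 * z = t * y" "A$3$2 * y + A$3$3 * z = t * z" for A t
      using that z True by (simp add: upper_def first_col_def matrix_mult_entry3 P_def Q_def)
  qed
qed

lemma single_triangularizable:
  obtains P Q where "mutual_inverse P Q" "upper (P ** A ** Q)"
proof -
  obtain c where "eigenvalue_of A c" using eigenvalue_exists[of A] by (rule exE)
  then obtain v where v: "v \<noteq> 0" "A *v v = c *s v" unfolding eigenvalue_of_def by (elim exE conjE)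
  obtain P Q where PQ: "mutual_inverse P Q" "\<And>A c. A *v v = c *s v \<Longrightarrow> first_col (P ** A ** Q)"
    by (rule common_eigenvector_first_col[OF v(1)]) blast
  define B where "B = P ** A ** Q"
  have B: "first_col B" unfolding B_def using v(2) by (rule PQ(2))
  obtain y z t where yz: "y \<noteq> 0 \<or> z \<noteq> 0"
    "B$2$2 * y + B$2$3 * z = t * y" "B$3$2 * y + B$3$3 * z = t * z"
    using block_eigenvector[of "B$2$2" "B$2$3" "B$3$2" "B$3$3"] by (elim exE conjE)
  obtain R S where RS: "mutual_inverse R S" "upper (R ** B ** S)"
    by (rule block_conjugation[OF yz(1)]) (use B yz(2,3) in blast)
  have "upper ((R ** P) ** A ** (Q ** S))" using RS(2) unfolding B_def conj_conj .
  then show thesis using that[OF mutual_inverse_mult[OF RS(1) PQ(1)]] by blast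
qed

section \<open>Bounded traces and orthogonality\<close>

lemma linear_growth_bounded:
  fixes a b :: complex
  assumes "\<And>n::nat. cmod (a + of_nat n * b) \<le> K"
  shows "b = 0"
proof (rule ccontr)
  assume "b \<noteq> 0"
  then obtain n :: nat where n: "K + cmod a < real n * cmod b"
    using reals_Archimedean3[of "cmod b"] by auto
  have "cmod (of_nat n * b) = cmod ((a + of_nat n * b) - a)" by simp
  also have "\<dots> \<le> cmod (a + of_nat n * b) + cmod a" by (rule norm_triangle_ineq4)
  also have "\<dots> \<le> K + cmod a" using assms by simp
  finally show False using n by (simp add: norm_mult)
qed

locale parabolic_monoid =
  fixes \<Gamma> :: "cmat3 set"
  assumes one: "mat 1 \<in> \<Gamma>"
    and mult: "\<And>A B. A \<in> \<Gamma> \<Longrightarrow> B \<in> \<Gamma> \<Longrightarrow> A ** B \<in> \<Gamma>"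
    and eig: "\<And>A c. A \<in> \<Gamma> \<Longrightarrow> eigenvalue_of A c \<Longrightarrow> cmod c = 1"
    and diag: "\<And>A. A \<in> \<Gamma> \<Longrightarrow> diagonalizable A \<Longrightarrow> \<exists>c. A = mat c"
begin

lemma conj:
  assumes "mutual_inverse P Q" shows "parabolic_monoid ((\<lambda>A. P ** A ** Q) ` \<Gamma>)"
proof
  show "mat 1 \<in> (\<lambda>A. P ** A ** Q) ` \<Gamma>"
    using one conj_mat[OF assms, of 1] by (metis image_eqI)
next
  fix A B assume "A \<in> (\<lambda>A. P ** A ** Q) ` \<Gamma>" "B \<in> (\<lambda>A. P ** A ** Q) ` \<Gamma>"
  then obtain A' B' where "A = P ** A' ** Q" "B = P ** B' ** Q" "A' \<in> \<Gamma>" "B' \<in> \<Gamma>" by blast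
  then show "A ** B \<in> (\<lambda>A. P ** A ** Q) ` \<Gamma>"
    using conj_mult[OF assms] mult by simp
next
  fix A c assume "A \<in> (\<lambda>A. P ** A ** Q) ` \<Gamma>" "eigenvalue_of A c"
  then show "cmod c = 1" using eigenvalue_of_conj[OF assms] eig by auto
next
  fix A assume "A \<in> (\<lambda>A. P ** A ** Q) ` \<Gamma>" "diagonalizable A"
  then obtain B where "A = P ** B ** Q" "B \<in> \<Gamma>" "diagonalizable B"
    using diagonalizable_conj[OF assms] by auto
  then show "\<exists>c. A = mat c" using diag conj_mat[OF assms] by metis
qed

lemma transpose: "parabolic_monoid (transpose ` \<Gamma>)"
proof
  show "mat 1 \<in> transpose ` \<Gamma>" using one by (metis image_eqI transpose_mat)
next
  fix A B assume "A \<in> transpose ` \<Gamma>" "B \<in> transpose ` \<Gamma>"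
  then obtain A' B' where "A = transpose A'" "B = transpose B'" "A' \<in> \<Gamma>" "B' \<in> \<Gamma>" by blast
  then show "A ** B \<in> transpose ` \<Gamma>" using mult by (metis image_eqI matrix_transpose_mul)
next
  fix A c assume "A \<in> transpose ` \<Gamma>" "eigenvalue_of A c"
  then show "cmod c = 1" using eigenvalue_of_transpose eig by auto
next
  fix A :: cmat3 assume "A \<in> transpose ` \<Gamma>" "diagonalizable A"
  then obtain B where "A = transpose B" "B \<in> \<Gamma>" "diagonalizable B"
    using diagonalizable_transpose by auto
  then show "\<exists>c. A = mat c" using diag transpose_mat by metis
qed

lemma trace_bound:
  assumes "A \<in> \<Gamma>" shows "cmod (trace A) \<le> 3"
proof -
  obtain P Q where PQ: "mutual_inverse P Q" "upper (P ** A ** Q)" by (rule single_triangularizable)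
  define U where "U = P ** A ** Q"
  have u: "cmod (U$i$i) = 1" for i
    using upper_diag_eigenvalue[OF PQ(2), of i] eigenvalue_of_conj[OF PQ(1)] eig[OF assms] unfolding U_def by blast
  have "trace U = trace (Q ** (P ** A))" unfolding U_def by (rule trace_mul_sym)
  then have "trace A = U$1$1 + U$2$2 + U$3$3"
    using PQ(1) by (simp add: matrix_mul_assoc mutual_inverse_def trace3)
  also have "cmod \<dots> \<le> cmod (U$1$1) + cmod (U$2$2) + cmod (U$3$3)"
    by (intro norm_triangle_le add_mono norm_triangle_ineq order_refl)
  finally show ?thesis by (simp add: u)
qed

lemma det_nonzero: "A \<in> \<Gamma> \<Longrightarrow> det A \<noteq> 0"
  using eig[of A 0] eigenvalue_of_det[of A 0] by (auto simp: mat_0)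

text \<open>If the entries of \<open>g\<^sup>n\<close> grew, then so would traces; hence a nilpotent part of \<open>g\<close> is
  trace-orthogonal to the whole monoid.\<close>

lemma trace_nilpotent_part:
  assumes g: "g \<in> \<Gamma>" and l: "cmod l = 1"
    and Y: "Y ** g = mat l ** Y + X" and X: "X ** g = mat l ** X"
    and bound: "\<And>h. h \<in> \<Gamma> \<Longrightarrow> cmod (trace (Y ** h)) \<le> K" and h: "h \<in> \<Gamma>"
  shows "trace (X ** h) = 0"
proof -
  define p where "p n = (((**) g) ^^ n) h" for n
  have p0: "p 0 = h" and pS: "p (Suc n) = g ** p n" for n by (simp_all add: p_def)
  have p: "p n \<in> \<Gamma>" for n by (induction n) (use h g mult p0 pS in auto)
  have tr: "trace (mat l ** M) = l * trace M" for M :: cmat3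
    by (simp add: trace3 mat_mult_left algebra_simps)
  have x: "trace (X ** p n) = l ^ n * trace (X ** h)" for n
  proof (induction n)
    case (Suc n)
    have "X ** p (Suc n) = mat l ** (X ** p n)" by (simp add: pS matrix_mul_assoc X)
    then show ?case using Suc by (simp add: tr)
  qed (simp add: p0)
  \<comment> \<open>The factor \<open>l\<close> avoids powers of \<open>l\<close> with exponent
    \<open>n - 1\<close>; the nilpotent part contributes the term linear in
    \<open>n\<close>.\<close>
  have y: "l * trace (Y ** p n) = l ^ n * (l * trace (Y ** h) + of_nat n * trace (X ** h))" for n
  proof (induction n)
    case (Suc n)
    have "Y ** p (Suc n) = mat l ** (Y ** p n) + X ** p n"
      by (simp add: pS matrix_mul_assoc Y) (simp add: vec_eq_iff matrix_mult_entry3 mat_mult_left algebra_simps)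
    then have "trace (Y ** p (Suc n)) = l * trace (Y ** p n) + l ^ n * trace (X ** h)"
      by (simp add: trace_add tr x)
    also have "\<dots> = l ^ n * (l * trace (Y ** h) + of_nat n * trace (X ** h)) + l ^ n * trace (X ** h)"
      by (simp only: Suc)
    finally show ?case by (simp add: algebra_simps)
  qed (simp add: p0)
  have "cmod (l * trace (Y ** h) + of_nat n * trace (X ** h)) \<le> K" for n
  proof -
    have "cmod (l * trace (Y ** h) + of_nat n * trace (X ** h)) = cmod (l * trace (Y ** p n))"
      using l by (simp add: y norm_mult norm_power)
    also have "\<dots> \<le> K" using bound[OF p] l by (simp add: norm_mult)
    finally show ?thesis .
  qed
  then show ?thesis by (rule linear_growth_bounded)
qed

end

context parabolic_monoid
begin

text \<open>For \<open>Y = g - mat k\<close> the defect \<open>X\<close> is (g - l)(g - k), with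
  \<open>l\<close> the repeated and \<open>k\<close> the remaining eigenvalue. Cayley-Hamilton gives
  \<open>X ** g = mat l ** X\<close>, and non-diagonalizability makes \<open>X\<close> a nonzero
  product of a column \<open>v\<close> and a row \<open>f\<close>, except when all eigenvalues agree
  and \<open>g - mat l\<close> squares to zero.\<close>

lemma upper_orthogonal_pair:
  assumes g: "g \<in> \<Gamma>" "upper g" and ns: "\<And>c. g \<noteq> mat c"
  obtains v f :: "complex ^ 3" where "v \<noteq> 0" "f \<noteq> 0"
    "\<And>h. h \<in> \<Gamma> \<Longrightarrow> trace ((\<chi> i j. v$i * f$j) ** h) = 0"
proof -
  note pair = that
  define x y z a b c where d: "x = g$1$1" "y = g$2$2" "z = g$3$3" "a = g$1$2" "b = g$1$3" "c = g$2$3"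
  have low: "g$2$1 = 0" "g$3$1 = 0" "g$3$2 = 0" using g(2) by (auto simp: upper_def)
  have nd: "\<not> diagonalizable g" using diag[OF g(1)] ns by blast
  have unit: "cmod x = 1" "cmod y = 1" "cmod z = 1"
    using upper_diag_eigenvalue[OF g(2)] eig[OF g(1)] by (auto simp: d)
  have shift: "cmod (trace ((g - mat k) ** h)) \<le> 6" if "h \<in> \<Gamma>" "cmod k = 1" for h k
  proof -
    have "trace ((g - mat k) ** h) = trace (g ** h) - k * trace h"
      by (simp add: trace3 matrix_mult_entry3 mat_entry algebra_simps)
    also have "cmod \<dots> \<le> cmod (trace (g ** h)) + cmod (k * trace h)" by (rule norm_triangle_ineq4)
    also have "\<dots> \<le> 3 + 3" using trace_bound mult[OF g(1)] that by (intro add_mono) (auto simp: norm_mult)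
    finally show ?thesis by simp
  qed
  note simps = vec_eq_iff forall_3 matrix_mult_entry3 mat_entry d[symmetric] low
  have rank_one: thesis
    if "cmod l = 1" "cmod k = 1" "v \<noteq> 0" "f \<noteq> 0" and X: "X = (\<chi> i j. v$i * f$j)"
      and "(g - mat k) ** g = mat l ** (g - mat k) + X" "X ** g = mat l ** X" for l k v f X
  proof (rule pair[OF \<open>v \<noteq> 0\<close> \<open>f \<noteq> 0\<close>])
    fix h assume h: "h \<in> \<Gamma>"
    have "trace (X ** h) = 0"
      using trace_nilpotent_part[OF g(1) \<open>cmod l = 1\<close> that(6,7) shift[OF _ \<open>cmod k = 1\<close>] h] .
    then show "trace ((\<chi> i j. v$i * f$j) ** h) = 0" by (simp only: X)
  qed
  consider "x = y" "y = z" | "x = y" "y \<noteq> z" | "y = z" "x \<noteq> y" | "x = z" "x \<noteq> y"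
    using upper_nondiagonalizable_cases(1)[OF g(2) nd] unfolding d by metis
  then show thesis
  proof cases
    case 1
    show thesis
    proof (cases "a * c = 0")
      case False
      show thesis
      proof (rule rank_one[OF unit(1) unit(1)])
        show "(vector [1, 0, 0] :: complex ^ 3) \<noteq> 0" "(vector [0, 0, a * c] :: complex ^ 3) \<noteq> 0"
          using False by (simp_all add: vec_eq_iff forall_3)
        let ?X = "\<chi> i j. (vector [1, 0, 0] :: complex ^ 3)$i * (vector [0, 0, a * c] :: complex ^ 3)$j"
        show "?X = ?X" ..
        show "(g - mat x) ** g = mat x ** (g - mat x) + ?X" "?X ** g = mat x ** ?X"
          using 1 by (simp_all add: simps algebra_simps)
      qed
    next
      case True
      \<comment> \<open>Here \<open>g - mat x\<close> squares to zero and has rank one, so it takes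
        the role of \<open>X\<close>, with the identity as \<open>Y\<close>.\<close>
      define v f :: "complex ^ 3" where
        "v = (if a = 0 then vector [b, c, 0] else vector [1, 0, 0])" and
        "f = (if a = 0 then vector [0, 0, 1] else vector [0, a, b])"
      have abc: "a \<noteq> 0 \<or> b \<noteq> 0 \<or> c \<noteq> 0"
        using ns[of x] 1 by (auto simp: simps)
      show thesis
      proof (rule pair[of v f])
        show "v \<noteq> 0" "f \<noteq> 0" using abc by (auto simp: v_def f_def vec_eq_iff forall_3)
        fix h assume h: "h \<in> \<Gamma>"
        show "trace ((\<chi> i j. v$i * f$j) ** h) = 0"
        proof (rule trace_nilpotent_part[OF g(1) unit(1) _ _ _ h])
          show "mat 1 ** g = mat x ** mat 1 + (\<chi> i j. v$i * f$j)"
            "(\<chi> i j. v$i * f$j) ** g = mat x ** (\<chi> i j. v$i * f$j)"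
            using 1 True by (auto simp: simps v_def f_def algebra_simps)
          show "cmod (trace (mat 1 ** h)) \<le> 3" if "h \<in> \<Gamma>" for h
            using trace_bound[OF that] by simp
        qed
      qed
    qed
  next
    case 2
    have a: "a \<noteq> 0" using upper_nondiagonalizable_cases(2)[OF g(2) nd] 2 by (simp add: d)
    show thesis
    proof (rule rank_one[OF unit(1) unit(3)])
      show "(vector [1, 0, 0] :: complex ^ 3) \<noteq> 0" "(vector [0, a * (x - z), a * c] :: complex ^ 3) \<noteq> 0"
        using a 2 by (simp_all add: vec_eq_iff forall_3)
      let ?X = "\<chi> i j. (vector [1, 0, 0] :: complex ^ 3)$i * (vector [0, a * (x - z), a * c] :: complex ^ 3)$j"
      show "?X = ?X" ..
      show "(g - mat z) ** g = mat x ** (g - mat z) + ?X" "?X ** g = mat x ** ?X"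
        using 2 by (simp_all add: simps algebra_simps)
    qed
  next
    case 3
    have c: "c \<noteq> 0" using upper_nondiagonalizable_cases(3)[OF g(2) nd] 3 by (simp add: d)
    show thesis
    proof (rule rank_one[OF unit(2) unit(1)])
      show "(vector [a * c, c * (y - x), 0] :: complex ^ 3) \<noteq> 0" "(vector [0, 0, 1] :: complex ^ 3) \<noteq> 0"
        using c 3 by (simp_all add: vec_eq_iff forall_3)
      let ?X = "\<chi> i j. (vector [a * c, c * (y - x), 0] :: complex ^ 3)$i * (vector [0, 0, 1] :: complex ^ 3)$j"
      show "?X = ?X" ..
      show "(g - mat x) ** g = mat y ** (g - mat x) + ?X" "?X ** g = mat y ** ?X"
        using 3 by (simp_all add: simps algebra_simps)
    qed
  next
    case 4
    \<comment> \<open>The only nonzero entry of (g - x)(g - y); if it vanished, the equations for an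
      eigenvector basis could be solved.\<close>
    define e where "e = a * c + b * (x - y)"
    have e: "e \<noteq> 0"
    proof
      assume "e = 0"
      define p r where "p = a / (y - x)" and "r = c / (x - y)"
      have "p * (y - x) = a" "r * (x - y) = c" using 4(2) by (simp_all add: p_def r_def)
      then have p: "a = p * y - p * x" and r: "c = r * x - r * y"
        by (simp_all add: right_diff_distrib)
      have "(a * r + b) * (x - y) = 0" using \<open>e = 0\<close> unfolding e_def r by (simp add: algebra_simps)
      then have "a * r + b = 0" using 4 by simp
      then have "diagonalizable g"
        using 4 p r by (intro upper_diagonalizable[OF g(2), of p r 0]) (simp_all flip: d)
      then show False using nd by simp
    qed
    show thesis
    proof (rule rank_one[OF unit(1) unit(2)])
      show "(vector [e, 0, 0] :: complex ^ 3) \<noteq> 0" "(vector [0, 0, 1] :: complex ^ 3) \<noteq> 0"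
        using e by (simp_all add: vec_eq_iff forall_3)
      let ?X = "\<chi> i j. (vector [e, 0, 0] :: complex ^ 3)$i * (vector [0, 0, 1] :: complex ^ 3)$j"
      show "?X = ?X" ..
      show "(g - mat y) ** g = mat x ** (g - mat y) + ?X" "?X ** g = mat x ** ?X"
        using 4 by (simp_all add: simps e_def algebra_simps)
    qed
  qed
qed

text \<open>The functional \<open>f\<close> vanishes on all \<open>h *v v\<close>, which span a
  proper invariant subspace. Unless this is the line of \<open>v\<close> it is a plane, whose
  annihilator is the line of \<open>f\<close> and is preserved by all transposes.\<close>

lemma orthogonal_pair_reducible:
  fixes v f :: "complex ^ 3"
  assumes v: "v \<noteq> 0" and f: "f \<noteq> 0"
    and orth: "\<And>h. h \<in> \<Gamma> \<Longrightarrow> trace ((\<chi> i j. v$i * f$j) ** h) = 0"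
  shows "(\<exists>v. v \<noteq> 0 \<and> (\<forall>h\<in>\<Gamma>. \<exists>c. h *v v = c *s v)) \<or>
    (\<exists>f. f \<noteq> 0 \<and> (\<forall>h\<in>\<Gamma>. \<exists>c. transpose h *v f = c *s f))"
proof (cases "\<forall>h\<in>\<Gamma>. \<exists>c. h *v v = c *s v")
  case True
  then show ?thesis using v by blast
next
  case False
  then obtain h0 where h0: "h0 \<in> \<Gamma>" "\<And>c. h0 *v v \<noteq> c *s v" by blast
  define w where "w = h0 *v v"
  \<comment> \<open>The cross product of \<open>v\<close> and \<open>w\<close>; every functional
    vanishing on both is parallel to it.\<close>
  define n :: "complex ^ 3" where
    "n = vector [v$2 * w$3 - v$3 * w$2, v$3 * w$1 - v$1 * w$3, v$1 * w$2 - v$2 * w$1]"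
  define dot :: "complex ^ 3 \<Rightarrow> complex ^ 3 \<Rightarrow> complex" where "dot p q = p$1 * q$1 + p$2 * q$2 + p$3 * q$3" for p q
  have f_orth: "dot f (h *v v) = 0" if "h \<in> \<Gamma>" for h
    using orth[OF that] by (simp add: dot_def trace3 matrix_mult_entry3 matrix_vector_entry3 algebra_simps)
  have parallel: "p$i * n$j = p$j * n$i" if "dot p v = 0" "dot p w = 0" for p i j
  proof -
    have "p$1 * n$2 - p$2 * n$1 = v$3 * dot p w - w$3 * dot p v"
      "p$1 * n$3 - p$3 * n$1 = w$2 * dot p v - v$2 * dot p w"
      "p$2 * n$3 - p$3 * n$2 = v$1 * dot p w - w$1 * dot p v"
      by (simp_all add: n_def dot_def algebra_simps)
    then show ?thesis using that exhaust_3[of i] exhaust_3[of j] by auto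
  qed
  have n: "n \<noteq> 0"
  proof
    assume "n = 0"
    then have "v$i * w$j = v$j * w$i" for i j
      using exhaust_3[of i] exhaust_3[of j] by (auto simp: n_def vec_eq_iff forall_3)
    moreover obtain k where "v$k \<noteq> 0" using v by (auto simp: vec_eq_iff)
    ultimately have "w = (w$k / v$k) *s v"
      by (auto simp: vec_eq_iff field_simps)
    then show False using h0(2) unfolding w_def by blast
  qed
  then obtain k where k: "n$k \<noteq> 0" by (auto simp: vec_eq_iff)
  have fv: "dot f v = 0" "dot f w = 0" using f_orth[OF one] f_orth[OF h0(1)] by (simp_all add: w_def)
  have fk: "f$k \<noteq> 0"
  proof
    assume "f$k = 0"
    then have "f$i = 0" for i using parallel[OF fv, of i k] k by simp
    then show False using f by (simp add: vec_eq_iff)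
  qed
  have "transpose h *v f = ((transpose h *v f)$k / f$k) *s f" if h: "h \<in> \<Gamma>" for h
  proof -
    let ?p = "transpose h *v f"
    have adj: "dot ?p u = dot f (h *v u)" for u
      by (simp add: dot_def matrix_vector_entry3 transpose_def algebra_simps)
    have "dot ?p v = 0" "dot ?p w = 0"
      using f_orth[OF h] f_orth[OF mult[OF h h0(1)]]
      by (simp_all only: adj w_def matrix_vector_mul_assoc)
    from parallel[OF this] have p: "?p$i * n$k = ?p$k * n$i" for i .
    have "?p$i * f$k = ?p$k * f$i" for i
    proof -
      have "(?p$i * f$k) * n$k = (?p$k * n$i) * f$k" using p[of i] by (simp add: algebra_simps)
      also have "\<dots> = ?p$k * (f$i * n$k)" using parallel[OF fv, of i k] by (simp add: algebra_simps)
      finally show ?thesis using k by (simp add: algebra_simps)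
    qed
    then have c: "?p$i = (?p$k / f$k) * f$i" for i using fk by (simp add: nonzero_eq_divide_eq)
    show ?thesis
      unfolding vec_eq_iff vector_smult_component by (intro allI c)
  qed
  then show ?thesis using f by blast
qed

text \<open>The trace argument inside the lower block: \<open>Y\<close> projects onto it, and
  \<open>trace (X ** h)\<close> equals \<open>g$2$3 * h$3$2\<close>.\<close>

lemma upper_if_block_nilpotent:
  assumes fc: "\<And>h. h \<in> \<Gamma> \<Longrightarrow> first_col h"
    and g: "g \<in> \<Gamma>" "upper g" "g$2$2 = g$3$3" "g$2$3 \<noteq> 0" and h: "h \<in> \<Gamma>"
  shows "upper h"
proof -
  define Y :: cmat3 where "Y = vector [vector [0, 0, 0], vector [0, 1, 0], vector [0, 0, 1]]"
  define X :: cmat3 where "X = vector [vector [0, 0, 0], vector [0, 0, g$2$3], vector [0, 0, 0]]"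
  have "trace (X ** h) = 0"
  proof (rule trace_nilpotent_part[OF g(1) _ _ _ _ h])
    show "cmod (g$2$2) = 1" using upper_diag_eigenvalue[OF g(2)] eig[OF g(1)] by blast
    show "Y ** g = mat (g$2$2) ** Y + X" "X ** g = mat (g$2$2) ** X"
      using g(2,3) by (simp_all add: vec_eq_iff forall_3 matrix_mult_entry3 mat_entry X_def Y_def upper_def)
    show "cmod (trace (Y ** h)) \<le> 4" if h: "h \<in> \<Gamma>" for h
    proof -
      have "eigenvalue_of h (h$1$1)"
        using fc[OF h] by (simp add: eigenvalue_of_det det_3 mat_entry first_col_def)
      then have "cmod (h$1$1) = 1" using eig[OF h] by blast
      moreover have "trace (Y ** h) = trace h - h$1$1" by (simp add: trace3 matrix_mult_entry3 Y_def)
      ultimately show ?thesis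
        using trace_bound[OF h] norm_triangle_ineq4[of "trace h" "h$1$1"] by simp
    qed
  qed
  then have "h$3$2 = 0" using g(4) by (simp add: trace3 matrix_mult_entry3 X_def)
  then show ?thesis using fc[OF h] by (simp add: upper_def first_col_def)
qed

lemma triangularizable_if_upper: "(\<And>h. h \<in> \<Gamma> \<Longrightarrow> upper h) \<Longrightarrow> triangularizable \<Gamma>"
  unfolding triangularizable_def
  by (intro exI[of _ "mat 1"]) (simp add: mutual_inverse_def)

text \<open>A nonzero \<open>block_char\<close> separates the first eigenvalue from those of the
  block, so the failure of \<open>g\<close> to be diagonalizable comes from the block, which is
  therefore a nontrivial Jordan block.\<close>

lemma triangularizable_if_block_char:
  assumes fc: "\<And>h. h \<in> \<Gamma> \<Longrightarrow> first_col h" and g: "g \<in> \<Gamma>" "block_char g \<noteq> 0"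
  shows "triangularizable \<Gamma>"
proof -
  obtain y z t where yz: "y \<noteq> 0 \<or> z \<noteq> 0"
    "g$2$2 * y + g$2$3 * z = t * y" "g$3$2 * y + g$3$3 * z = t * z"
    using block_eigenvector[of "g$2$2" "g$2$3" "g$3$2" "g$3$3"] by (elim exE conjE)
  obtain P Q where PQ: "mutual_inverse P Q" and fcPQ: "\<And>A. first_col A \<Longrightarrow> first_col (P ** A ** Q) \<and> (P ** A ** Q)$1$1 = A$1$1"
    and up: "\<And>A t. first_col A \<Longrightarrow> A$2$2 * y + A$2$3 * z = t * y \<Longrightarrow> A$3$2 * y + A$3$3 * z = t * z \<Longrightarrow>
       upper (P ** A ** Q)"
    by (rule block_conjugation[OF yz(1)]) blast
  define B where "B = P ** g ** Q"
  have uB: "upper B" unfolding B_def by (rule up[OF fc[OF g(1)] yz(2,3)])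
  interpret C: parabolic_monoid "(\<lambda>A. P ** A ** Q) ` \<Gamma>" by (rule conj[OF PQ])
  have B: "B \<in> (\<lambda>A. P ** A ** Q) ` \<Gamma>" using g(1) by (simp add: B_def)
  have "block_char B = block_char g"
    unfolding B_def using fcPQ[OF fc[OF g(1)]] by (intro block_char_conj[OF PQ fc[OF g(1)]]) auto
  then have bc: "B$2$2 \<noteq> B$1$1" "B$3$3 \<noteq> B$1$1"
    using g(2) uB by (auto simp: block_char_def upper_def)
  have "\<not> diagonalizable B"
  proof
    assume "diagonalizable B"
    then obtain c where "B = mat c" using C.diag[OF B] by blast
    then show False using bc by (simp add: mat_entry)
  qed
  then have "B$2$2 = B$3$3" "B$2$3 \<noteq> 0"
    using upper_nondiagonalizable_cases(1,3)[OF uB] bc by auto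
  moreover have "first_col h" if "h \<in> (\<lambda>A. P ** A ** Q) ` \<Gamma>" for h using that fcPQ fc by blast
  ultimately have "triangularizable ((\<lambda>A. P ** A ** Q) ` \<Gamma>)"
    using C.upper_if_block_nilpotent[OF _ B uB] by (intro C.triangularizable_if_upper) blast
  then show ?thesis by (rule triangularizable_conj[OF PQ])
qed

end

context parabolic_monoid
begin

text \<open>Comparing \<open>block_char\<close> for \<open>h\<close> and \<open>g ** h\<close>
  forces a diagonal entry of the block of \<open>h\<close> to equal \<open>h$1$1\<close>, so every
  block is upper or lower triangular. A strictly upper and a strictly lower kind cannot both occur,
  as their product would have two nonzero off-diagonal entries.\<close>

lemma triangularizable_if_diagonal_block:
  assumes fc: "\<And>h. h \<in> \<Gamma> \<Longrightarrow> first_col h" and bc: "\<And>h. h \<in> \<Gamma> \<Longrightarrow> block_char h = 0"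
    and g: "g \<in> \<Gamma>" "g$2$3 = 0" "g$3$2 = 0" "g$2$2 \<noteq> g$3$3"
  shows "triangularizable \<Gamma>"
proof -
  have nz: "h$1$1 \<noteq> 0" "h$2$2 * h$3$3 - h$2$3 * h$3$2 \<noteq> 0" if h: "h \<in> \<Gamma>" for h
  proof -
    have "det h = h$1$1 * (h$2$2 * h$3$3 - h$2$3 * h$3$2)"
      using fc[OF h] by (simp add: det_3 first_col_def algebra_simps)
    then show "h$1$1 \<noteq> 0" "h$2$2 * h$3$3 - h$2$3 * h$3$2 \<noteq> 0" using det_nonzero[OF h] by auto
  qed
  define l m n where lmn: "l = g$1$1" "m = g$2$2" "n = g$3$3"
  have one_eq: "m = l \<or> n = l" "m \<noteq> n" using bc[OF g(1)] g by (auto simp: block_char_def lmn)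
  have split: "h$2$3 * h$3$2 = 0" if h: "h \<in> \<Gamma>" for h
  proof -
    have b: "h$2$3 * h$3$2 = (h$2$2 - h$1$1) * (h$3$3 - h$1$1)"
      using bc[OF h] by (simp add: block_char_def)
    have "(m * h$2$2 - l * h$1$1) * (n * h$3$3 - l * h$1$1) = (m * n) * (h$2$3 * h$3$2)"
      using bc[OF mult[OF g(1) h]] fc[OF g(1)] fc[OF h] g
      by (simp add: block_char_def matrix_mult_entry3 first_col_def lmn)
    then have e: "(m * h$2$2 - l * h$1$1) * (n * h$3$3 - l * h$1$1) = (m * n) * ((h$2$2 - h$1$1) * (h$3$3 - h$1$1))"
      unfolding b .
    have l: "l \<noteq> 0" using nz(1)[OF g(1)] by (simp add: lmn)
    have "h$2$2 = h$1$1 \<or> h$3$3 = h$1$1"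
    proof (cases "m = l")
      case True
      have "(h$2$2 - h$1$1) * ((n - l) * (h$1$1 * l)) = 0"
        using e unfolding True by (simp add: algebra_simps)
      then show ?thesis using one_eq True nz(1)[OF h] l by auto
    next
      case False
      then have nl: "n = l" using one_eq by blast
      have "(h$3$3 - h$1$1) * ((m - l) * (h$1$1 * l)) = 0"
        using e unfolding nl by (simp add: algebra_simps)
      then show ?thesis using False nz(1)[OF h] l by auto
    qed
    then show ?thesis using b by auto
  qed
  show ?thesis
  proof (cases "\<forall>h\<in>\<Gamma>. h$3$2 = 0")
    case True
    then show ?thesis using fc by (intro triangularizable_if_upper) (auto simp: upper_def first_col_def)
  next
    case False
    then obtain h where h: "h \<in> \<Gamma>" "h$3$2 \<noteq> 0" by blast
    then have h23: "h$2$3 = 0" using split[OF h(1)] by simp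
    have zero: "k$2$3 = 0" if k: "k \<in> \<Gamma>" for k
    proof (rule ccontr)
      assume k23: "k$2$3 \<noteq> 0"
      then have k32: "k$3$2 = 0" using split[OF k] by simp
      have "h$3$3 \<noteq> 0" "k$3$3 \<noteq> 0" using nz(2)[OF h(1)] nz(2)[OF k] h23 k32 by auto
      moreover have "(k ** h)$2$3 = k$2$3 * h$3$3" "(k ** h)$3$2 = k$3$3 * h$3$2"
        using fc[OF k] fc[OF h(1)] h23 k32 by (simp_all add: matrix_mult_entry3 first_col_def)
      ultimately show False using split[OF mult[OF k h(1)]] k23 h(2) by simp
    qed
    \<comment> \<open>All blocks are lower triangular, so the last basis vector is a common
      eigenvector of the blocks.\<close>
    have yz: "0 \<noteq> (0::complex) \<or> 1 \<noteq> (0::complex)" by simp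
    obtain P Q where PQ: "mutual_inverse P Q"
      and up: "\<And>A t. first_col A \<Longrightarrow> A$2$2 * 0 + A$2$3 * 1 = t * 0 \<Longrightarrow> A$3$2 * 0 + A$3$3 * 1 = t * 1 \<Longrightarrow>
         upper (P ** A ** Q)"
      by (rule block_conjugation[OF yz]) blast
    have "upper (P ** k ** Q)" if "k \<in> \<Gamma>" for k
      by (rule up[OF fc[OF that], of "k$3$3"]) (simp_all add: zero[OF that])
    then show ?thesis unfolding triangularizable_def using PQ by blast
  qed
qed

text \<open>If \<open>block_char\<close> vanishes throughout, the block of some non-upper element is
  triangularized; it is then either a Jordan block or can be made diagonal with distinct
  entries.\<close>

lemma triangularizable_if_first_col:
  assumes fc: "\<And>h. h \<in> \<Gamma> \<Longrightarrow> first_col h"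
  shows "triangularizable \<Gamma>"
proof (cases "\<exists>g\<in>\<Gamma>. block_char g \<noteq> 0")
  case True
  then show ?thesis using triangularizable_if_block_char[OF fc] by blast
next
  case False
  then have bc: "block_char h = 0" if "h \<in> \<Gamma>" for h using that by blast
  show ?thesis
  proof (cases "\<forall>h\<in>\<Gamma>. h$3$2 = 0")
    case True
    then show ?thesis using fc by (intro triangularizable_if_upper) (auto simp: upper_def first_col_def)
  next
    case False
    then obtain g where g: "g \<in> \<Gamma>" "g$3$2 \<noteq> 0" by blast
    obtain y z t where yz: "y \<noteq> 0 \<or> z \<noteq> 0"
      "g$2$2 * y + g$2$3 * z = t * y" "g$3$2 * y + g$3$3 * z = t * z"
      using block_eigenvector[of "g$2$2" "g$2$3" "g$3$2" "g$3$3"] by (elim exE conjE)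
    obtain P Q where PQ: "mutual_inverse P Q"
      and fcPQ: "\<And>A. first_col A \<Longrightarrow> first_col (P ** A ** Q) \<and> (P ** A ** Q)$1$1 = A$1$1"
      and up: "\<And>A t. first_col A \<Longrightarrow> A$2$2 * y + A$2$3 * z = t * y \<Longrightarrow> A$3$2 * y + A$3$3 * z = t * z \<Longrightarrow>
         upper (P ** A ** Q)"
      and scalar: "\<And>A. first_col A \<Longrightarrow> A$2$3 = 0 \<Longrightarrow> A$3$2 = 0 \<Longrightarrow> A$2$2 = A$3$3 \<Longrightarrow> (Q ** A ** P)$3$2 = 0"
      by (rule block_conjugation[OF yz(1)]) blast
    define B where "B = P ** g ** Q"
    have uB: "upper B" unfolding B_def by (rule up[OF fc[OF g(1)] yz(2,3)])
    have fcB: "first_col B" using uB by (simp add: upper_def first_col_def)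
    let ?C = "(\<lambda>A. P ** A ** Q) ` \<Gamma>"
    interpret C: parabolic_monoid ?C by (rule conj[OF PQ])
    have B: "B \<in> ?C" using g(1) by (simp add: B_def)
    have fcC: "first_col h" if "h \<in> ?C" for h using that fcPQ fc by blast
    have bcC: "block_char h = 0" if h: "h \<in> ?C" for h
    proof -
      obtain A where A: "A \<in> \<Gamma>" "h = P ** A ** Q" using h by blast
      have "block_char h = block_char A"
        unfolding A(2) using fcPQ[OF fc[OF A(1)]] by (intro block_char_conj[OF PQ fc[OF A(1)]]) auto
      then show ?thesis using bc[OF A(1)] by simp
    qed
    have "triangularizable ?C"
    proof (cases "B$2$2 = B$3$3")
      case True
      \<comment> \<open>A scalar block would remain scalar after conjugating back, against the
        choice of \<open>g\<close>.\<close>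
      have "B$2$3 \<noteq> 0"
      proof
        assume "B$2$3 = 0"
        then have "(Q ** B ** P)$3$2 = 0" using uB True by (intro scalar[OF fcB]) (auto simp: upper_def)
        then show False using g(2) by (simp add: B_def conj_back[OF PQ])
      qed
      then show ?thesis using C.upper_if_block_nilpotent[OF fcC B uB True]
        by (intro C.triangularizable_if_upper) blast
    next
      case False
      \<comment> \<open>The shear by \<open>x\<close> removes the off-diagonal entry of the block of
        \<open>B\<close>.\<close>
      define x where "x = B$2$3 / (B$3$3 - B$2$2)"
      have "x * (B$3$3 - B$2$2) = B$2$3" using False by (simp add: x_def)
      then have x: "x * B$3$3 - x * B$2$2 = B$2$3" by (simp add: right_diff_distrib)
      define R S :: cmat3 where
        "R = vector [vector [1, 0, 0], vector [0, 1, - x], vector [0, 0, 1]]" and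
        "S = vector [vector [1, 0, 0], vector [0, 1, x], vector [0, 0, 1]]"
      have RS: "mutual_inverse R S"
        by (simp add: mutual_inverse_def vec_eq_iff forall_3 matrix_mult_entry3 R_def S_def mat_entry)
      have fcRS: "first_col (R ** A ** S) \<and> (R ** A ** S)$1$1 = A$1$1" if "first_col A" for A
        using that by (simp add: first_col_def matrix_mult_entry3 R_def S_def)
      let ?D = "(\<lambda>A. R ** A ** S) ` ?C"
      interpret D: parabolic_monoid ?D by (rule C.conj[OF RS])
      have "triangularizable ?D"
      proof (rule D.triangularizable_if_diagonal_block)
        show "first_col h" if "h \<in> ?D" for h using that fcRS fcC by blast
        show "block_char h = 0" if h: "h \<in> ?D" for h
        proof -
          obtain A where A: "A \<in> ?C" "h = R ** A ** S" using h by blast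
          have "block_char h = block_char A"
            unfolding A(2) using fcRS[OF fcC[OF A(1)]] by (intro block_char_conj[OF RS fcC[OF A(1)]]) auto
          then show ?thesis using bcC[OF A(1)] by simp
        qed
        show "R ** B ** S \<in> ?D" using B by (rule imageI)
        show "(R ** B ** S)$2$3 = 0" "(R ** B ** S)$3$2 = 0" "(R ** B ** S)$2$2 \<noteq> (R ** B ** S)$3$3"
          using uB False x by (simp_all add: matrix_mult_entry3 R_def S_def upper_def algebra_simps)
      qed
      then show ?thesis by (rule triangularizable_conj[OF RS])
    qed
    then show ?thesis by (rule triangularizable_conj[OF PQ])
  qed
qed

lemma triangularizable_if_common_eigenvector:
  assumes "v \<noteq> 0" "\<And>h. h \<in> \<Gamma> \<Longrightarrow> \<exists>c. h *v v = c *s v"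
  shows "triangularizable \<Gamma>"
proof -
  obtain P Q where PQ: "mutual_inverse P Q" "\<And>A c. A *v v = c *s v \<Longrightarrow> first_col (P ** A ** Q)"
    by (rule common_eigenvector_first_col[OF assms(1)]) blast
  interpret C: parabolic_monoid "(\<lambda>A. P ** A ** Q) ` \<Gamma>" by (rule conj[OF PQ(1)])
  have "first_col h" if "h \<in> (\<lambda>A. P ** A ** Q) ` \<Gamma>" for h using that PQ(2) assms(2) by blast
  then have "triangularizable ((\<lambda>A. P ** A ** Q) ` \<Gamma>)" by (rule C.triangularizable_if_first_col)
  then show ?thesis by (rule triangularizable_conj[OF PQ(1)])
qed

theorem triangularizable: "triangularizable \<Gamma>"
proof (cases "\<forall>g\<in>\<Gamma>. \<exists>c. g = mat c")
  case True
  then show ?thesis by (intro triangularizable_if_upper) (auto simp: upper_def mat_entry)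
next
  case False
  then obtain g where g: "g \<in> \<Gamma>" "\<And>c. g \<noteq> mat c" by blast
  obtain P Q where PQ: "mutual_inverse P Q" and ug: "upper (P ** g ** Q)" by (rule single_triangularizable)
  let ?C = "(\<lambda>A. P ** A ** Q) ` \<Gamma>"
  interpret C: parabolic_monoid ?C by (rule conj[OF PQ])
  have gC: "P ** g ** Q \<in> ?C" using g(1) by (rule imageI)
  have "P ** g ** Q \<noteq> mat c" for c
    using conj_back[OF PQ, of g] conj_mat[OF mutual_inverse_sym[OF PQ], of c] g(2) by metis
  then obtain v f :: "complex ^ 3" where vf: "v \<noteq> 0" "f \<noteq> 0"
    "\<And>h. h \<in> ?C \<Longrightarrow> trace ((\<chi> i j. v$i * f$j) ** h) = 0"
    by (rule C.upper_orthogonal_pair[OF gC ug]) blast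
  have "triangularizable ?C"
    using C.orthogonal_pair_reducible[OF vf]
  proof
    assume "\<exists>v. v \<noteq> 0 \<and> (\<forall>h\<in>?C. \<exists>c. h *v v = c *s v)"
    then obtain u where "u \<noteq> 0" "\<forall>h\<in>?C. \<exists>c. h *v u = c *s u" by (elim exE conjE)
    then show ?thesis by (intro C.triangularizable_if_common_eigenvector) auto
  next
    assume "\<exists>f. f \<noteq> 0 \<and> (\<forall>h\<in>?C. \<exists>c. transpose h *v f = c *s f)"
    then obtain u where u: "u \<noteq> 0" "\<forall>h\<in>?C. \<exists>c. transpose h *v u = c *s u" by (elim exE conjE)
    interpret T: parabolic_monoid "transpose ` ?C" by (rule C.transpose)
    have "\<exists>c. h *v u = c *s u" if h: "h \<in> transpose ` ?C" for h
    proof -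
      obtain k where "k \<in> ?C" "h = transpose k" using h by blast
      then show ?thesis using u(2) by (simp only:) 
    qed
    then have "triangularizable (transpose ` ?C)" by (rule T.triangularizable_if_common_eigenvector[OF u(1)])
    then show ?thesis by (rule triangularizable_transpose)
  qed
  then show ?thesis by (rule triangularizable_conj[OF PQ])
qed

end

section \<open>Lifting discrete subgroups\<close>

text \<open>The adjugate, which is the inverse for determinant 1; its polynomial entries make the
  size and shape of inverses computable.\<close>

definition cofactor3 :: "cmat3 \<Rightarrow> cmat3" where
  "cofactor3 A = vector
    [vector [A$2$2 * A$3$3 - A$2$3 * A$3$2, A$1$3 * A$3$2 - A$1$2 * A$3$3, A$1$2 * A$2$3 - A$1$3 * A$2$2],
     vector [A$2$3 * A$3$1 - A$2$1 * A$3$3, A$1$1 * A$3$3 - A$1$3 * A$3$1, A$1$3 * A$2$1 - A$1$1 * A$2$3],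
     vector [A$2$1 * A$3$2 - A$2$2 * A$3$1, A$1$2 * A$3$1 - A$1$1 * A$3$2, A$1$1 * A$2$2 - A$1$2 * A$2$1]]"

lemma cofactor3_inverse:
  assumes "det A = 1" shows "mutual_inverse A (cofactor3 A)"
proof -
  have "A$1$1 * A$2$2 * A$3$3 + A$1$2 * A$2$3 * A$3$1 + A$1$3 * A$2$1 * A$3$2
      - A$1$1 * A$2$3 * A$3$2 - A$1$2 * A$2$1 * A$3$3 - A$1$3 * A$2$2 * A$3$1 = 1"
    using assms by (simp add: det_3)
  then show ?thesis
    by (simp add: mutual_inverse_def vec_eq_iff forall_3 matrix_mult_entry3 mat_entry cofactor3_def algebra_simps)
qed

lemma mutual_inverse_unique: "mutual_inverse A B \<Longrightarrow> mutual_inverse A C \<Longrightarrow> B = C"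
  unfolding mutual_inverse_def by (metis matrix_mul_assoc matrix_mul_lid matrix_mul_rid)

lemma det_mat3: "det (mat c :: cmat3) = c ^ 3"
  by (simp add: det_3 mat_entry power3_eq_cube)

lemma carrier_SL3: "A \<in> carrier SL3 \<longleftrightarrow> det A = 1"
  and mult_SL3 [simp]: "A \<otimes>\<^bsub>SL3\<^esub> B = A ** B"
  and one_SL3 [simp]: "\<one>\<^bsub>SL3\<^esub> = mat 1"
  by (simp_all add: SL3_def)

lemma inv_SL3: "det A = 1 \<Longrightarrow> mutual_inverse A B \<Longrightarrow> inv\<^bsub>SL3\<^esub> A = B"
  using group.inv_equality[OF group_SL3, of B A] det_mul[of A B]
  by (auto simp: mutual_inverse_def carrier_SL3)

lemma SL3_scalars_eq: "SL3_scalars = {mat c | c. c ^ 3 = 1}"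
  by (auto simp: SL3_scalars_def carrier_SL3 det_mat3)

lemma proj_eq: "proj A = {mat c ** A | c. c ^ 3 = 1}"
  by (auto simp: proj_def r_coset_def SL3_scalars_eq)

lemma proj_self: "A \<in> proj A"
  unfolding proj_eq by (metis (mono_tags, lifting) matrix_mul_lid mem_Collect_eq power_one)

lemma proj_scale: assumes "c ^ 3 = 1" shows "proj (mat c ** A) = proj A"
proof -
  have "c \<noteq> 0" using assms by auto
  have mm: "mat a ** (mat b ** B) = mat (a * b) ** B" for a b and B :: cmat3
    by (simp add: vec_eq_iff mat_mult_left)
  show ?thesis
  proof
    show "proj (mat c ** A) \<subseteq> proj A"
    proof
      fix B assume "B \<in> proj (mat c ** A)"
      then obtain d where "d ^ 3 = 1" "B = mat (d * c) ** A" unfolding proj_eq mm by auto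
      then show "B \<in> proj A" unfolding proj_eq using assms by (auto simp: power_mult_distrib)
    qed
    show "proj A \<subseteq> proj (mat c ** A)"
    proof
      fix B assume "B \<in> proj A"
      then obtain d where d: "d ^ 3 = 1" "B = mat d ** A" unfolding proj_eq by auto
      then have "B = mat (d / c) ** (mat c ** A)" "(d / c) ^ 3 = 1"
        using assms \<open>c \<noteq> 0\<close> by (simp_all add: mm power_divide)
      then show "B \<in> proj (mat c ** A)" unfolding proj_eq by blast
    qed
  qed
qed

lemma proj_eq_iff: "proj A = proj B \<longleftrightarrow> (\<exists>c. c ^ 3 = 1 \<and> A = mat c ** B)"
proof
  assume "proj A = proj B"
  then have "A \<in> proj B" using proj_self[of A] by simp
  then show "\<exists>c. c ^ 3 = 1 \<and> A = mat c ** B" unfolding proj_eq by auto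
qed (auto simp: proj_scale)

lemma one_PSL3: "\<one>\<^bsub>PSL3\<^esub> = proj (mat 1)"
  unfolding PSL3_def FactGroup_def proj_def
  using group.coset_mult_one[OF group_SL3, of SL3_scalars] by (simp add: SL3_scalars_def)

lemma proj_hom: "proj \<in> hom SL3 PSL3"
  unfolding PSL3_def proj_def[abs_def] by (rule normal.r_coset_hom_Mod[OF normal_SL3_scalars])

lemma group_hom_proj: "group_hom SL3 PSL3 proj"
  by (simp add: group_hom_def group_hom_axioms_def group_SL3 group_PSL3 proj_hom)

lemma proj_mult: "det A = 1 \<Longrightarrow> det B = 1 \<Longrightarrow> proj A \<otimes>\<^bsub>PSL3\<^esub> proj B = proj (A ** B)"
  using hom_mult[OF proj_hom, of A B] by (simp add: carrier_SL3)

lemma proj_inv: "det A = 1 \<Longrightarrow> mutual_inverse A B \<Longrightarrow> inv\<^bsub>PSL3\<^esub> proj A = proj B"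
  using group_hom.hom_inv[OF group_hom_proj, of A] by (simp add: carrier_SL3 inv_SL3)

text \<open>Axioms for the full preimage of the group: it contains the scalars of SL, and
  discreteness appears as finiteness of its bounded parts.\<close>

locale parabolic_lift = parabolic_monoid +
  assumes det1: "\<And>A. A \<in> \<Gamma> \<Longrightarrow> det A = 1"
    and inv: "\<And>A. A \<in> \<Gamma> \<Longrightarrow> cofactor3 A \<in> \<Gamma>"
    and scal: "\<And>c. c ^ 3 = 1 \<Longrightarrow> mat c \<in> \<Gamma>"
    and fin: "\<And>r. finite {A \<in> \<Gamma>. \<forall>i j. cmod (A$i$j) \<le> r}"

lemma mult_entry_bound:
  assumes "\<And>i j. cmod ((A::cmat3)$i$j) \<le> a" "\<And>i j. cmod (B$i$j) \<le> b"
  shows "cmod ((A ** B)$i$j) \<le> 3 * a * b"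
proof -
  have a: "0 \<le> a" using assms(1)[of 1 1] norm_ge_zero order_trans by blast
  have "cmod (A$i$k * B$k$j) \<le> a * b" for k
    unfolding norm_mult using assms a by (intro mult_mono) auto
  then have "cmod ((A ** B)$i$j) \<le> a * b + a * b + a * b"
    unfolding matrix_mult_entry3 by (intro norm_triangle_le add_mono) 
  then show ?thesis by simp
qed

lemma entry_bound: "\<exists>r. \<forall>i j. cmod ((A::cmat3)$i$j) \<le> r"
  by (metis Finite_Cartesian_Product.norm_nth_le order_trans)

lemma (in parabolic_lift) lift_conj:
  assumes PQ: "mutual_inverse P Q"
  shows "parabolic_lift ((\<lambda>A. P ** A ** Q) ` \<Gamma>)"
proof -
  interpret C: parabolic_monoid "(\<lambda>A. P ** A ** Q) ` \<Gamma>" by (rule conj[OF PQ])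
  have dPQ: "det P * det Q = 1" using PQ by (metis det_I det_mul mutual_inverse_def)
  show ?thesis
  proof
    show d: "det A = 1" if "A \<in> (\<lambda>A. P ** A ** Q) ` \<Gamma>" for A
      using that det1 dPQ by (auto simp: det_mul)
    show "cofactor3 A \<in> (\<lambda>A. P ** A ** Q) ` \<Gamma>" if A: "A \<in> (\<lambda>A. P ** A ** Q) ` \<Gamma>" for A
    proof -
      obtain B where B: "B \<in> \<Gamma>" "A = P ** B ** Q" using A by blast
      have m: "mutual_inverse B (cofactor3 B)" using det1[OF B(1)] by (rule cofactor3_inverse)
      have "mutual_inverse A (P ** cofactor3 B ** Q)"
        using m PQ conj_mult[OF PQ] conj_mat[OF PQ, of 1] unfolding mutual_inverse_def B(2) by simp
      then have "cofactor3 A = P ** cofactor3 B ** Q"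
        using mutual_inverse_unique cofactor3_inverse[OF d[OF A]] by blast
      then show ?thesis using inv[OF B(1)] by simp
    qed
    show "mat c \<in> (\<lambda>A. P ** A ** Q) ` \<Gamma>" if "c ^ 3 = 1" for c
      using scal[OF that] conj_mat[OF PQ, of c] by (metis image_eqI)
    show "finite {A \<in> (\<lambda>A. P ** A ** Q) ` \<Gamma>. \<forall>i j. cmod (A$i$j) \<le> r}" for r
    proof -
      obtain p q where p: "\<And>i j. cmod (P$i$j) \<le> p" and q: "\<And>i j. cmod (Q$i$j) \<le> q"
        using entry_bound[of P] entry_bound[of Q] by blast
      \<comment> \<open>Undoing the conjugation multiplies a bound on entries by at most
        \<open>3 * q\<close> and then \<open>3 * p\<close>.\<close>
      let ?r = "3 * (3 * q * r) * p"
      show ?thesis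
      proof (rule finite_subset)
        show "finite ((\<lambda>A. P ** A ** Q) ` {A \<in> \<Gamma>. \<forall>i j. cmod (A$i$j) \<le> ?r})"
          by (intro finite_imageI fin)
        show "{A \<in> (\<lambda>A. P ** A ** Q) ` \<Gamma>. \<forall>i j. cmod (A$i$j) \<le> r} \<subseteq>
          (\<lambda>A. P ** A ** Q) ` {A \<in> \<Gamma>. \<forall>i j. cmod (A$i$j) \<le> ?r}"
        proof clarify
          fix B assume B: "B \<in> \<Gamma>" "\<forall>i j. cmod ((P ** B ** Q)$i$j) \<le> r"
          have "cmod ((Q ** (P ** B ** Q) ** P)$i$j) \<le> ?r" for i j
            using B(2) p q by (intro mult_entry_bound) auto
          then show "P ** B ** Q \<in> (\<lambda>A. P ** A ** Q) ` {A \<in> \<Gamma>. \<forall>i j. cmod (A$i$j) \<le> ?r}"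
            using B(1) unfolding conj_back[OF PQ] by blast
        qed
      qed
    qed
  qed
qed

section \<open>The preimage of a discrete group in SL\<close>

definition lift :: "cmat3 set set \<Rightarrow> cmat3 set" where
  "lift G = {A \<in> carrier SL3. proj A \<in> G}"

lemma proj_lift: "G \<subseteq> carrier PSL3 \<Longrightarrow> proj ` lift G = G"
  unfolding lift_def carrier_PSL3 by blast

text \<open>For a nontrivial cube root of unity, d = c - 1 satisfies
  \<open>d\<^sup>2 + 3 * d + 3 = 0\<close>, which is impossible for small \<open>d\<close>.\<close>

lemma cube_root_near_one:
  fixes c :: complex
  assumes "c ^ 3 = 1" "cmod (c - 1) < 1 / 2"
  shows "c = 1"
proof (rule ccontr)
  assume "c \<noteq> 1"
  define d where "d = c - 1"
  have c: "c = 1 + d" by (simp add: d_def)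
  have "d * (d\<^sup>2 + 3 * d + 3) = 0"
    using assms(1) unfolding c by (simp add: power2_eq_square power3_eq_cube algebra_simps)
  then have "3 = - (d\<^sup>2 + 3 * d)" using \<open>c \<noteq> 1\<close> by (simp add: d_def add_eq_0_iff)
  then have "3 = cmod (d\<^sup>2 + 3 * d)" by (metis norm_minus_cancel norm_numeral)
  also have "\<dots> \<le> cmod (d\<^sup>2) + cmod (3 * d)" by (rule norm_triangle_ineq)
  also have "\<dots> = cmod d * cmod d + 3 * cmod d" by (simp add: norm_mult power2_eq_square)
  also have "\<dots> < 3"
  proof -
    have d: "cmod d < 1/2" using assms(2) by (simp add: d_def)
    then have "cmod d * cmod d \<le> 1/2 * (1/2)" by (intro mult_mono) auto
    then show ?thesis using d by linarith
  qed
  finally show False by simp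
qed

lemma matrix_norm_le_entries:
  assumes "\<And>i j. cmod ((A::cmat3)$i$j) \<le> r" shows "norm A \<le> 9 * r"
proof -
  have row: "norm (v :: complex ^ 3) \<le> 3 * r" if "\<And>j. cmod (v$j) \<le> r" for v
  proof -
    have "norm v \<le> (\<Sum>j\<in>UNIV. norm (v$j))" unfolding norm_vec_def by (rule L2_set_le_sum) simp
    also have "\<dots> \<le> 3 * r" using that[of 1] that[of 2] that[of 3] by (simp add: sum_3)
    finally show ?thesis .
  qed
  have "norm A \<le> (\<Sum>i\<in>UNIV. norm (A$i))" unfolding norm_vec_def[of A] by (rule L2_set_le_sum) simp
  also have "\<dots> \<le> 9 * r" using row[of "A$1"] row[of "A$2"] row[of "A$3"] assms by (simp add: sum_3)
  finally show ?thesis .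
qed

lemma entry_le_norm: "cmod ((A::cmat3)$i$j) \<le> norm A"
  by (metis Finite_Cartesian_Product.norm_nth_le order_trans)

lemma cofactor3_entry_bound:
  assumes "\<And>i j. cmod (A$i$j) \<le> r" shows "cmod (cofactor3 A $ i $ j) \<le> 2 * r * r"
proof -
  have r: "0 \<le> r" using assms[of 1 1] norm_ge_zero order_trans by blast
  have "cmod (A$i$j * A$k$l - A$m$n * A$p$q) \<le> r * r + r * r" for i j k l m n p q
  proof -
    have "cmod (A$i$j * A$k$l) \<le> r * r" "cmod (A$m$n * A$p$q) \<le> r * r"
      unfolding norm_mult using assms r by (auto intro!: mult_mono)
    then show ?thesis by (intro norm_triangle_le_diff add_mono)
  qed
  then show ?thesis
    using exhaust_3[of i] exhaust_3[of j] by (auto simp: cofactor3_def algebra_simps)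
qed

text \<open>A neighbourhood isolating the identity of PSL pulls back to SL. Quotients of two close
  matrices with bounded entries land in it, so bounded parts are uniformly discrete and hence
  finite.\<close>

lemma discrete_lift_finite:
  assumes G: "subgroup G PSL3" and disc: "discrete_in_PSL3 G"
  shows "finite {A \<in> lift G. \<forall>i j. cmod (A$i$j) \<le> r}" (is "finite ?F")
proof -
  have oneG: "\<one>\<^bsub>PSL3\<^esub> \<in> G" by (rule subgroup.one_closed[OF G])
  have "openin (subtopology PSL3_topology G) {\<one>\<^bsub>PSL3\<^esub>}"
    using disc oneG by (simp add: discrete_in_PSL3_def)
  then obtain U where U: "openin PSL3_topology U" "{\<one>\<^bsub>PSL3\<^esub>} = U \<inter> G"
    by (auto simp: openin_subtopology)
  then obtain T where T: "open T" "{A \<in> carrier SL3. proj A \<in> U} = carrier SL3 \<inter> T"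
    unfolding openin_PSL3_topology openin_open by blast
  have "mat 1 \<in> carrier SL3 \<inter> T"
    using U(2) by (subst T(2)[symmetric]) (auto simp: carrier_SL3 one_PSL3)
  then obtain e where e: "e > 0" "\<And>A. dist A (mat 1) < e \<Longrightarrow> A \<in> T"
    using T(1) unfolding open_dist by blast
  \<comment> \<open>The bound 1/2 excludes the nontrivial scalars, which also project to the
    identity.\<close>
  define e' where "e' = min e (1/2)"
  have near: "A = mat 1" if A: "A \<in> lift G" "dist A (mat 1) < e'" for A
  proof -
    have "A \<in> carrier SL3 \<inter> T" using A e(2) by (auto simp: lift_def e'_def)
    then have "proj A \<in> U \<inter> G" using A(1) unfolding T(2)[symmetric] lift_def by simp
    then have "proj A = proj (mat 1)" unfolding U(2)[symmetric] one_PSL3 by simp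
    then obtain c where c: "c ^ 3 = 1" "A = mat c" unfolding proj_eq_iff by auto
    have "cmod (c - 1) \<le> norm (A - mat 1)"
      using entry_le_norm[of "A - mat 1" 1 1] by (simp add: c mat_entry)
    then have "cmod (c - 1) < 1/2" using A(2) by (simp add: dist_norm e'_def)
    then show ?thesis using cube_root_near_one c by blast
  qed
  show ?thesis
  proof (cases "0 < r")
    case False
    have "False" if A: "A \<in> ?F" for A
    proof -
      have "cmod (A$i$j) \<le> 0" for i j using A False order_trans[of "cmod (A$i$j)" r 0] by auto
      then have "det A = 0" by (simp add: det_3)
      then show False using A by (simp add: lift_def carrier_SL3)
    qed
    then have "?F = {}" by (rule equals0I)
    then show ?thesis by (simp only: finite.emptyI)
  next
    case r: True
    have "uniform_discrete ?F"
      unfolding uniform_discrete_def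
    \<comment> \<open>54 = 9 * 3 * 2: from entries to the norm, from factors to a product, and the
      two terms in each entry of the adjugate.\<close>
    proof (intro exI[of _ "e' / (54 * r * r)"] conjI ballI impI)
      show "0 < e' / (54 * r * r)" using e(1) r by (simp add: e'_def)
      fix A B assume A: "A \<in> ?F" and B: "B \<in> ?F" and d: "dist A B < e' / (54 * r * r)"
      have dets: "det A = 1" "det B = 1" and GA: "proj A \<in> G" and GB: "proj B \<in> G"
        using A B by (auto simp: lift_def carrier_SL3)
      let ?C = "cofactor3 B"
      have inv: "mutual_inverse B ?C" by (rule cofactor3_inverse[OF dets(2)])
      have dC: "det ?C = 1" using inv dets(2) by (metis det_I det_mul mult_1 mutual_inverse_def)
      have "proj (A ** ?C) = proj A \<otimes>\<^bsub>PSL3\<^esub> inv\<^bsub>PSL3\<^esub> proj B"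
        by (simp add: proj_mult proj_inv[OF dets(2) inv] dets dC)
      then have "A ** ?C \<in> lift G"
        using dets dC GA GB subgroup.m_closed[OF G] subgroup.m_inv_closed[OF G]
        by (simp add: lift_def carrier_SL3 det_mul)
      moreover have "dist (A ** ?C) (mat 1) < e'"
      proof -
        have "A ** ?C - mat 1 = (A - B) ** ?C"
          using inv by (simp add: mutual_inverse_def) 
            (simp add: vec_eq_iff matrix_mult_entry3 algebra_simps)
        moreover have "cmod (((A - B) ** ?C)$i$j) \<le> 3 * norm (A - B) * (2 * r * r)" for i j
          using B by (intro mult_entry_bound entry_le_norm cofactor3_entry_bound) auto
        ultimately have "norm (A ** ?C - mat 1) \<le> 9 * (3 * norm (A - B) * (2 * r * r))"
          by (metis matrix_norm_le_entries)
        also have "\<dots> < e'" using d r by (simp add: dist_norm field_simps)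
        finally show ?thesis by (simp add: dist_norm)
      qed
      ultimately have "A ** ?C = mat 1" by (rule near)
      then have "A ** ?C ** B = B" by simp
      then show "A = B" using inv unfolding mutual_inverse_def
        by (metis matrix_mul_assoc matrix_mul_rid)
    qed
    moreover have "bounded ?F"
      unfolding bounded_iff using matrix_norm_le_entries by (intro exI[of _ "9 * r"]) blast
    ultimately show ?thesis using uniform_discrete_finite_iff by blast
  qed
qed

lemma parabolic_lift_lift:
  assumes G: "subgroup G PSL3" and disc: "discrete_in_PSL3 G" and par: "purely_parabolic G"
  shows "parabolic_lift (lift G)"
proof
  have L: "A \<in> lift G \<longleftrightarrow> det A = 1 \<and> proj A \<in> G" for A by (simp add: lift_def carrier_SL3)
  show scal: "mat c \<in> lift G" if "c ^ 3 = 1" for c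
  proof -
    have "proj (mat c) = \<one>\<^bsub>PSL3\<^esub>" using proj_scale[OF that, of "mat 1"] by (simp add: one_PSL3)
    then show ?thesis using that subgroup.one_closed[OF G] by (simp add: L det_mat3)
  qed
  show "mat 1 \<in> lift G" by (rule scal) simp
  show "A ** B \<in> lift G" if "A \<in> lift G" "B \<in> lift G" for A B
    using that subgroup.m_closed[OF G] by (auto simp: L det_mul proj_mult[symmetric])
  show "det A = 1" if "A \<in> lift G" for A using that L by simp
  show "cofactor3 A \<in> lift G" if "A \<in> lift G" for A
  proof -
    have A: "det A = 1" "proj A \<in> G" using that L by auto
    have inv: "mutual_inverse A (cofactor3 A)" by (rule cofactor3_inverse[OF A(1)])
    have "det (cofactor3 A) = 1" using inv A(1) by (metis det_I det_mul mult_1 mutual_inverse_def)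
    moreover have "proj (cofactor3 A) \<in> G"
      using subgroup.m_inv_closed[OF G A(2)] by (simp add: proj_inv[OF A(1) inv])
    ultimately show ?thesis by (simp add: L)
  qed
  have cases: "parabolic (proj A) \<or> (\<exists>c. c ^ 3 = 1 \<and> A = mat c)" if "A \<in> lift G" for A
  proof (cases "proj A = \<one>\<^bsub>PSL3\<^esub>")
    case True
    then show ?thesis unfolding one_PSL3 proj_eq_iff by auto
  next
    case False
    then show ?thesis using par that by (auto simp: purely_parabolic_def L)
  qed
  show "cmod c = 1" if A: "A \<in> lift G" and ev: "eigenvalue_of A c" for A c
    using cases[OF A]
  proof
    assume "parabolic (proj A)"
    then show ?thesis using ev proj_self[of A] unfolding parabolic_def by blast
  next
    assume "\<exists>c. c ^ 3 = 1 \<and> A = mat c"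
    then obtain d where d: "d ^ 3 = 1" "A = mat d" by blast
    have "det (mat d - mat c :: cmat3) = (d - c) ^ 3" by (simp add: det_3 mat_entry power3_eq_cube)
    then have "c = d" using ev d by (simp add: eigenvalue_of_det)
    then have "cmod c ^ 3 = 1" using d(1) by (metis norm_one norm_power)
    then show ?thesis using power_eq_imp_eq_base[of "cmod c" 3 1] by simp
  qed
  show "\<exists>c. A = mat c" if A: "A \<in> lift G" and d: "diagonalizable A" for A
    using cases[OF A] d proj_self[of A] unfolding parabolic_def by blast
  show "finite {A \<in> lift G. \<forall>i j. cmod (A$i$j) \<le> r}" for r
    by (rule discrete_lift_finite[OF G disc])
qed

section \<open>Upper triangular lifts\<close>

text \<open>A group is not the union of two proper subgroups, and if it is the union of three, then squares
  lie in all of them; here the three subgroups are given by \<open>x = 1\<close>, \<open>y = 1\<close> and \<open>x * y = 1\<close>.\<close>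

lemma three_characters:
  fixes S :: "(complex \<times> complex) set"
  assumes mult: "\<And>x y x' y'. (x, y) \<in> S \<Longrightarrow> (x', y') \<in> S \<Longrightarrow> (x * x', y * y') \<in> S"
    and nz: "\<And>x y. (x, y) \<in> S \<Longrightarrow> x \<noteq> 0 \<and> y \<noteq> 0"
    and cover: "\<And>x y. (x, y) \<in> S \<Longrightarrow> x = 1 \<or> y = 1 \<or> x * y = 1"
  shows "(\<forall>(x, y)\<in>S. x = 1) \<or> (\<forall>(x, y)\<in>S. y = 1) \<or> (\<forall>(x, y)\<in>S. x * y = 1) \<or> S \<subseteq> {1, -1} \<times> {1, -1}"
proof (rule ccontr)
  assume not: "\<not> ?thesis"
  then have n: "\<not> (\<forall>(x, y)\<in>S. x = 1)" "\<not> (\<forall>(x, y)\<in>S. y = 1)" "\<not> (\<forall>(x, y)\<in>S. x * y = 1)"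
    by blast+
  obtain x1 y1 where s1: "(x1, y1) \<in> S" "x1 \<noteq> 1" using n(1) by auto
  obtain x2 y2 where s2: "(x2, y2) \<in> S" "y2 \<noteq> 1" using n(2) by auto
  obtain x3 y3 where s3: "(x3, y3) \<in> S" "x3 * y3 \<noteq> 1" using n(3) by auto
  \<comment> \<open>The product of nontrivial elements of the two axes lies on neither axis, so it
    lies in the third subgroup.\<close>
  have P: False if "(s, 1) \<in> S" "(1, t) \<in> S" "s \<noteq> 1" "t \<noteq> 1" "s * t \<noteq> 1" for s t
    using cover[OF mult[OF that(1,2)]] that by simp
  obtain t where t: "(1, t) \<in> S" "t \<noteq> 1"
  proof (cases "x2 = 1 \<or> x3 = 1")
    case True
    then show thesis using s2 s3 that[of y2] that[of y3] by auto
  next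
    case False
    then have e: "x2 * y2 = 1" "y3 = 1" using cover[OF s2(1)] cover[OF s3(1)] s2 s3 by auto
    have m: "(x2 * x3, y2) \<in> S" using mult[OF s2(1) s3(1)] e by simp
    have "x2 * x3 * y2 = x3" using e(1) by (simp add: mult.commute mult.left_commute)
    then have "x2 * x3 * y2 \<noteq> 1" using False by metis
    then have "x2 * x3 = 1" using cover[OF m] s2(2) by blast
    then show thesis using m s2(2) that by simp
  qed
  obtain s where s: "(s, 1) \<in> S" "s \<noteq> 1"
  proof (cases "y1 = 1 \<or> y3 = 1")
    case True
    then show thesis using s1 s3 that[of x1] that[of x3] by auto
  next
    case False
    then have e: "x1 * y1 = 1" "x3 = 1" using cover[OF s1(1)] cover[OF s3(1)] s1 s3 by auto
    have m: "(x1, y1 * y3) \<in> S" using mult[OF s1(1) s3(1)] e by simp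
    have "x1 * (y1 * y3) = y3" using e(1) by (simp flip: mult.assoc)
    then have "x1 * (y1 * y3) \<noteq> 1" using False by metis
    then have "y1 * y3 = 1" using cover[OF m] s1(2) by blast
    then show thesis using m s1(2) that by simp
  qed
  have inv_t: "x * t = 1" if "(x, 1) \<in> S" "x \<noteq> 1" for x using P[OF that(1) t(1) that(2) t(2)] by blast
  have inv_s: "s * y = 1" if "(1, y) \<in> S" "y \<noteq> 1" for y using P[OF s(1) that(1) s(2) that(2)] by blast
  have tn: "t = -1"
  proof -
    \<comment> \<open>Otherwise both \<open>t\<close> and \<open>t * t\<close> would be inverse to
      \<open>s\<close>.\<close>
    have "t * t = 1"
    proof (rule ccontr)
      assume a: "t * t \<noteq> 1"
      have "(1, t * t) \<in> S" using mult[OF t(1) t(1)] by simp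
      then have "s * (t * t) = 1" using a by (rule inv_s)
      then show False using inv_s[OF t] t(2) by (metis mult.assoc mult_1)
    qed
    then show ?thesis using t(2) by (metis square_eq_1_iff)
  qed
  have sn: "s = -1" using inv_s[OF t] tn by (simp add: minus_equation_iff)
  have "x \<in> {1, -1} \<and> y \<in> {1, -1}" if xy: "(x, y) \<in> S" for x y
  proof -
    consider "x = 1" | "y = 1" | "x \<noteq> 1" "y \<noteq> 1" "x * y = 1" using cover[OF xy] by blast
    then show ?thesis
    proof cases
      case 1
      then show ?thesis using inv_s[of y] xy sn by (auto simp: minus_equation_iff)
    next
      case 2
      then show ?thesis using inv_t[of x] xy tn by (auto simp: minus_equation_iff)
    next
      case 3
      have "(x, - y) \<in> S" using mult[OF xy t(1)] by (simp add: tn)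
      moreover have "x * - y \<noteq> 1" using 3(3) by simp
      ultimately have "- y = 1" using cover[of x "- y"] 3(1) by blast
      then have "y = -1" by (simp add: minus_equation_iff)
      then show ?thesis using 3(3) by (simp add: minus_equation_iff)
    qed
  qed
  then show False using not by fast
qed

text \<open>Unchanged by scalar factors and multiplicative on invertible upper triangular matrices,
  among which the value (1, 1) characterizes scalar multiples of unipotent ones.\<close>

definition ratios :: "cmat3 \<Rightarrow> complex \<times> complex" where
  "ratios A = (A$1$1 / A$2$2, A$2$2 / A$3$3)"

text \<open>A block with a repeated eigenvalue and a complementary invariant line: the shape of the
  elements of \<open>Ell\<close>.\<close>

definition ell_form :: "cmat3 \<Rightarrow> bool" where
  "ell_form A \<longleftrightarrow> upper A \<and> A$1$3 = 0 \<and> A$2$3 = 0 \<and> A$1$1 = A$2$2"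

locale upper_parabolic_lift = parabolic_lift +
  assumes up: "\<And>A. A \<in> \<Gamma> \<Longrightarrow> upper A"
begin

lemma low: "A \<in> \<Gamma> \<Longrightarrow> A$2$1 = 0" "A \<in> \<Gamma> \<Longrightarrow> A$3$1 = 0" "A \<in> \<Gamma> \<Longrightarrow> A$3$2 = 0"
  using up by (auto simp: upper_def)

lemma diag_unit: "A \<in> \<Gamma> \<Longrightarrow> cmod (A$i$i) = 1"
  using eig upper_diag_eigenvalue up by blast

lemma diag_nonzero: "A \<in> \<Gamma> \<Longrightarrow> A$i$i \<noteq> 0"
  using diag_unit[of A i] by auto

lemma diag_prod: "A \<in> \<Gamma> \<Longrightarrow> A$1$1 * A$2$2 * A$3$3 = 1"
  using det1[of A] low[of A] by (simp add: det_3)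

lemma diag_equal: "A \<in> \<Gamma> \<Longrightarrow> A$1$1 = A$2$2 \<or> A$2$2 = A$3$3 \<or> A$1$1 = A$3$3"
  using upper_nondiagonalizable_cases(1)[OF up] diag by (metis mat_entry)

lemma nonscalar_entry:
  assumes "A \<in> \<Gamma>"
  shows "A$1$1 = A$2$2 \<Longrightarrow> A$2$2 \<noteq> A$3$3 \<Longrightarrow> A$1$2 \<noteq> 0"
    and "A$2$2 = A$3$3 \<Longrightarrow> A$1$1 \<noteq> A$2$2 \<Longrightarrow> A$2$3 \<noteq> 0"
proof -
  have nd: "\<not> diagonalizable A" if "A$i$i \<noteq> A$j$j" for i j
    using diag[OF assms] that by (auto simp: mat_entry)
  show "A$1$2 \<noteq> 0" if "A$1$1 = A$2$2" "A$2$2 \<noteq> A$3$3"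
    by (rule upper_nondiagonalizable_cases(2)[OF up[OF assms] nd[OF that(2)] that])
  show "A$2$3 \<noteq> 0" if "A$2$2 = A$3$3" "A$1$1 \<noteq> A$2$2"
    by (rule upper_nondiagonalizable_cases(3)[OF up[OF assms] nd[OF that(2)] that])
qed

lemma finite_bounded_image:
  assumes "\<And>A. A \<in> \<Gamma> \<Longrightarrow> P A \<Longrightarrow> cmod (A$1$2) \<le> r \<and> cmod (A$1$3) \<le> r \<and> cmod (A$2$3) \<le> r"
  shows "finite (f ` {A \<in> \<Gamma>. P A})"
proof (rule finite_imageI, rule finite_subset[OF _ fin[of "max r 1"]], safe)
  fix A i j assume A: "A \<in> \<Gamma>" "P A"
  have "i = j \<or> A$i$j = 0 \<or> cmod (A$i$j) \<le> r"
    using low[OF A(1)] assms[OF A] exhaust_3[of i] exhaust_3[of j] by auto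
  then show "cmod (A$i$j) \<le> max r 1"
    using diag_unit[OF A(1), of j] by auto
qed

end

context upper_parabolic_lift
begin

lemma finite_ratios_if:
  assumes "finite (fst ` f ` \<Gamma>)" "\<And>A. A \<in> \<Gamma> \<Longrightarrow> ratios A = h (fst (f A))"
  shows "finite (ratios ` \<Gamma>)"
proof (rule finite_subset)
  show "finite (h ` fst ` f ` \<Gamma>)" by (rule finite_imageI[OF assms(1)])
  show "ratios ` \<Gamma> \<subseteq> h ` fst ` f ` \<Gamma>" using assms(2) by auto
qed

text \<open>Scaling by the first diagonal entry gives a \<open>block_group\<close>. In its split
  case (-p, -q, 1) is a common eigenvector, and taking it to the third basis vector clears the last
  column.\<close>

lemma split_first_equal:
  assumes eq: "\<And>A. A \<in> \<Gamma> \<Longrightarrow> A$1$1 = A$2$2"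
  shows "finite (ratios ` \<Gamma>) \<or> (\<exists>P Q. mutual_inverse P Q \<and> (\<forall>A\<in>\<Gamma>. ell_form (P ** A ** Q)))"
proof -
  define f where "f A = (A$3$3 / A$1$1, A$1$2 / A$1$1, A$1$3 / A$1$1, A$2$3 / A$1$1)" for A :: cmat3
  interpret S: block_group "f ` \<Gamma>"
  proof
    show "(1, 0, 0, 0) \<in> f ` \<Gamma>" by (rule image_eqI[OF _ one]) (simp add: f_def mat_entry)
  next
    fix n a b c n' a' b' c' assume "(n, a, b, c) \<in> f ` \<Gamma>" "(n', a', b', c') \<in> f ` \<Gamma>"
    then obtain A B where A: "A \<in> \<Gamma>" "(n, a, b, c) = f A" and B: "B \<in> \<Gamma>" "(n', a', b', c') = f B" by auto
    have e: "n = A$3$3 / A$1$1" "a = A$1$2 / A$1$1" "b = A$1$3 / A$1$1" "c = A$2$3 / A$1$1"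
      "n' = B$3$3 / B$1$1" "a' = B$1$2 / B$1$1" "b' = B$1$3 / B$1$1" "c' = B$2$3 / B$1$1"
      using A(2) B(2) by (simp_all add: f_def)
    show "(n * n', a + a', b' + a * c' + b * n', c' + c * n') \<in> f ` \<Gamma>"
    proof (rule image_eqI[OF _ mult[OF A(1) B(1)]])
      show "(n * n', a + a', b' + a * c' + b * n', c' + c * n') = f (A ** B)"
        using low[OF A(1)] low[OF B(1)] diag_nonzero[OF A(1), of 1] diag_nonzero[OF B(1), of 1] eq[OF A(1)] eq[OF B(1)] unfolding e
        by (simp add: f_def matrix_mult_entry3) (simp add: field_simps)
    qed
  next
    fix n a b c assume "(n, a, b, c) \<in> f ` \<Gamma>"
    then obtain A where A: "A \<in> \<Gamma>" "(n, a, b, c) = f A" by auto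
    have e: "n = A$3$3 / A$1$1" "a = A$1$2 / A$1$1" "b = A$1$3 / A$1$1" "c = A$2$3 / A$1$1"
      using A(2) by (simp_all add: f_def)
    show "(1 / n, - a, (a * c - b) / n, - c / n) \<in> f ` \<Gamma>"
    proof (rule image_eqI[OF _ inv[OF A(1)]])
      show "(1 / n, - a, (a * c - b) / n, - c / n) = f (cofactor3 A)"
        using low[OF A(1)] diag_nonzero[OF A(1), of 1] diag_nonzero[OF A(1), of 3] eq[OF A(1)] unfolding e
        by (simp add: f_def cofactor3_def) (simp add: field_simps)
    qed
    show "cmod n = 1" using A diag_unit by (simp add: f_def norm_divide)
    show "a \<noteq> 0" if "n \<noteq> 1"
      using nonscalar_entry(1)[OF A(1)] A that diag_nonzero[OF A(1), of 1] eq[OF A(1)] by (auto simp: f_def)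
  next
    fix r
    have "finite (f ` {A \<in> \<Gamma>. cmod (A$1$2) \<le> r \<and> cmod (A$1$3) \<le> r \<and> cmod (A$2$3) \<le> r})"
      by (rule finite_bounded_image) blast
    then show "finite {(n, a, b, c) \<in> f ` \<Gamma>. cmod a \<le> r \<and> cmod b \<le> r \<and> cmod c \<le> r}"
      by (rule finite_subset[rotated]) (auto simp: f_def norm_divide diag_unit intro!: image_eqI)
  qed
  show ?thesis using S.finite_or_split
  proof
    assume "finite (fst ` f ` \<Gamma>)"
    then have "finite (ratios ` \<Gamma>)"
    proof (rule finite_ratios_if)
      fix A assume "A \<in> \<Gamma>"
      then show "ratios A = (\<lambda>n. (1, 1 / n)) (fst (f A))"
        using eq diag_nonzero[of A 2] by (simp add: ratios_def f_def)
    qed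
    then show ?thesis ..
  next
    assume "\<exists>p q. \<forall>(n, a, b, c)\<in>f ` \<Gamma>. c = (1 - n) * q \<and> b = (1 - n) * p + a * q"
    then obtain p q where pq: "\<forall>(n, a, b, c)\<in>f ` \<Gamma>. c = (1 - n) * q \<and> b = (1 - n) * p + a * q" by (elim exE)
    define P Q :: cmat3 where
      "P = vector [vector [1, 0, p], vector [0, 1, q], vector [0, 0, 1]]" and
      "Q = vector [vector [1, 0, - p], vector [0, 1, - q], vector [0, 0, 1]]"
    have "mutual_inverse P Q"
      by (simp add: mutual_inverse_def vec_eq_iff forall_3 matrix_mult_entry3 P_def Q_def mat_entry)
    moreover have "ell_form (P ** A ** Q)" if A: "A \<in> \<Gamma>" for A
    proof -
      have "f A \<in> f ` \<Gamma>" using A by (rule imageI)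
      from bspec[OF pq this] have "A$2$3 / A$1$1 = (1 - A$3$3 / A$1$1) * q"
        "A$1$3 / A$1$1 = (1 - A$3$3 / A$1$1) * p + A$1$2 / A$1$1 * q"
        by (simp_all add: f_def)
      then have "A$2$3 = (A$1$1 - A$3$3) * q" "A$1$3 = (A$1$1 - A$3$3) * p + A$1$2 * q"
        using diag_nonzero[OF A, of 1] by (simp_all add: field_simps)
      then show ?thesis using low[OF A] eq[OF A]
        by (simp add: ell_form_def upper_def matrix_mult_entry3 P_def Q_def algebra_simps)
    qed
    ultimately show ?thesis by blast
  qed
qed

text \<open>Mirror image of \<open>split_first_equal\<close> in the antidiagonal, hence the reversed
  products; the conjugation also moves the simple eigenvalue from the first to the last
  place.\<close>

lemma split_last_equal:
  assumes eq: "\<And>A. A \<in> \<Gamma> \<Longrightarrow> A$2$2 = A$3$3"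
  shows "finite (ratios ` \<Gamma>) \<or> (\<exists>P Q. mutual_inverse P Q \<and> (\<forall>A\<in>\<Gamma>. ell_form (P ** A ** Q)))"
proof -
  define f where "f A = (A$1$1 / A$2$2, A$2$3 / A$2$2, A$1$3 / A$2$2, A$1$2 / A$2$2)" for A :: cmat3
  interpret S: block_group "f ` \<Gamma>"
  proof
    show "(1, 0, 0, 0) \<in> f ` \<Gamma>" by (rule image_eqI[OF _ one]) (simp add: f_def mat_entry)
  next
    fix n a b c n' a' b' c' assume "(n, a, b, c) \<in> f ` \<Gamma>" "(n', a', b', c') \<in> f ` \<Gamma>"
    then obtain A B where A: "A \<in> \<Gamma>" "(n, a, b, c) = f A" and B: "B \<in> \<Gamma>" "(n', a', b', c') = f B" by auto
    have e: "n = A$1$1 / A$2$2" "a = A$2$3 / A$2$2" "b = A$1$3 / A$2$2" "c = A$1$2 / A$2$2"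
      "n' = B$1$1 / B$2$2" "a' = B$2$3 / B$2$2" "b' = B$1$3 / B$2$2" "c' = B$1$2 / B$2$2"
      using A(2) B(2) by (simp_all add: f_def)
    show "(n * n', a + a', b' + a * c' + b * n', c' + c * n') \<in> f ` \<Gamma>"
    proof (rule image_eqI[OF _ mult[OF B(1) A(1)]])
      show "(n * n', a + a', b' + a * c' + b * n', c' + c * n') = f (B ** A)"
        using low[OF A(1)] low[OF B(1)] diag_nonzero[OF A(1), of 2] diag_nonzero[OF B(1), of 2] eq[OF A(1)] eq[OF B(1)] unfolding e
        by (simp add: f_def matrix_mult_entry3) (simp add: field_simps)
    qed
  next
    fix n a b c assume "(n, a, b, c) \<in> f ` \<Gamma>"
    then obtain A where A: "A \<in> \<Gamma>" "(n, a, b, c) = f A" by auto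
    have e: "n = A$1$1 / A$2$2" "a = A$2$3 / A$2$2" "b = A$1$3 / A$2$2" "c = A$1$2 / A$2$2"
      using A(2) by (simp_all add: f_def)
    show "(1 / n, - a, (a * c - b) / n, - c / n) \<in> f ` \<Gamma>"
    proof (rule image_eqI[OF _ inv[OF A(1)]])
      show "(1 / n, - a, (a * c - b) / n, - c / n) = f (cofactor3 A)"
        using low[OF A(1)] diag_nonzero[OF A(1), of 1] diag_nonzero[OF A(1), of 3] eq[OF A(1)] unfolding e
        by (simp add: f_def cofactor3_def) (simp add: field_simps)
    qed
    show "cmod n = 1" using A diag_unit by (simp add: f_def norm_divide)
    show "a \<noteq> 0" if "n \<noteq> 1"
      using nonscalar_entry(2)[OF A(1)] A that diag_nonzero[OF A(1), of 2] eq[OF A(1)] by (auto simp: f_def)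
  next
    fix r
    have "finite (f ` {A \<in> \<Gamma>. cmod (A$1$2) \<le> r \<and> cmod (A$1$3) \<le> r \<and> cmod (A$2$3) \<le> r})"
      by (rule finite_bounded_image) blast
    then show "finite {(n, a, b, c) \<in> f ` \<Gamma>. cmod a \<le> r \<and> cmod b \<le> r \<and> cmod c \<le> r}"
      by (rule finite_subset[rotated]) (auto simp: f_def norm_divide diag_unit intro!: image_eqI)
  qed
  show ?thesis using S.finite_or_split
  proof
    assume "finite (fst ` f ` \<Gamma>)"
    then have "finite (ratios ` \<Gamma>)"
    proof (rule finite_ratios_if)
      fix A assume "A \<in> \<Gamma>"
      then show "ratios A = (\<lambda>n. (n, 1)) (fst (f A))"
        using eq diag_nonzero[of A 3] by (simp add: ratios_def f_def)
    qed
    then show ?thesis ..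
  next
    assume "\<exists>p q. \<forall>(n, a, b, c)\<in>f ` \<Gamma>. c = (1 - n) * q \<and> b = (1 - n) * p + a * q"
    then obtain p q where pq: "\<forall>(n, a, b, c)\<in>f ` \<Gamma>. c = (1 - n) * q \<and> b = (1 - n) * p + a * q" by (elim exE)
    define P Q :: cmat3 where
      "P = vector [vector [0, 1, 0], vector [0, 0, 1], vector [1, - q, - p]]" and
      "Q = vector [vector [q, p, 1], vector [1, 0, 0], vector [0, 1, 0]]"
    have "mutual_inverse P Q"
      by (simp add: mutual_inverse_def vec_eq_iff forall_3 matrix_mult_entry3 P_def Q_def mat_entry)
    moreover have "ell_form (P ** A ** Q)" if A: "A \<in> \<Gamma>" for A
    proof -
      have "f A \<in> f ` \<Gamma>" using A by (rule imageI)
      from bspec[OF pq this] have "A$1$2 / A$2$2 = (1 - A$1$1 / A$2$2) * q"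
        "A$1$3 / A$2$2 = (1 - A$1$1 / A$2$2) * p + A$2$3 / A$2$2 * q"
        by (simp_all add: f_def)
      then have "A$1$2 = (A$2$2 - A$1$1) * q" "A$1$3 = (A$2$2 - A$1$1) * p + A$2$3 * q"
        using diag_nonzero[OF A, of 2] by (simp_all add: field_simps)
      then show ?thesis using low[OF A] eq[OF A]
        by (simp add: ell_form_def upper_def matrix_mult_entry3 P_def Q_def algebra_simps)
    qed
    ultimately show ?thesis by blast
  qed
qed

text \<open>The simple eigenvalue sits in the middle, so the final conjugation also exchanges the
  last two basis vectors.\<close>

lemma split_outer_equal:
  assumes eq: "\<And>A. A \<in> \<Gamma> \<Longrightarrow> A$1$1 = A$3$3"
  shows "finite (ratios ` \<Gamma>) \<or> (\<exists>P Q. mutual_inverse P Q \<and> (\<forall>A\<in>\<Gamma>. ell_form (P ** A ** Q)))"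
proof -
  define f where "f A = (A$2$2 / A$1$1, A$1$2 / A$1$1, A$1$3 / A$1$1, A$2$3 / A$1$1)" for A :: cmat3
  interpret S: middle_block_group "f ` \<Gamma>"
  proof
    show "(1, 0, 0, 0) \<in> f ` \<Gamma>" by (rule image_eqI[OF _ one]) (simp add: f_def mat_entry)
  next
    fix n a b c n' a' b' c' assume "(n, a, b, c) \<in> f ` \<Gamma>" "(n', a', b', c') \<in> f ` \<Gamma>"
    then obtain A B where A: "A \<in> \<Gamma>" "(n, a, b, c) = f A" and B: "B \<in> \<Gamma>" "(n', a', b', c') = f B" by auto
    have e: "n = A$2$2 / A$1$1" "a = A$1$2 / A$1$1" "b = A$1$3 / A$1$1" "c = A$2$3 / A$1$1"
      "n' = B$2$2 / B$1$1" "a' = B$1$2 / B$1$1" "b' = B$1$3 / B$1$1" "c' = B$2$3 / B$1$1"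
      using A(2) B(2) by (simp_all add: f_def)
    show "(n * n', a' + a * n', b' + a * c' + b, n * c' + c) \<in> f ` \<Gamma>"
    proof (rule image_eqI[OF _ mult[OF A(1) B(1)]])
      show "(n * n', a' + a * n', b' + a * c' + b, n * c' + c) = f (A ** B)"
        using low[OF A(1)] low[OF B(1)] diag_nonzero[OF A(1), of 1] diag_nonzero[OF B(1), of 1] eq[OF A(1)] eq[OF B(1)] unfolding e
        by (simp add: f_def matrix_mult_entry3) (simp add: field_simps)
    qed
  next
    fix n a b c assume "(n, a, b, c) \<in> f ` \<Gamma>"
    then obtain A where A: "A \<in> \<Gamma>" "(n, a, b, c) = f A" by auto
    have e: "n = A$2$2 / A$1$1" "a = A$1$2 / A$1$1" "b = A$1$3 / A$1$1" "c = A$2$3 / A$1$1"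
      using A(2) by (simp_all add: f_def)
    show "(1 / n, - a / n, a * c / n - b, - c / n) \<in> f ` \<Gamma>"
    proof (rule image_eqI[OF _ inv[OF A(1)]])
      show "(1 / n, - a / n, a * c / n - b, - c / n) = f (cofactor3 A)"
        using low[OF A(1)] diag_nonzero[OF A(1), of 1] diag_nonzero[OF A(1), of 2]
          diag_nonzero[OF A(1), of 3] eq[OF A(1)] unfolding e
        by (simp add: f_def cofactor3_def) (simp add: field_simps)
    qed
    show "cmod n = 1" using A diag_unit by (simp add: f_def norm_divide)
  next
    fix r
    have "finite (f ` {A \<in> \<Gamma>. cmod (A$1$2) \<le> r \<and> cmod (A$1$3) \<le> r \<and> cmod (A$2$3) \<le> r})"
      by (rule finite_bounded_image) blast
    then show "finite {(n, a, b, c) \<in> f ` \<Gamma>. cmod a \<le> r \<and> cmod b \<le> r \<and> cmod c \<le> r}"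
      by (rule finite_subset[rotated]) (auto simp: f_def norm_divide diag_unit intro!: image_eqI)
  qed
  show ?thesis using S.finite_or_split
  proof
    assume "finite (fst ` f ` \<Gamma>)"
    then have "finite (ratios ` \<Gamma>)"
    proof (rule finite_ratios_if)
      fix A assume "A \<in> \<Gamma>"
      then show "ratios A = (\<lambda>n. (1 / n, n)) (fst (f A))"
        using eq by (simp add: ratios_def f_def)
    qed
    then show ?thesis ..
  next
    assume "\<exists>p q. \<forall>(n, a, b, c)\<in>f ` \<Gamma>. a = (n - 1) * p \<and> c = (1 - n) * q"
    then obtain p q where pq: "\<forall>(n, a, b, c)\<in>f ` \<Gamma>. a = (n - 1) * p \<and> c = (1 - n) * q" by (elim exE)
    define P Q :: cmat3 where
      "P = vector [vector [1, - p, p * q], vector [0, 0, 1], vector [0, 1, - q]]" and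
      "Q = vector [vector [1, 0, p], vector [0, q, 1], vector [0, 1, 0]]"
    have "mutual_inverse P Q"
      by (simp add: mutual_inverse_def vec_eq_iff forall_3 matrix_mult_entry3 P_def Q_def mat_entry)
    moreover have "ell_form (P ** A ** Q)" if A: "A \<in> \<Gamma>" for A
    proof -
      have "f A \<in> f ` \<Gamma>" using A by (rule imageI)
      from bspec[OF pq this] have "A$1$2 / A$1$1 = (A$2$2 / A$1$1 - 1) * p"
        "A$2$3 / A$1$1 = (1 - A$2$2 / A$1$1) * q"
        by (simp_all add: f_def)
      then have "A$1$2 = (A$2$2 - A$1$1) * p" "A$2$3 = (A$1$1 - A$2$2) * q"
        using diag_nonzero[OF A, of 1] by (simp_all add: field_simps)
      then show ?thesis using low[OF A] eq[OF A]
        by (simp add: ell_form_def upper_def matrix_mult_entry3 P_def Q_def algebra_simps)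
    qed
    ultimately show ?thesis by blast
  qed
qed

text \<open>The conditions \<open>x = 1\<close>, \<open>y = 1\<close> and \<open>x * y = 1\<close>
  on ratios say which two diagonal entries agree; the exceptional case leaves at most four
  ratios.\<close>

theorem finite_ratios_or_ell_form:
  "finite (ratios ` \<Gamma>) \<or> (\<exists>P Q. mutual_inverse P Q \<and> (\<forall>A\<in>\<Gamma>. ell_form (P ** A ** Q)))"
proof -
  have "(\<forall>(x, y)\<in>ratios ` \<Gamma>. x = 1) \<or> (\<forall>(x, y)\<in>ratios ` \<Gamma>. y = 1) \<or> (\<forall>(x, y)\<in>ratios ` \<Gamma>. x * y = 1) \<or>
      ratios ` \<Gamma> \<subseteq> {1, -1} \<times> {1, -1}"
  proof (rule three_characters)
    fix x y x' y' assume "(x, y) \<in> ratios ` \<Gamma>" "(x', y') \<in> ratios ` \<Gamma>"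
    then obtain A B where A: "A \<in> \<Gamma>" "(x, y) = ratios A" and B: "B \<in> \<Gamma>" "(x', y') = ratios B" by auto
    show "(x * x', y * y') \<in> ratios ` \<Gamma>"
      by (rule image_eqI[OF _ mult[OF A(1) B(1)]])
         (use A(2) B(2) low[OF A(1)] low[OF B(1)] in \<open>simp add: ratios_def matrix_mult_entry3\<close>)
  next
    fix x y assume "(x, y) \<in> ratios ` \<Gamma>"
    then obtain A where A: "A \<in> \<Gamma>" "x = A$1$1 / A$2$2" "y = A$2$2 / A$3$3" by (auto simp: ratios_def)
    then show "x \<noteq> 0 \<and> y \<noteq> 0" using diag_nonzero by simp
    show "x = 1 \<or> y = 1 \<or> x * y = 1" using diag_equal[OF A(1)] A diag_nonzero by auto
  qed
  then consider "\<forall>(x, y)\<in>ratios ` \<Gamma>. x = 1" | "\<forall>(x, y)\<in>ratios ` \<Gamma>. y = 1"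
    | "\<forall>(x, y)\<in>ratios ` \<Gamma>. x * y = 1" | "ratios ` \<Gamma> \<subseteq> {1, -1} \<times> {1, -1}" by argo
  then show ?thesis
  proof cases
    case 1
    then have "A$1$1 = A$2$2" if "A \<in> \<Gamma>" for A using that diag_nonzero[OF that] by (auto simp: ratios_def)
    then show ?thesis by (rule split_first_equal)
  next
    case 2
    then have "A$2$2 = A$3$3" if "A \<in> \<Gamma>" for A using that diag_nonzero[OF that] by (auto simp: ratios_def)
    then show ?thesis by (rule split_last_equal)
  next
    case 3
    have "A$1$1 = A$3$3" if A: "A \<in> \<Gamma>" for A
    proof -
      have "A$1$1 / A$2$2 * (A$2$2 / A$3$3) = 1"
        using bspec[OF 3 imageI[OF A]] by (simp only: ratios_def prod.case)
      then show ?thesis using diag_nonzero[OF A] by simp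
    qed
    then show ?thesis by (rule split_outer_equal)
  next
    case 4
    then have "finite (ratios ` \<Gamma>)" by (rule finite_subset) simp
    then show ?thesis ..
  qed
qed

end

section \<open>Discrete subgroups of the Heisenberg group\<close>

text \<open>The derived subgroup of \<open>K\<close> lies in \<open>N\<close>, so the derived series
  of \<open>K\<close> ends at most one step after that of \<open>N\<close>.\<close>

lemma (in group) solvable_seq_over_commutators:
  assumes N: "solvable_seq G N" and K: "subgroup K G"
    and comm: "\<And>x y. x \<in> K \<Longrightarrow> y \<in> K \<Longrightarrow> x \<otimes> y \<otimes> inv x \<otimes> inv y \<in> N"
  shows "solvable_seq G K"
proof -
  obtain n where n: "(derived G ^^ n) N = {\<one>}" using solvable_imp_trivial_derived_seq[OF N] by blast
  have "derived G K \<subseteq> N"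
    unfolding derived_def
    by (rule generate_subgroup_incl[OF _ solvable_imp_subgroup[OF N]]) (use comm in auto)
  then have "(derived G ^^ n) (derived G K) \<subseteq> {\<one>}" using mono_exp_of_derived[of "derived G K" N n] n by simp
  moreover have "subgroup ((derived G ^^ n) (derived G K)) G"
    by (intro exp_of_derived_is_subgroup derived_is_subgroup subgroup.subset[OF K])
  ultimately have "(derived G ^^ n) (derived G K) = {\<one>}" using subgroup.one_closed by blast
  then have "(derived G ^^ Suc n) K = {\<one>}" by (simp add: funpow_swap1)
  then show ?thesis by (rule trivial_derived_seq_imp_solvable[OF K])
qed

lemma (in group) solvable_if_solvable_seq:
  assumes "solvable_seq G K" shows "solvable (G\<lparr>carrier := K\<rparr>)"
proof -
  have K: "subgroup K G" by (rule solvable_imp_subgroup[OF assms])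
  let ?K = "G\<lparr>carrier := K\<rparr>"
  have gK: "group ?K" by (rule subgroup_imp_group[OF K])
  interpret i: group_hom ?K G "\<lambda>x. x"
    using gK is_group subgroup.mem_carrier[OF K]
    by (auto simp: group_hom_def group_hom_axioms_def hom_def)
  have "subgroup K ?K" using group.subgroup_self[OF gK] by simp
  then have "solvable_seq ?K K" by (rule i.solvable_img_imp_solvable) (simp_all add: assms)
  then show ?thesis by (simp add: solvable_def)
qed

text \<open>The image is a discrete additive group, hence finitely generated; preimages of its
  generators generate \<open>K\<close> together with \<open>N\<close>.\<close>

lemma (in group) finitely_generated_over_kernel:
  fixes f :: "'a \<Rightarrow> 'v::euclidean_space"
  assumes K: "subgroup K G"
    and hom: "\<And>x y. x \<in> K \<Longrightarrow> y \<in> K \<Longrightarrow> f (x \<otimes> y) = f x + f y"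
    and ker: "\<And>x. x \<in> K \<Longrightarrow> f x = 0 \<Longrightarrow> x \<in> N"
    and fin: "\<And>r. finite {v \<in> f ` K. norm v \<le> r}"
  obtains F where "finite F" "F \<subseteq> K"
    "\<And>S. subgroup S G \<Longrightarrow> N \<subseteq> S \<Longrightarrow> F \<subseteq> S \<Longrightarrow> K \<subseteq> S"
proof -
  have cK: "x \<in> carrier G" if "x \<in> K" for x by (rule subgroup.mem_carrier[OF K that])
  have f1: "f \<one> = 0" using hom[of \<one> \<one>] subgroup.one_closed[OF K] by simp
  have fdiff: "f (x \<otimes> inv y) = f x - f y" if "x \<in> K" "y \<in> K" for x y
  proof -
    have iy: "inv y \<in> K" by (rule subgroup.m_inv_closed[OF K that(2)])
    have "f y + f (inv y) = 0" using hom[OF that(2) iy] f1 cK[OF that(2)] by simp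
    then show ?thesis using hom[OF that(1) iy] by (simp add: add_eq_0_iff)
  qed
  have diffK: "x \<otimes> inv y \<in> K" if "x \<in> K" "y \<in> K" for x y
    using that by (intro subgroup.m_closed[OF K] subgroup.m_inv_closed[OF K])
  interpret D: discrete_additive "f ` K"
  proof
    show "0 \<in> f ` K" using f1 subgroup.one_closed[OF K] by (metis image_eqI)
    show "u - v \<in> f ` K" if "u \<in> f ` K" "v \<in> f ` K" for u v
      using that fdiff diffK by (auto simp flip: fdiff)
  qed (rule fin)
  obtain F0 where F0: "finite F0" "F0 \<subseteq> f ` K"
    "\<And>S. 0 \<in> S \<Longrightarrow> (\<And>x y. x \<in> S \<Longrightarrow> y \<in> S \<Longrightarrow> x - y \<in> S) \<Longrightarrow> F0 \<subseteq> S \<Longrightarrow> f ` K \<subseteq> S"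
    by (rule D.finitely_generated) blast
  obtain F where F: "F \<subseteq> K" "finite F" "F0 = f ` F" using finite_subset_image[OF F0(1,2)] by blast
  show thesis
  proof (rule that[OF F(2,1)])
    fix S assume S: "subgroup S G" "N \<subseteq> S" "F \<subseteq> S"
    have "f ` K \<subseteq> f ` (K \<inter> S)"
    proof (rule F0(3))
      show "0 \<in> f ` (K \<inter> S)"
        using f1 subgroup.one_closed[OF K] subgroup.one_closed[OF S(1)] by (metis IntI image_eqI)
      show "u - v \<in> f ` (K \<inter> S)" if uv: "u \<in> f ` (K \<inter> S)" "v \<in> f ` (K \<inter> S)" for u v
      proof -
        obtain x y where x: "x \<in> K" "x \<in> S" "u = f x" and y: "y \<in> K" "y \<in> S" "v = f y" using uv by auto
        have "x \<otimes> inv y \<in> S" using x y by (intro subgroup.m_closed[OF S(1)] subgroup.m_inv_closed[OF S(1)])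
        then show ?thesis using fdiff[OF x(1) y(1)] diffK[OF x(1) y(1)] x(3) y(3) by (metis IntI image_eqI)
      qed
      show "F0 \<subseteq> f ` (K \<inter> S)" using F S by auto
    qed
    show "K \<subseteq> S"
    proof
      fix x assume x: "x \<in> K"
      then obtain y where y: "y \<in> K" "y \<in> S" "f x = f y" using \<open>f ` K \<subseteq> f ` (K \<inter> S)\<close> by blast
      have "x \<otimes> inv y \<in> S" using fdiff[OF x y(1)] y(3) ker[OF diffK[OF x y(1)]] S(2) by auto
      then have "x \<otimes> inv y \<otimes> y \<in> S" using y(2) by (rule subgroup.m_closed[OF S(1)])
      then show "x \<in> S" using cK[OF x] cK[OF y(1)] by (simp add: m_assoc)
    qed
  qed
qed

lemma iso_transfer:
  assumes G: "group G" and H: "group H" and f: "f \<in> iso G H"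
    and "finitely_presented G" "torsion_free G" "solvable G"
  shows "finitely_presented H \<and> torsion_free H \<and> solvable H"
proof -
  interpret f: group_hom G H f
    using G H f by (simp add: group_hom_def group_hom_axioms_def iso_def)
  have inj: "inj_on f (carrier G)" and surj: "f ` carrier G = carrier H"
    using f by (auto simp: iso_def bij_betw_def)
  have "G \<cong> H" using f unfolding is_iso_def by blast
  then have "finitely_presented H" using assms(4) G by (rule finitely_presented_iso[rotated 2])
  moreover have "torsion_free H"
    unfolding torsion_free_def
  proof (intro ballI impI allI notI)
    fix x n assume x: "x \<in> carrier H" "x \<noteq> \<one>\<^bsub>H\<^esub>" and n: "0 < n" "x [^]\<^bsub>H\<^esub> (n::nat) = \<one>\<^bsub>H\<^esub>"
    obtain a where a: "a \<in> carrier G" "x = f a" using x(1) surj by blast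
    have "f (a [^]\<^bsub>G\<^esub> n) = f \<one>\<^bsub>G\<^esub>" using n(2) a by (simp add: f.hom_nat_pow)
    then have "a [^]\<^bsub>G\<^esub> n = \<one>\<^bsub>G\<^esub>" using inj a(1) by (simp add: inj_on_def)
    then have "a = \<one>\<^bsub>G\<^esub>" using assms(5) a(1) n(1) unfolding torsion_free_def by blast
    then show False using a(2) x(2) by simp
  qed
  moreover have "solvable H" by (rule f.surj_hom_imp_solvable[OF surj assms(6)])
  ultimately show ?thesis by blast
qed

section \<open>Commutators, torsion and polycyclicity in the Heisenberg group\<close>

lemma Heis3_iff: "A \<in> carrier Heis3 \<longleftrightarrow> upper A \<and> (\<forall>i. A$i$i = 1)"
  by (auto simp: Heis3_def upper_def)

lemma Heis3_mult:
  assumes "A \<in> carrier Heis3" "B \<in> carrier Heis3"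
  shows "(A ** B)$1$2 = A$1$2 + B$1$2" "(A ** B)$2$3 = A$2$3 + B$2$3"
    "(A ** B)$1$3 = A$1$3 + B$1$3 + A$1$2 * B$2$3"
  using assms by (simp_all add: Heis3_iff upper_def matrix_mult_entry3)

lemma Heis3_eqI:
  assumes "A \<in> carrier Heis3" "B \<in> carrier Heis3" "A$1$2 = B$1$2" "A$2$3 = B$2$3" "A$1$3 = B$1$3"
  shows "A = B"
  using assms by (simp add: Heis3_iff upper_def vec_eq_iff forall_3)

lemma Heis3_det: "A \<in> carrier Heis3 \<Longrightarrow> det A = 1"
  by (simp add: Heis3_iff upper_def det_3)

locale discrete_Heis =
  fixes K :: "cmat3 set"
  assumes K: "subgroup K SL3" and heis: "K \<subseteq> carrier Heis3"
    and fin: "\<And>r. finite {A \<in> K. \<forall>i j. cmod (A$i$j) \<le> r}"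
begin

interpretation SL: group SL3 by (rule group_SL3)

text \<open>Central in \<open>K\<close> and containing all commutators of \<open>K\<close>; it can
  be smaller than the true centre, as for some abelian \<open>K\<close>.\<close>

definition centre :: "cmat3 set" where
  "centre = {A \<in> K. A$1$2 = 0 \<and> A$2$3 = 0}"

lemma inv_entries:
  assumes "A \<in> K"
  shows "inv\<^bsub>SL3\<^esub> A \<in> K" "(inv\<^bsub>SL3\<^esub> A)$1$2 = - A$1$2" "(inv\<^bsub>SL3\<^esub> A)$2$3 = - A$2$3"
    "(inv\<^bsub>SL3\<^esub> A)$1$3 = A$1$2 * A$2$3 - A$1$3"
proof -
  have A: "A \<in> carrier Heis3" using assms heis by blast
  show "inv\<^bsub>SL3\<^esub> A \<in> K" by (rule subgroup.m_inv_closed[OF K assms])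
  have "inv\<^bsub>SL3\<^esub> A = cofactor3 A" using Heis3_det[OF A] by (intro inv_SL3 cofactor3_inverse)
  then show "(inv\<^bsub>SL3\<^esub> A)$1$2 = - A$1$2" "(inv\<^bsub>SL3\<^esub> A)$2$3 = - A$2$3"
    "(inv\<^bsub>SL3\<^esub> A)$1$3 = A$1$2 * A$2$3 - A$1$3"
    using A by (simp_all add: cofactor3_def Heis3_iff upper_def)
qed

lemma closed: "A \<in> K \<Longrightarrow> B \<in> K \<Longrightarrow> A ** B \<in> K"
  using subgroup.m_closed[OF K, of A B] by simp

lemma mult_entries:
  assumes "A \<in> K" "B \<in> K"
  shows "(A ** B)$1$2 = A$1$2 + B$1$2" "(A ** B)$2$3 = A$2$3 + B$2$3"
    "(A ** B)$1$3 = A$1$3 + B$1$3 + A$1$2 * B$2$3"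
  using Heis3_mult[of A B] subsetD[OF heis] assms by simp_all

lemma eqI: "A \<in> K \<Longrightarrow> B \<in> K \<Longrightarrow> A$1$2 = B$1$2 \<Longrightarrow> A$2$3 = B$2$3 \<Longrightarrow> A$1$3 = B$1$3 \<Longrightarrow> A = B"
  using Heis3_eqI[of A B] subsetD[OF heis] by simp

lemma one_in: "mat 1 \<in> K"
  using subgroup.one_closed[OF K] by simp

lemma finite_entries:
  "finite {A \<in> K. cmod (A$1$2) \<le> r \<and> cmod (A$2$3) \<le> r \<and> cmod (A$1$3) \<le> r}"
proof (rule finite_subset[OF _ fin[of "max r 1"]], safe)
  fix A i j assume A: "A \<in> K" "cmod (A$1$2) \<le> r" "cmod (A$2$3) \<le> r" "cmod (A$1$3) \<le> r"
  then have "A \<in> carrier Heis3" using heis by blast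
  then have "A$i$j = 0 \<or> A$i$j = 1 \<or> cmod (A$i$j) \<le> r"
    using A exhaust_3[of i] exhaust_3[of j] by (auto simp: Heis3_iff upper_def)
  then show "cmod (A$i$j) \<le> max r 1" by auto
qed

lemma commutator_entries:
  assumes A: "A \<in> K" and B: "B \<in> K"
  defines "C \<equiv> A ** B ** inv\<^bsub>SL3\<^esub> A ** inv\<^bsub>SL3\<^esub> B"
  shows "C \<in> centre" "C$1$3 = A$1$2 * B$2$3 - B$1$2 * A$2$3"
proof -
  note i = inv_entries[OF A] inv_entries[OF B]
  have AB: "A ** B \<in> K" and ABA: "A ** B ** inv\<^bsub>SL3\<^esub> A \<in> K" using A B i closed by auto
  note e = mult_entries[OF A B] mult_entries[OF AB i(1)] mult_entries[OF ABA i(5)]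
  show "C \<in> centre" using closed[OF ABA i(5)] by (simp add: centre_def C_def e i)
  show "C$1$3 = A$1$2 * B$2$3 - B$1$2 * A$2$3" by (simp add: C_def e i algebra_simps)
qed

lemma centre_subgroup: "subgroup centre SL3"
proof (rule SL.subgroupI)
  show "centre \<subseteq> carrier SL3" using subgroup.subset[OF K] by (auto simp: centre_def)
  have "mat 1 \<in> centre" using one_in by (simp add: centre_def mat_entry)
  then show "centre \<noteq> {}" by blast
  show "inv\<^bsub>SL3\<^esub> A \<in> centre" if "A \<in> centre" for A using that inv_entries by (auto simp: centre_def)
  show "A \<otimes>\<^bsub>SL3\<^esub> B \<in> centre" if "A \<in> centre" "B \<in> centre" for A B
    using that closed mult_entries by (auto simp: centre_def)
qed

lemma centre_commutator:
  assumes "A \<in> centre" "B \<in> K"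
  shows "A ** B ** inv\<^bsub>SL3\<^esub> A ** inv\<^bsub>SL3\<^esub> B = mat 1"
proof -
  have A: "A \<in> K" using assms by (simp add: centre_def)
  note c = commutator_entries[OF A assms(2)]
  show ?thesis
    using c assms(1) by (intro eqI one_in) (auto simp: centre_def mat_entry)
qed

lemma centre_fin: "finite {v \<in> (\<lambda>A. A$1$3) ` centre. norm v \<le> r}"
  by (rule finite_subset[OF _ finite_imageI[OF finite_entries[of "max r 0"], of "\<lambda>A. A$1$3"]])
     (auto simp: centre_def)

lemma centre_polycyclic: "SL.polycyclic centre"
proof -
  obtain F where F: "finite F" "F \<subseteq> centre"
    "\<And>S. subgroup S SL3 \<Longrightarrow> {mat 1} \<subseteq> S \<Longrightarrow> F \<subseteq> S \<Longrightarrow> centre \<subseteq> S"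
  proof (rule SL.finitely_generated_over_kernel[OF centre_subgroup, of "\<lambda>A. A$1$3" "{mat 1}"])
    show "(A \<otimes>\<^bsub>SL3\<^esub> B)$1$3 = A$1$3 + B$1$3" if "A \<in> centre" "B \<in> centre" for A B
      using that mult_entries by (auto simp: centre_def)
    show "A \<in> {mat 1}" if "A \<in> centre" "A$1$3 = 0" for A
      using that one_in by (auto simp: centre_def mat_entry intro!: eqI)
  qed (rule centre_fin, blast)
  show ?thesis
  proof (rule SL.polycyclic_if_fg_over_commutators[OF SL.polycyclic.trivial centre_subgroup _ F(1,2)])
    show "A \<otimes>\<^bsub>SL3\<^esub> B \<otimes>\<^bsub>SL3\<^esub> inv\<^bsub>SL3\<^esub> A \<otimes>\<^bsub>SL3\<^esub> inv\<^bsub>SL3\<^esub> B \<in> {\<one>\<^bsub>SL3\<^esub>}"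
      if "A \<in> centre" "B \<in> centre" for A B
      using centre_commutator[OF that(1), of B] that(2) by (simp add: centre_def)
  qed (use F(3) subgroup.one_closed[OF centre_subgroup] in auto)
qed

lemma solvable: "solvable (SL3\<lparr>carrier := K\<rparr>)"
proof (rule SL.solvable_if_solvable_seq)
  have "solvable_seq SL3 centre"
    using centre_commutator
    by (intro SL.solvable_seq_over_commutators[OF solvable_seq.unity centre_subgroup]) (auto simp: centre_def)
  then show "solvable_seq SL3 K"
    using commutator_entries(1) by (intro SL.solvable_seq_over_commutators[OF _ K]) auto
qed

text \<open>Powers multiply the two outer entries by the exponent, and the corner entry as well once
  \<open>A$1$2\<close> vanishes.\<close>

lemma torsion_free: "torsion_free (SL3\<lparr>carrier := K\<rparr>)"
  unfolding torsion_free_def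
proof (intro ballI impI allI notI)
  let ?K = "SL3\<lparr>carrier := K\<rparr>"
  interpret K: group ?K by (rule SL.subgroup_imp_group[OF K])
  fix A n assume "A \<in> carrier ?K" and n1: "A \<noteq> \<one>\<^bsub>?K\<^esub>" and n: "0 < n" "A [^]\<^bsub>?K\<^esub> (n::nat) = \<one>\<^bsub>?K\<^esub>"
  then have A: "A \<in> K" by simp
  have p: "A [^]\<^bsub>?K\<^esub> m \<in> K \<and> (A [^]\<^bsub>?K\<^esub> m)$1$2 = of_nat m * A$1$2 \<and> (A [^]\<^bsub>?K\<^esub> m)$2$3 = of_nat m * A$2$3 \<and>
     (A$1$2 = 0 \<longrightarrow> (A [^]\<^bsub>?K\<^esub> m)$1$3 = of_nat m * A$1$3)" for m :: nat
  proof (induction m)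
    case 0
    then show ?case using one_in by (simp add: mat_entry)
  next
    case (Suc m)
    then show ?case using A closed mult_entries[of "A [^]\<^bsub>?K\<^esub> m" A] by (simp add: algebra_simps)
  qed
  have "A$1$2 = 0" "A$2$3 = 0" using p[of n] n by (simp_all add: mat_entry)
  moreover have "A$1$3 = 0" using p[of n] n calculation by (simp add: mat_entry)
  ultimately have "A = mat 1" using A one_in by (intro eqI) (simp_all add: mat_entry)
  then show False using n1 by simp
qed

lemma polycyclic: "SL.polycyclic K"
proof (cases "\<forall>A\<in>K. \<forall>B\<in>K. A$1$2 * B$2$3 = B$1$2 * A$2$3")
  case True
  \<comment> \<open>The coordinates of the matrix logarithm, which is additive on commuting
    elements.\<close>
  define f where "f A = (A$1$2, A$2$3, A$1$3 - A$1$2 * A$2$3 / 2)" for A :: cmat3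
  obtain F where F: "finite F" "F \<subseteq> K"
    "\<And>S. subgroup S SL3 \<Longrightarrow> {mat 1} \<subseteq> S \<Longrightarrow> F \<subseteq> S \<Longrightarrow> K \<subseteq> S"
  proof (rule SL.finitely_generated_over_kernel[OF K, of f "{mat 1}"])
    show "f (A \<otimes>\<^bsub>SL3\<^esub> B) = f A + f B" if "A \<in> K" "B \<in> K" for A B
      using True that mult_entries[OF that] by (auto simp: f_def field_simps)
    show "A \<in> {mat 1}" if "A \<in> K" "f A = 0" for A
      using that one_in by (auto simp: f_def mat_entry zero_prod_def intro!: eqI)
    show "finite {v \<in> f ` K. norm v \<le> r}" for r
    proof (rule finite_subset)
      \<comment> \<open>The corner entry is recovered as z + x y / 2, hence the quadratic term;
        \<open>max r 0\<close> covers negative radii.\<close>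
      let ?r = "max r 0 + max r 0 * max r 0"
      show "finite (f ` {A \<in> K. cmod (A$1$2) \<le> ?r \<and> cmod (A$2$3) \<le> ?r \<and> cmod (A$1$3) \<le> ?r})"
        by (intro finite_imageI finite_entries)
      show "{v \<in> f ` K. norm v \<le> r} \<subseteq> f ` {A \<in> K. cmod (A$1$2) \<le> ?r \<and> cmod (A$2$3) \<le> ?r \<and> cmod (A$1$3) \<le> ?r}"
      proof
        fix v assume "v \<in> {v \<in> f ` K. norm v \<le> r}"
        then obtain A where A: "A \<in> K" "norm (f A) \<le> r" and v: "v = f A" by auto
        define x y z where "x = A$1$2" "y = A$2$3" "z = A$1$3 - A$1$2 * A$2$3 / 2"
        have fA: "f A = (x, y, z)" by (simp add: f_def x_y_z_def)
        have b: "cmod x \<le> r" "cmod y \<le> r" "cmod z \<le> r"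
        proof -
          have "cmod x \<le> norm (x, y, z)" by (rule norm_fst_le)
          moreover have "norm (y, z) \<le> norm (x, y, z)" by (rule norm_snd_le)
          moreover have "cmod y \<le> norm (y, z)" by (rule norm_fst_le)
          moreover have "cmod z \<le> norm (y, z)" by (rule norm_snd_le)
          ultimately show "cmod x \<le> r" "cmod y \<le> r" "cmod z \<le> r" using A(2) unfolding fA by linarith+
        qed
        have r: "0 \<le> r" using b(1) norm_ge_zero order_trans by blast
        have "cmod (x * y) \<le> r * r" unfolding norm_mult using b r by (intro mult_mono) auto
        moreover have "A$1$3 = z + x * y / 2" by (simp add: x_y_z_def)
        moreover have "cmod (z + x * y / 2) \<le> cmod z + cmod (x * y) / 2"
          by (rule norm_triangle_le) (simp add: norm_divide)
        moreover have "0 \<le> r * r" by simp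
        ultimately have "cmod (A$1$3) \<le> r + r * r" using b(3) by (smt (verit) field_sum_of_halves)
        moreover have "cmod (A$1$2) \<le> r + r * r" "cmod (A$2$3) \<le> r + r * r"
          using b(1,2) \<open>0 \<le> r * r\<close> unfolding x_y_z_def by linarith+
        ultimately show "v \<in> f ` {A \<in> K. cmod (A$1$2) \<le> ?r \<and> cmod (A$2$3) \<le> ?r \<and> cmod (A$1$3) \<le> ?r}"
          unfolding v using A(1) r by (intro imageI) simp
      qed
    qed
  qed blast
  show ?thesis
  proof (rule SL.polycyclic_if_fg_over_commutators[OF SL.polycyclic.trivial K _ F(1,2)])
    show "A \<otimes>\<^bsub>SL3\<^esub> B \<otimes>\<^bsub>SL3\<^esub> inv\<^bsub>SL3\<^esub> A \<otimes>\<^bsub>SL3\<^esub> inv\<^bsub>SL3\<^esub> B \<in> {\<one>\<^bsub>SL3\<^esub>}"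
      if "A \<in> K" "B \<in> K" for A B
      using commutator_entries[OF that] True that one_in
      by (auto simp: centre_def mat_entry intro!: eqI)
  qed (use F(3) one_in in auto)
next
  case False
  then obtain U V where UV: "U \<in> K" "V \<in> K" "U$1$2 * V$2$3 \<noteq> V$1$2 * U$2$3" by blast
  \<comment> \<open>Corner entries of the commutators of \<open>U\<close> and \<open>V\<close> with
    \<open>A\<close>. Their values lie in the discrete set \<open>?D\<close>, and both vanish only
    for \<open>A\<close> in \<open>centre\<close>, because \<open>U\<close> and \<open>V\<close> do
    not commute.\<close>
  define f where "f A = (U$1$2 * A$2$3 - A$1$2 * U$2$3, V$1$2 * A$2$3 - A$1$2 * V$2$3)" for A :: cmat3
  let ?D = "(\<lambda>A. A$1$3) ` centre"
  obtain F where F: "finite F" "F \<subseteq> K"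
    "\<And>S. subgroup S SL3 \<Longrightarrow> centre \<subseteq> S \<Longrightarrow> F \<subseteq> S \<Longrightarrow> K \<subseteq> S"
  proof (rule SL.finitely_generated_over_kernel[OF K, of f centre])
    show "f (A \<otimes>\<^bsub>SL3\<^esub> B) = f A + f B" if "A \<in> K" "B \<in> K" for A B
      using mult_entries[OF that] by (simp add: f_def algebra_simps)
    show "A \<in> centre" if A: "A \<in> K" "f A = 0" for A
    proof -
      have e: "U$1$2 * A$2$3 = A$1$2 * U$2$3" "V$1$2 * A$2$3 = A$1$2 * V$2$3"
        using A(2) by (auto simp: f_def zero_prod_def)
      have "(U$1$2 * V$2$3 - V$1$2 * U$2$3) * A$1$2 = U$1$2 * (A$1$2 * V$2$3) - V$1$2 * (A$1$2 * U$2$3)"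
        by (simp add: algebra_simps)
      also have "\<dots> = U$1$2 * (V$1$2 * A$2$3) - V$1$2 * (U$1$2 * A$2$3)" by (simp only: e)
      finally have 1: "(U$1$2 * V$2$3 - V$1$2 * U$2$3) * A$1$2 = 0" by (simp add: algebra_simps)
      have "(U$1$2 * V$2$3 - V$1$2 * U$2$3) * A$2$3 = V$2$3 * (U$1$2 * A$2$3) - U$2$3 * (V$1$2 * A$2$3)"
        by (simp add: algebra_simps)
      also have "\<dots> = V$2$3 * (A$1$2 * U$2$3) - U$2$3 * (A$1$2 * V$2$3)" by (simp only: e)
      finally have "(U$1$2 * V$2$3 - V$1$2 * U$2$3) * A$2$3 = 0" by (simp add: algebra_simps)
      with 1 show ?thesis using A(1) UV(3) by (simp add: centre_def)
    qed
    show "finite {v \<in> f ` K. norm v \<le> r}" for r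
    proof (rule finite_subset)
      show "finite ({v \<in> ?D. norm v \<le> r} \<times> {v \<in> ?D. norm v \<le> r})"
        by (intro finite_cartesian_product centre_fin)
      show "{v \<in> f ` K. norm v \<le> r} \<subseteq> {v \<in> ?D. norm v \<le> r} \<times> {v \<in> ?D. norm v \<le> r}"
      proof
        fix v assume "v \<in> {v \<in> f ` K. norm v \<le> r}"
        then obtain A where A: "A \<in> K" "norm (f A) \<le> r" and v: "v = f A" by auto
        have "U$1$2 * A$2$3 - A$1$2 * U$2$3 \<in> ?D" "V$1$2 * A$2$3 - A$1$2 * V$2$3 \<in> ?D"
          using commutator_entries[OF UV(1) A(1)] commutator_entries[OF UV(2) A(1)] by (metis image_eqI)+
        moreover have "cmod (fst (f A)) \<le> norm (f A)" "cmod (snd (f A)) \<le> norm (f A)"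
          by (metis norm_fst_le norm_snd_le prod.collapse)+
        then have "cmod (fst (f A)) \<le> r" "cmod (snd (f A)) \<le> r" using A(2) by simp_all
        ultimately show "v \<in> {v \<in> ?D. norm v \<le> r} \<times> {v \<in> ?D. norm v \<le> r}" by (simp add: v f_def)
      qed
    qed
  qed blast
  show ?thesis
  proof (rule SL.polycyclic_if_fg_over_commutators[OF centre_polycyclic K _ F(1,2)])
    show "A \<otimes>\<^bsub>SL3\<^esub> B \<otimes>\<^bsub>SL3\<^esub> inv\<^bsub>SL3\<^esub> A \<otimes>\<^bsub>SL3\<^esub> inv\<^bsub>SL3\<^esub> B \<in> centre"
      if "A \<in> K" "B \<in> K" for A B
      using commutator_entries(1)[OF that] by simp
  qed (use F(3) in \<open>auto simp: centre_def\<close>)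
qed

lemma finitely_presented: "finitely_presented (SL3\<lparr>carrier := K\<rparr>)"
  by (rule SL.polycyclic_imp_finitely_presented[OF polycyclic])

end

section \<open>The dichotomy\<close>

text \<open>Dividing by a cube root of the determinant leaves the conjugation unchanged and makes
  \<open>P\<close> represent an element of PSL.\<close>

lemma normalize_det:
  assumes "mutual_inverse P Q"
  obtains P' Q' where "mutual_inverse P' Q'" "det P' = 1" "\<And>A. P' ** A ** Q' = P ** A ** Q"
proof -
  have d: "det P * det Q = 1" using assms by (metis det_I det_mul mutual_inverse_def)
  define s where "s = exp (Ln (1 / det P) / 3)"
  have "1 / det P \<noteq> 0" using d by auto
  then have s3: "s ^ 3 = 1 / det P" by (simp add: s_def exp_of_nat_mult[symmetric])
  have s0: "s \<noteq> 0" by (simp add: s_def)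
  have scale: "(mat s ** P) ** A ** (Q ** mat (1 / s)) = P ** A ** Q" for A
  proof -
    have "(mat s ** P) ** A ** (Q ** mat (1 / s)) = mat s ** (P ** A ** Q) ** mat (1 / s)"
      by (simp add: matrix_mul_assoc)
    also have "\<dots> = P ** A ** Q" using s0 by (simp add: vec_eq_iff mat_mult_left mat_mult_right)
    finally show ?thesis .
  qed
  have "mat s ** mat (1 / s) = (mat 1 :: cmat3)" "mat (1 / s) ** mat s = (mat 1 :: cmat3)"
    using s0 by (simp_all add: vec_eq_iff mat_mult_left mat_entry)
  then have "mutual_inverse (mat s) (mat (1 / s))" by (simp add: mutual_inverse_def)
  then have "mutual_inverse (mat s ** P) (Q ** mat (1 / s))" by (rule mutual_inverse_mult[OF _ assms])
  moreover have "det (mat s ** P) = 1" using s3 d by (auto simp: det_mul det_mat3)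
  ultimately show thesis using scale by (rule that)
qed

lemma injective_hom_iso:
  assumes A: "group A" and f: "f \<in> hom A PSL3"
    and inj: "\<And>x. x \<in> carrier A \<Longrightarrow> f x = \<one>\<^bsub>PSL3\<^esub> \<Longrightarrow> x = \<one>\<^bsub>A\<^esub>"
  shows "subgroup (f ` carrier A) PSL3" "f \<in> iso A (PSL3_sub (f ` carrier A))"
proof -
  interpret f: group_hom A PSL3 f by (simp add: group_hom_def group_hom_axioms_def A group_PSL3 f)
  show "subgroup (f ` carrier A) PSL3" by (rule f.img_is_subgroup)
  have "inj_on f (carrier A)" using inj by (simp add: f.inj_on_one_iff)
  then show "f \<in> iso A (PSL3_sub (f ` carrier A))"
    using f by (simp add: iso_def bij_betw_def hom_def Pi_def)
qed

text \<open>An invariant with finitely many values, each of whose fibres stays within one coset,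
  bounds the number of cosets. It is used for eigenvalue ratios and for lattice coordinates modulo
  3.\<close>

lemma finite_index:
  fixes \<phi> :: "cmat3 \<Rightarrow> 'b"
  assumes G: "subgroup G PSL3" and H: "subgroup H PSL3" "H \<subseteq> G"
    and fin: "finite (\<phi> ` lift G)"
    and \<phi>: "\<And>A B. A \<in> lift G \<Longrightarrow> B \<in> lift G \<Longrightarrow> \<phi> A = \<phi> B \<Longrightarrow> proj (A ** cofactor3 B) \<in> H"
  shows "subgroup H (PSL3_sub G)" "finite (rcosets\<^bsub>PSL3_sub G\<^esub> H)"
proof -
  interpret group PSL3 by (rule group_PSL3)
  show "subgroup H (PSL3_sub G)" by (rule subgroup_incl[OF H(1) G H(2)])
  define c where "c A = H #>\<^bsub>PSL3\<^esub> proj A" for A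
  have eq: "c A = c B" if A: "A \<in> lift G" and B: "B \<in> lift G" and e: "\<phi> A = \<phi> B" for A B
  proof -
    have d: "det A = 1" "det B = 1" using A B by (auto simp: lift_def carrier_SL3)
    have inv: "mutual_inverse B (cofactor3 B)" by (rule cofactor3_inverse[OF d(2)])
    have "det (cofactor3 B) = 1" using inv d by (metis det_I det_mul mult_1 mutual_inverse_def)
    then have "proj (A ** cofactor3 B) \<otimes>\<^bsub>PSL3\<^esub> proj B = proj (A ** cofactor3 B ** B)"
      using d by (intro proj_mult) (simp_all add: det_mul)
    also have "A ** cofactor3 B ** B = A"
      using inv unfolding mutual_inverse_def by (metis matrix_mul_assoc matrix_mul_rid)
    finally have "proj A \<in> H #>\<^bsub>PSL3\<^esub> proj B"
      using \<phi>[OF A B e] unfolding r_coset_def by (metis UN_I singletonI)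
    moreover have "proj B \<in> carrier PSL3" using d by (auto simp: carrier_PSL3 carrier_SL3)
    ultimately show ?thesis unfolding c_def by (rule repr_independence[OF _ _ H(1), symmetric])
  qed
  have "finite (c ` lift G)"
  proof (rule finite_subset)
    show "finite ((\<lambda>v. c (SOME A. A \<in> lift G \<and> \<phi> A = v)) ` \<phi> ` lift G)" by (rule finite_imageI[OF fin])
    show "c ` lift G \<subseteq> (\<lambda>v. c (SOME A. A \<in> lift G \<and> \<phi> A = v)) ` \<phi> ` lift G"
    proof
      fix x assume "x \<in> c ` lift G"
      then obtain A where A: "A \<in> lift G" "x = c A" by blast
      have "\<exists>B. B \<in> lift G \<and> \<phi> B = \<phi> A" using A(1) by blast
      then have "(SOME B. B \<in> lift G \<and> \<phi> B = \<phi> A) \<in> lift G \<and> \<phi> (SOME B. B \<in> lift G \<and> \<phi> B = \<phi> A) = \<phi> A"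
        by (rule someI_ex)
      then have "x = c (SOME B. B \<in> lift G \<and> \<phi> B = \<phi> A)" using eq[OF A(1)] A(2) by metis
      then show "x \<in> (\<lambda>v. c (SOME A. A \<in> lift G \<and> \<phi> A = v)) ` \<phi> ` lift G" using A(1) by blast
    qed
  qed
  moreover have "rcosets\<^bsub>PSL3_sub G\<^esub> H \<subseteq> c ` lift G"
  proof
    fix x assume "x \<in> rcosets\<^bsub>PSL3_sub G\<^esub> H"
    then obtain g where g: "g \<in> G" "x = H #>\<^bsub>PSL3\<^esub> g" by (auto simp: RCOSETS_def r_coset_def)
    then obtain A where "A \<in> lift G" "g = proj A" using proj_lift[OF subgroup.subset[OF G]] by blast
    then show "x \<in> c ` lift G" using g by (auto simp: c_def)
  qed
  ultimately show "finite (rcosets\<^bsub>PSL3_sub G\<^esub> H)" by (rule finite_subset[rotated])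
qed

locale conjugated_lift =
  fixes G :: "cmat3 set set" and P Q :: cmat3
  assumes G: "subgroup G PSL3" and lift: "parabolic_lift (lift G)"
    and PQ: "mutual_inverse P Q" and detP: "det P = 1"
begin

abbreviation \<Delta> :: "cmat3 set" where "\<Delta> \<equiv> (\<lambda>A. P ** A ** Q) ` lift G"

sublocale conj: parabolic_lift \<Delta>
  by (rule parabolic_lift.lift_conj[OF lift PQ])

lemma detQ: "det Q = 1"
  using PQ detP by (metis det_I det_mul mult_1 mutual_inverse_def)

text \<open>Undoes the conjugation before projecting, so that subgroups found inside
  \<open>\<Delta>\<close> become subgroups of \<open>G\<close> itself.\<close>

definition emb :: "cmat3 \<Rightarrow> cmat3 set" where "emb X = proj (Q ** X ** P)"

lemma emb_mult:
  assumes "det X = 1" "det Y = 1" shows "emb (X ** Y) = emb X \<otimes>\<^bsub>PSL3\<^esub> emb Y"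
  using conj_mult[OF mutual_inverse_sym[OF PQ], of X Y] assms detP detQ
  by (simp add: emb_def proj_mult det_mul)

lemma emb_scale: "c ^ 3 = 1 \<Longrightarrow> emb (mat c ** X) = emb X"
proof -
  assume "c ^ 3 = 1"
  moreover have "Q ** (mat c ** X) ** P = mat c ** (Q ** X ** P)"
    by (metis mat_commute matrix_mul_assoc)
  ultimately show ?thesis by (simp add: emb_def proj_scale)
qed

lemma emb_eq_one: "emb X = \<one>\<^bsub>PSL3\<^esub> \<Longrightarrow> \<exists>c. c ^ 3 = 1 \<and> X = mat c"
proof -
  assume "emb X = \<one>\<^bsub>PSL3\<^esub>"
  then obtain c where c: "c ^ 3 = 1" "Q ** X ** P = mat c"
    unfolding emb_def one_PSL3 proj_eq_iff by auto
  then have "X = P ** mat c ** Q" using conj_back[OF mutual_inverse_sym[OF PQ], of X] by simp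
  then show ?thesis using c(1) conj_mat[OF PQ] by auto
qed

lemma emb_in_G: "X \<in> \<Delta> \<Longrightarrow> emb X \<in> G"
  using conj_back[OF PQ] by (auto simp: emb_def lift_def)

lemma emb_conj: "A \<in> lift G \<Longrightarrow> emb (P ** A ** Q) = proj A"
  using conj_back[OF PQ] by (simp add: emb_def)

lemma quotient_lift:
  assumes A: "A \<in> lift G" and B: "B \<in> lift G"
  defines "C \<equiv> P ** (A ** cofactor3 B) ** Q"
  shows "C \<in> \<Delta>" "C ** (P ** B ** Q) = P ** A ** Q" "emb C = proj (A ** cofactor3 B)"
proof -
  have L: "A ** cofactor3 B \<in> lift G"
    using parabolic_monoid.mult[OF parabolic_lift.axioms(1)[OF lift]] parabolic_lift.inv[OF lift] A B by blast
  show "C \<in> \<Delta>" unfolding C_def by (rule imageI[OF L])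
  show "emb C = proj (A ** cofactor3 B)" unfolding C_def by (rule emb_conj[OF L])
  have "mutual_inverse B (cofactor3 B)"
    using B by (intro cofactor3_inverse) (simp add: lift_def carrier_SL3)
  then have "A ** cofactor3 B ** B = A"
    unfolding mutual_inverse_def by (metis matrix_mul_assoc matrix_mul_rid)
  then show "C ** (P ** B ** Q) = P ** A ** Q" by (simp add: C_def conj_mult[OF PQ])
qed

lemma conjugate_emb:
  assumes "\<And>X. X \<in> S \<Longrightarrow> det X = 1"
  shows "conjugate_in_PSL3 (emb ` S) (proj ` S)"
  unfolding conjugate_in_PSL3_def
proof (intro bexI[of _ "proj P"])
  show "proj P \<in> carrier PSL3" using detP by (auto simp: carrier_PSL3 carrier_SL3)
  have "proj P \<otimes>\<^bsub>PSL3\<^esub> emb X \<otimes>\<^bsub>PSL3\<^esub> inv\<^bsub>PSL3\<^esub> proj P = proj X" if "X \<in> S" for X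
    using assms[OF that] conj_back[OF mutual_inverse_sym[OF PQ], of X]
    by (simp add: emb_def proj_inv[OF detP PQ] proj_mult det_mul detP detQ matrix_mul_assoc)
  then show "proj ` S = (\<lambda>h. proj P \<otimes>\<^bsub>PSL3\<^esub> h \<otimes>\<^bsub>PSL3\<^esub> inv\<^bsub>PSL3\<^esub> proj P) ` emb ` S"
    by (simp add: image_image)
qed

text \<open>\<open>emb\<close> is injective on the unipotent matrices \<open>K\<close> in
  \<open>\<Delta>\<close>, since a unipotent scalar is the identity; so the properties of
  \<open>K\<close> pass to its image.\<close>

theorem virtually_unipotent:
  assumes up: "\<And>X. X \<in> \<Delta> \<Longrightarrow> upper X" and fin: "finite (ratios ` \<Delta>)"
  obtains H where "subgroup H (PSL3_sub G)" "finite (rcosets\<^bsub>PSL3_sub G\<^esub> H)"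
    "finitely_presented (PSL3_sub H)" "torsion_free (PSL3_sub H)" "solvable (PSL3_sub H)"
    "\<forall>h\<in>H. unipotent h" "\<exists>K. subgroup K Heis3 \<and> conjugate_in_PSL3 H (proj ` K)"
proof -
  interpret U: upper_parabolic_lift \<Delta> by unfold_locales (rule up)
  interpret SL: group SL3 by (rule group_SL3)
  define K where "K = {X \<in> \<Delta>. \<forall>i. X$i$i = 1}"
  have KD: "K \<subseteq> \<Delta>" by (auto simp: K_def)
  have Kdet: "det X = 1" if "X \<in> K" for X using that KD conj.det1 by blast
  have heis: "K \<subseteq> carrier Heis3" using up by (auto simp: K_def Heis3_iff)
  have K: "subgroup K SL3"
  proof (rule SL.subgroupI)
    show "K \<subseteq> carrier SL3" using Kdet by (auto simp: carrier_SL3)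
    have "mat 1 \<in> K" using conj.one by (simp add: K_def mat_entry)
    then show "K \<noteq> {}" by blast
    fix X assume X: "X \<in> K"
    then have XD: "X \<in> \<Delta>" and Xi: "X$i$i = 1" for i by (auto simp: K_def)
    have "inv\<^bsub>SL3\<^esub> X = cofactor3 X" using Kdet[OF X] by (intro inv_SL3 cofactor3_inverse)
    moreover have "cofactor3 X \<in> K"
      using conj.inv[OF XD] U.low[OF XD] by (simp add: K_def forall_3 cofactor3_def Xi)
    ultimately show "inv\<^bsub>SL3\<^esub> X \<in> K" by simp
    fix Y assume Y: "Y \<in> K"
    then have YD: "Y \<in> \<Delta>" and Yi: "Y$i$i = 1" for i by (auto simp: K_def)
    show "X \<otimes>\<^bsub>SL3\<^esub> Y \<in> K"
      using conj.mult[OF XD YD] U.low[OF XD] U.low[OF YD]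
      by (simp add: K_def forall_3 matrix_mult_entry3 Xi Yi)
  qed
  interpret dH: discrete_Heis K
  proof (rule discrete_Heis.intro[OF K heis])
    show "finite {A \<in> K. \<forall>i j. cmod (A$i$j) \<le> r}" for r
      by (rule finite_subset[OF _ conj.fin[of r]]) (use KD in blast)
  qed
  let ?K = "SL3\<lparr>carrier := K\<rparr>"
  have gK: "group ?K" by (rule SL.subgroup_imp_group[OF K])
  define H where "H = emb ` K"
  have hom: "emb \<in> hom ?K PSL3"
  proof (rule homI)
    show "emb X \<in> carrier PSL3" if "X \<in> carrier ?K" for X
      using emb_in_G[of X] subsetD[OF KD, of X] subsetD[OF subgroup.subset[OF G]] that by simp
    show "emb (X \<otimes>\<^bsub>?K\<^esub> Y) = emb X \<otimes>\<^bsub>PSL3\<^esub> emb Y" if "X \<in> carrier ?K" "Y \<in> carrier ?K" for X Y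
      using emb_mult[of X Y] Kdet that by simp
  qed
  have inj: "X = \<one>\<^bsub>?K\<^esub>" if "X \<in> carrier ?K" "emb X = \<one>\<^bsub>PSL3\<^esub>" for X
    using that emb_eq_one[of X] by (auto simp: K_def mat_entry)
  note iso = injective_hom_iso[OF gK hom inj]
  have H: "subgroup H PSL3" and iso': "emb \<in> iso ?K (PSL3_sub H)" using iso by (simp_all add: H_def)
  have HG: "H \<subseteq> G" using emb_in_G KD by (auto simp: H_def)
  have index: "proj (A ** cofactor3 B) \<in> H"
    if A: "A \<in> lift G" and B: "B \<in> lift G" and r: "ratios (P ** A ** Q) = ratios (P ** B ** Q)" for A B
  proof -
    let ?A = "P ** A ** Q" and ?B = "P ** B ** Q" and ?C = "P ** (A ** cofactor3 B) ** Q"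
    note C = quotient_lift[OF A B]
    have D: "?A \<in> \<Delta>" "?B \<in> \<Delta>" "?C \<in> \<Delta>" using A B C(1) by blast+
    have diag: "?C$i$i * ?B$i$i = ?A$i$i" for i
    proof -
      have "(?C ** ?B)$i$i = ?C$i$i * ?B$i$i"
        using U.low[OF D(2)] U.low[OF D(3)] exhaust_3[of i] by (auto simp: matrix_mult_entry3)
      then show ?thesis using C(2) by simp
    qed
    define c where "c = ?C$1$1"
    have nz: "?B$i$i \<noteq> 0" "?C$i$i \<noteq> 0" for i using U.diag_nonzero D by blast+
    \<comment> \<open>Equal ratios make the diagonal of the quotient constant, determinant 1 makes
      it a cube root of unity, and scaling it away does not change the class.\<close>
    have "?C$1$1 = ?C$2$2" "?C$2$2 = ?C$3$3"
      using r nz unfolding ratios_def diag[symmetric] by (simp_all add: field_simps)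
    then have Cd: "?C$i$i = c" for i using exhaust_3[of i] by (auto simp: c_def)
    then have c3: "c ^ 3 = 1" using U.diag_prod[OF D(3)] by (simp add: power3_eq_cube)
    have c0: "c \<noteq> 0" using nz(2)[of 1] by (simp add: c_def)
    have ic3: "(1 / c) ^ 3 = 1" using c3 by (simp add: power_divide)
    have "mat (1 / c) ** ?C \<in> K"
      using conj.mult[OF conj.scal[OF ic3] D(3)] Cd c0 by (simp add: K_def mat_mult_left)
    moreover have "emb (mat (1 / c) ** ?C) = proj (A ** cofactor3 B)"
      unfolding emb_scale[OF ic3] by (rule C(3))
    ultimately show ?thesis unfolding H_def by (metis image_eqI)
  qed
  have finr: "finite ((\<lambda>A. ratios (P ** A ** Q)) ` lift G)" using fin by (simp add: image_image)
  note fi = finite_index[OF G H HG finr index]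
  have "finitely_presented (PSL3_sub H) \<and> torsion_free (PSL3_sub H) \<and> solvable (PSL3_sub H)"
    by (rule iso_transfer[OF gK group.subgroup_imp_group[OF group_PSL3 H] iso'
          dH.finitely_presented dH.torsion_free dH.solvable])
  moreover have "unipotent h" if h: "h \<in> H" for h
  proof -
    obtain X where X: "X \<in> K" "h = proj (Q ** X ** P)" using h by (auto simp: H_def emb_def)
    have "c = 1" if "eigenvalue_of (Q ** X ** P) c" for c
    proof -
      have "eigenvalue_of X c" using that eigenvalue_of_conj[OF mutual_inverse_sym[OF PQ]] by blast
      moreover have "X \<in> \<Delta>" "X$i$i = 1" for i using X(1) by (auto simp: K_def)
      ultimately show ?thesis
        using U.low[of X] by (simp add: eigenvalue_of_det det_3 mat_entry)
    qed
    then show ?thesis unfolding unipotent_def using proj_self X(2) by blast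
  qed
  moreover have "subgroup K Heis3"
    unfolding Heis3_def using SL.subgroup_incl[OF K subgroup_Heis3 heis] by (simp add: Heis3_def)
  moreover have "conjugate_in_PSL3 H (proj ` K)" unfolding H_def using Kdet by (rule conjugate_emb)
  ultimately show thesis using that[OF fi] by blast
qed

end

section \<open>The translation lattice of a split group\<close>

lemma (in discrete_additive) discrete: "discrete L"
proof -
  have f: "finite (insert 1 (norm ` ({x \<in> L. norm x \<le> 1} - {0})))" (is "finite ?A") using fin by simp
  have pos: "0 < Min ?A" using f by (subst Min_gr_iff) auto
  have "uniform_discrete L"
    unfolding uniform_discrete_def
  proof (intro exI[of _ "Min ?A"] conjI ballI impI pos)
    fix x y assume xy: "x \<in> L" "y \<in> L" "dist x y < Min ?A"
    have "norm (x - y) < 1" using xy(3) Min_le[OF f, of 1] by (simp add: dist_norm)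
    show "x = y"
    proof (rule ccontr)
      assume "x \<noteq> y"
      then have "norm (x - y) \<in> ?A" using diff[OF xy(1,2)] \<open>norm (x - y) < 1\<close> by (intro insertI2 imageI) simp
      then have "Min ?A \<le> norm (x - y)" using f by (rule Min_le[rotated])
      then show False using xy(3) by (simp add: dist_norm)
    qed
  qed
  then show ?thesis by (rule uniform_discrete_imp_discrete)
qed

lemma complex_add_group_simps [simp]:
  "x \<otimes>\<^bsub>complex_add_group\<^esub> y = x + y" "\<one>\<^bsub>complex_add_group\<^esub> = 0" "x \<in> carrier complex_add_group"
  "inv\<^bsub>complex_add_group\<^esub> x = - x"
proof -
  show *: "x \<otimes>\<^bsub>complex_add_group\<^esub> y = x + y" "\<one>\<^bsub>complex_add_group\<^esub> = 0" "x \<in> carrier complex_add_group" for x y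
    by (simp_all add: complex_add_group_def)
  show "inv\<^bsub>complex_add_group\<^esub> x = - x"
    by (rule group.inv_equality[OF group_complex_add_group]) (simp_all add: *)
qed

locale ell_lift = conjugated_lift +
  assumes ell: "\<And>X. X \<in> \<Delta> \<Longrightarrow> ell_form X"
begin

sublocale U: upper_parabolic_lift \<Delta>
  by unfold_locales (use ell in \<open>simp add: ell_form_def\<close>)

definition transl :: "cmat3 \<Rightarrow> complex" where "transl X = X$1$2 / X$1$1"

definition translation_set :: "complex set" where "translation_set = transl ` \<Delta>"

lemma entries:
  assumes "X \<in> \<Delta>"
  shows "X$1$3 = 0" "X$2$3 = 0" "X$2$1 = 0" "X$3$1 = 0" "X$3$2 = 0" "X$2$2 = X$1$1"
    "X$1$1 \<noteq> 0" "cmod (X$1$1) = 1" "X$1$2 = X$1$1 * transl X" "X$3$3 = 1 / (X$1$1)\<^sup>2"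
proof -
  show "X$1$3 = 0" "X$2$3 = 0" "X$2$1 = 0" "X$3$1 = 0" "X$3$2 = 0" and e: "X$2$2 = X$1$1"
    using ell[OF assms] by (auto simp: ell_form_def upper_def)
  show nz: "X$1$1 \<noteq> 0" and "cmod (X$1$1) = 1" using U.diag_nonzero U.diag_unit assms by blast+
  show "X$1$2 = X$1$1 * transl X" using nz by (simp add: transl_def)
  show "X$3$3 = 1 / (X$1$1)\<^sup>2" using U.diag_prod[OF assms] nz e by (simp add: field_simps power2_eq_square)
qed

lemma transl_mult: "X \<in> \<Delta> \<Longrightarrow> Y \<in> \<Delta> \<Longrightarrow> transl (X ** Y) = transl X + transl Y"
  using entries[of X] entries[of Y] by (simp add: transl_def matrix_mult_entry3 field_simps)

lemma transl_one: "transl (mat 1) = 0"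
  by (simp add: transl_def mat_entry)

lemma transl_inv: "X \<in> \<Delta> \<Longrightarrow> transl (cofactor3 X) = - transl X"
  using transl_mult[of X "cofactor3 X"] conj.inv cofactor3_inverse[OF conj.det1] transl_one
  by (auto simp: mutual_inverse_def add_eq_0_iff)

text \<open>Here non-diagonalizability enters: without translation the matrix is diagonal, hence
  scalar. So a translation determines its element up to scalars.\<close>

lemma transl_zero: 
  assumes "X \<in> \<Delta>" "transl X = 0" shows "\<exists>c. c ^ 3 = 1 \<and> X = mat c"
proof -
  note e = entries[OF assms(1)]
  have "X$1$2 = 0" using e assms(2) by simp
  then have "X$2$2 = X$3$3" using U.nonscalar_entry(1)[OF assms(1)] e by auto
  then have "X = mat (X$1$1)"
    using e \<open>X$1$2 = 0\<close> by (simp add: vec_eq_iff forall_3 mat_entry)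
  moreover have "(X$1$1) ^ 3 = 1"
    using U.diag_prod[OF assms(1)] unfolding \<open>X$2$2 = X$3$3\<close>[symmetric] e(6) power3_eq_cube .
  ultimately show ?thesis by blast
qed

lemma transl_eq:
  assumes "X \<in> \<Delta>" "Y \<in> \<Delta>" "transl X = transl Y" shows "\<exists>c. c ^ 3 = 1 \<and> X = mat c ** Y"
proof -
  have Y: "mutual_inverse Y (cofactor3 Y)" by (rule cofactor3_inverse[OF conj.det1[OF assms(2)]])
  have "X ** cofactor3 Y \<in> \<Delta>" by (rule conj.mult[OF assms(1) conj.inv[OF assms(2)]])
  moreover have "transl (X ** cofactor3 Y) = 0"
    using transl_mult[OF assms(1) conj.inv[OF assms(2)]] transl_inv[OF assms(2)] assms(3) by simp
  ultimately obtain c where c: "c ^ 3 = 1" "X ** cofactor3 Y = mat c" using transl_zero by blast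
  have "X = X ** cofactor3 Y ** Y"
    using Y unfolding mutual_inverse_def by (metis matrix_mul_assoc matrix_mul_rid)
  then show ?thesis using c by auto
qed

text \<open>Diagonal entries have modulus 1, so a translation has the modulus of the matrix entry
  \<open>X$1$2\<close>.\<close>

lemma translation_set_discrete: "discrete_additive translation_set"
proof
  show "0 \<in> translation_set" using conj.one transl_one unfolding translation_set_def by (metis image_eqI)
  show "x - y \<in> translation_set" if xy: "x \<in> translation_set" "y \<in> translation_set" for x y
  proof -
    obtain X Y where X: "X \<in> \<Delta>" "x = transl X" and Y: "Y \<in> \<Delta>" "y = transl Y"
      using xy unfolding translation_set_def by blast
    have "x - y = transl (X ** cofactor3 Y)"
      using transl_mult[OF X(1) conj.inv[OF Y(1)]] transl_inv[OF Y(1)] X(2) Y(2) by simp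
    then show ?thesis unfolding translation_set_def using conj.mult[OF X(1) conj.inv[OF Y(1)]] by (rule image_eqI)
  qed
  show "finite {x \<in> translation_set. norm x \<le> r}" for r
  proof (rule finite_subset)
    show "finite (transl ` {X \<in> \<Delta>. cmod (transl X) \<le> r})"
    proof (rule U.finite_bounded_image)
      fix X assume X: "X \<in> \<Delta>" "cmod (transl X) \<le> r"
      then show "cmod (X$1$2) \<le> r \<and> cmod (X$1$3) \<le> r \<and> cmod (X$2$3) \<le> r"
        using entries[OF X(1)] order_trans[OF norm_ge_zero X(2)] by (simp add: norm_mult)
    qed
    show "{x \<in> translation_set. norm x \<le> r} \<subseteq> transl ` {X \<in> \<Delta>. cmod (transl X) \<le> r}"
      unfolding translation_set_def by blast
  qed
qed

lemma two_generators:
  obtains a b where "a \<in> translation_set" "b \<in> translation_set"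
    "\<And>x. x \<in> translation_set \<Longrightarrow> \<exists>i j::int. x = of_int i * a + of_int j * b"
  by (rule discrete_complex_two_generators[OF translation_set_discrete]) blast

lemma complex_additive_int:
  fixes S :: "complex set"
  assumes "0 \<in> S" "\<And>x y. x \<in> S \<Longrightarrow> y \<in> S \<Longrightarrow> x - y \<in> S" "a \<in> S" "b \<in> S"
  shows "of_int i * a + of_int j * b \<in> S"
proof -
  have "of_int k * x \<in> S" if "x \<in> S" for k x
    using additive_closure(3)[of S x k] assms(1,2) that by (simp add: scaleR_conv_of_real)
  then have "of_int i * a \<in> S" "of_int j * b \<in> S" using assms(3,4) by auto
  then show ?thesis by (intro additive_closure(2)[OF assms(1,2)])
qed

text \<open>Elements whose eigenvalue is killed by a common exponent are closed under quotients.
  They realize two generating translations, hence all of them, and every other lift differs by a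
  cube root of unity.\<close>

lemma rational_finite_ratios:
  assumes root: "\<And>X. X \<in> \<Delta> \<Longrightarrow> \<exists>n::nat. n > 0 \<and> (X$1$1) ^ n = 1"
  shows "finite (ratios ` \<Delta>)"
proof -
  obtain a b where ab: "a \<in> translation_set" "b \<in> translation_set"
    and gen: "\<And>x. x \<in> translation_set \<Longrightarrow> \<exists>i j::int. x = of_int i * a + of_int j * b"
    by (rule two_generators) blast
  obtain A B where A: "A \<in> \<Delta>" "a = transl A" and B: "B \<in> \<Delta>" "b = transl B"
    using ab unfolding translation_set_def by blast
  obtain m n :: nat where m: "m > 0" "(A$1$1) ^ m = 1" and n: "n > 0" "(B$1$1) ^ n = 1"
    using root[OF A(1)] root[OF B(1)] by blast
  \<comment> \<open>The factor 3 absorbs the cube roots of unity by which lifts differ.\<close>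
  define M where "M = 3 * (m * n)"
  have pow: "c ^ M = 1" if "c ^ 3 = 1 \<or> c ^ m = 1 \<or> c ^ n = 1" for c :: complex
  proof -
    have "c ^ M = (c ^ 3) ^ (m * n)" "c ^ M = (c ^ m) ^ (3 * n)" "c ^ M = (c ^ n) ^ (3 * m)"
      by (simp_all add: M_def mult_ac flip: power_mult)
    then show ?thesis using that by (metis power_one)
  qed
  define S where "S = transl ` {X \<in> \<Delta>. (X$1$1) ^ M = 1}"
  have S: "0 \<in> S" "\<And>x y. x \<in> S \<Longrightarrow> y \<in> S \<Longrightarrow> x - y \<in> S"
  proof -
    show "0 \<in> S" unfolding S_def
      by (rule image_eqI[of _ _ "mat 1"]) (simp_all add: transl_one conj.one mat_entry)
    fix x y assume "x \<in> S" "y \<in> S"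
    then obtain X Y where X: "X \<in> \<Delta>" "(X$1$1) ^ M = 1" "x = transl X" and Y: "Y \<in> \<Delta>" "(Y$1$1) ^ M = 1" "y = transl Y"
      unfolding S_def by blast
    have Z: "X ** cofactor3 Y \<in> \<Delta>" by (rule conj.mult[OF X(1) conj.inv[OF Y(1)]])
    have "(X ** cofactor3 Y)$1$1 = X$1$1 / Y$1$1"
      using entries[OF X(1)] entries[OF Y(1)]
      by (simp add: matrix_mult_entry3 cofactor3_def power2_eq_square)
    then have "((X ** cofactor3 Y)$1$1) ^ M = 1" by (simp add: power_divide X Y)
    moreover have "x - y = transl (X ** cofactor3 Y)"
      using transl_mult[OF X(1) conj.inv[OF Y(1)]] transl_inv[OF Y(1)] X(3) Y(3) by simp
    ultimately show "x - y \<in> S" unfolding S_def using Z by blast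
  qed
  have all: "(X$1$1) ^ M = 1" if X: "X \<in> \<Delta>" for X
  proof -
    have "a \<in> S" unfolding S_def A(2) by (rule imageI) (simp add: A(1) pow m(2))
    moreover have "b \<in> S" unfolding S_def B(2) by (rule imageI) (simp add: B(1) pow n(2))
    moreover obtain i j :: int where "transl X = of_int i * a + of_int j * b"
      using gen[of "transl X"] X unfolding translation_set_def by blast
    ultimately have "transl X \<in> S" using complex_additive_int[OF S, of a b] by simp
    then obtain Y where Y: "Y \<in> \<Delta>" "(Y$1$1) ^ M = 1" "transl X = transl Y" unfolding S_def by blast
    obtain c where "c ^ 3 = 1" "X = mat c ** Y" using transl_eq[OF X Y(1,3)] by blast
    then show ?thesis using Y(2) pow[of c] by (simp add: mat_mult_left power_mult_distrib)
  qed
  show ?thesis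
  proof (rule finite_subset)
    have "M \<ge> 1" using m n by (simp add: M_def)
    then show "finite ((\<lambda>z. (1, z ^ 3)) ` {z::complex. z ^ M = 1})"
      by (intro finite_imageI finite_roots_unity)
    show "ratios ` \<Delta> \<subseteq> (\<lambda>z. (1, z ^ 3)) ` {z. z ^ M = 1}"
    proof
      fix x assume "x \<in> ratios ` \<Delta>"
      then obtain X where X: "X \<in> \<Delta>" "x = ratios X" by (rule imageE)
      have "x = (1, (X$1$1) ^ 3)"
        using entries[OF X(1)] X(2) by (simp add: ratios_def power2_eq_square power3_eq_cube)
      then show "x \<in> (\<lambda>z. (1, z ^ 3)) ` {z. z ^ M = 1}" by (rule image_eqI[where x = "X$1$1"]) (simp add: all[OF X(1)])
    qed
  qed
qed

end

section \<open>The explicit form on threefold translations\<close>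

context ell_lift
begin

text \<open>The lifts of an element differ by cube roots of unity, so the multiplier of the group is only
  defined on cubes, that is on the subgroup of index at most 9 of threefold translations.\<close>

definition triple_set :: "complex set" where "triple_set = (\<lambda>v. 3 * v) ` translation_set"

text \<open>The choice ranges over all lifts with a third of the given translation;
  \<open>multiplier_eq\<close> shows that the cube does not depend on it.\<close>

definition multiplier :: "complex \<Rightarrow> complex" where
  "multiplier u = (SOME z. \<exists>X\<in>\<Delta>. u = 3 * transl X \<and> z = (X$1$1) ^ 3)"

definition ell_matrix :: "complex \<Rightarrow> cmat3" where
  "ell_matrix u = vector [vector [multiplier u, multiplier u * u, 0],
                       vector [0, multiplier u, 0],
                       vector [0, 0, multiplier u powi (-2)]]"

lemma triple_setE:
  assumes "u \<in> triple_set" obtains X where "X \<in> \<Delta>" "u = 3 * transl X"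
  using assms unfolding triple_set_def translation_set_def by blast

lemma triple_setI: "X \<in> \<Delta> \<Longrightarrow> 3 * transl X \<in> triple_set"
  unfolding triple_set_def translation_set_def by (intro imageI)

lemma multiplier_eq:
  assumes X: "X \<in> \<Delta>" shows "multiplier (3 * transl X) = (X$1$1) ^ 3"
proof -
  have "\<exists>z. \<exists>Y\<in>\<Delta>. 3 * transl X = 3 * transl Y \<and> z = (Y$1$1) ^ 3" using X by blast
  then have "\<exists>Y\<in>\<Delta>. 3 * transl X = 3 * transl Y \<and> multiplier (3 * transl X) = (Y$1$1) ^ 3"
    unfolding multiplier_def by (rule someI_ex)
  then obtain Y where Y: "Y \<in> \<Delta>" "3 * transl X = 3 * transl Y" "multiplier (3 * transl X) = (Y$1$1) ^ 3" by blast
  have "transl X = transl Y" using Y(2) by simp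
  then obtain c where "c ^ 3 = 1" "X = mat c ** Y" using transl_eq[OF X Y(1)] by blast
  then show ?thesis using Y(3) by (simp add: mat_mult_left power_mult_distrib)
qed

lemma multiplier_unit: "u \<in> triple_set \<Longrightarrow> cmod (multiplier u) = 1"
  by (elim triple_setE) (simp add: multiplier_eq norm_power entries)

text \<open>Cubing triples the translation and removes the ambiguity of the lift, so the explicit
  matrices lie in \<open>\<Delta>\<close>.\<close>

lemma ell_matrix_cube:
  assumes X: "X \<in> \<Delta>" shows "ell_matrix (3 * transl X) = X ** X ** X"
proof -
  note e = entries[OF X]
  have p: "(X$1$1 ^ 3) powi (-2) = 1 / (X$1$1)\<^sup>2 * (1 / (X$1$1)\<^sup>2) * (1 / (X$1$1)\<^sup>2)"
    using e(7) by (simp add: power_int_def field_simps flip: power_mult power_add)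
  show ?thesis
    unfolding ell_matrix_def multiplier_eq[OF X] p
    by (simp add: vec_eq_iff forall_3 matrix_mult_entry3 e(1-6) e(9,10)) (simp add: power3_eq_cube algebra_simps)
qed

lemma ell_matrix_in: "u \<in> triple_set \<Longrightarrow> ell_matrix u \<in> \<Delta>"
  by (elim triple_setE) (simp only: ell_matrix_cube conj.mult)

lemma triple_set_discrete: "discrete_additive triple_set"
proof -
  interpret T: discrete_additive translation_set by (rule translation_set_discrete)
  show ?thesis
  proof
    show "0 \<in> triple_set" unfolding triple_set_def using T.zero by force
    show "x - y \<in> triple_set" if xy: "x \<in> triple_set" "y \<in> triple_set" for x y
    proof -
      obtain v w where v: "v \<in> translation_set" "x = 3 * v" and w: "w \<in> translation_set" "y = 3 * w"
        using xy unfolding triple_set_def by blast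
      have "x - y = 3 * (v - w)" by (simp add: v w)
      then show ?thesis unfolding triple_set_def using T.diff[OF v(1) w(1)] by (rule image_eqI)
    qed
    show "finite {x \<in> triple_set. norm x \<le> r}" for r
    proof (rule finite_subset)
      show "finite ((\<lambda>v. 3 * v) ` {v \<in> translation_set. norm v \<le> r})" by (intro finite_imageI T.fin)
      show "{x \<in> triple_set. norm x \<le> r} \<subseteq> (\<lambda>v. 3 * v) ` {v \<in> translation_set. norm v \<le> r}"
      proof
        fix x assume "x \<in> {x \<in> triple_set. norm x \<le> r}"
        then obtain v where v: "v \<in> translation_set" "x = 3 * v" "norm x \<le> r" unfolding triple_set_def by blast
        then have "3 * norm v \<le> r" by (simp add: norm_mult)
        then have "norm v \<le> r" using norm_ge_zero[of v] by linarith
        then show "x \<in> (\<lambda>v. 3 * v) ` {v \<in> translation_set. norm v \<le> r}" using v(1,2) by blast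
      qed
    qed
  qed
qed

abbreviation W_group :: "complex monoid" where
  "W_group \<equiv> complex_add_group\<lparr>carrier := triple_set\<rparr>"

interpretation AG: group complex_add_group by (rule group_complex_add_group)

lemma W_subgroup: "subgroup triple_set complex_add_group"
proof -
  interpret T: discrete_additive triple_set by (rule triple_set_discrete)
  show ?thesis
    using T.zero additive_closure[OF T.zero T.diff] by (intro AG.subgroupI) auto
qed

lemma W_group_group: "group W_group"
  by (rule AG.subgroup_imp_group[OF W_subgroup])

lemma multiplier_add:
  assumes "u \<in> triple_set" "v \<in> triple_set"
  shows "multiplier (u + v) = multiplier u * multiplier v"
proof -
  obtain X Y where X: "X \<in> \<Delta>" "u = 3 * transl X" and Y: "Y \<in> \<Delta>" "v = 3 * transl Y"
    using assms triple_setE by metis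
  have "u + v = 3 * transl (X ** Y)" using transl_mult[OF X(1) Y(1)] X Y by simp
  then have "multiplier (u + v) = ((X ** Y)$1$1) ^ 3" using multiplier_eq[OF conj.mult[OF X(1) Y(1)]] by simp
  also have "(X ** Y)$1$1 = X$1$1 * Y$1$1" using entries[OF X(1)] entries[OF Y(1)] by (simp add: matrix_mult_entry3)
  finally show ?thesis using multiplier_eq[OF X(1)] multiplier_eq[OF Y(1)] X(2) Y(2) by (simp add: power_mult_distrib)
qed

lemma ell_matrix_add:
  assumes "u \<in> triple_set" "v \<in> triple_set"
  shows "ell_matrix (u + v) = ell_matrix u ** ell_matrix v"
  unfolding ell_matrix_def multiplier_add[OF assms]
  by (simp add: vec_eq_iff forall_3 matrix_mult_entry3 power_int_mult_distrib algebra_simps)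

lemma det_ell_matrix: "u \<in> triple_set \<Longrightarrow> det (ell_matrix u) = 1"
  by (rule conj.det1[OF ell_matrix_in])

definition ell_emb :: "complex \<Rightarrow> cmat3 set" where "ell_emb u = emb (ell_matrix u)"

lemma ell_emb_hom: "ell_emb \<in> hom W_group PSL3"
proof (rule homI)
  show "ell_emb u \<in> carrier PSL3" if "u \<in> carrier W_group" for u
    using emb_in_G[OF ell_matrix_in] that subsetD[OF subgroup.subset[OF G]] by (simp add: ell_emb_def)
  show "ell_emb (u \<otimes>\<^bsub>W_group\<^esub> v) = ell_emb u \<otimes>\<^bsub>PSL3\<^esub> ell_emb v"
    if "u \<in> carrier W_group" "v \<in> carrier W_group" for u v
    using that by (simp add: ell_emb_def ell_matrix_add emb_mult det_ell_matrix)
qed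

lemma ell_emb_inj:
  assumes "u \<in> carrier W_group" "ell_emb u = \<one>\<^bsub>PSL3\<^esub>" shows "u = \<one>\<^bsub>W_group\<^esub>"
proof -
  obtain c where "ell_matrix u = mat c" using emb_eq_one assms(2) unfolding ell_emb_def by blast
  then have "(ell_matrix u)$1$2 = 0" by (simp add: mat_entry)
  then have "multiplier u * u = 0" by (simp add: ell_matrix_def)
  moreover have "multiplier u \<noteq> 0" using multiplier_unit[of u] assms(1) by auto
  ultimately show ?thesis by simp
qed

lemma W_generators:
  obtains a b where "a \<in> triple_set" "b \<in> triple_set"
    "\<And>S. 0 \<in> S \<Longrightarrow> (\<And>x y. x \<in> S \<Longrightarrow> y \<in> S \<Longrightarrow> x - y \<in> S) \<Longrightarrow> a \<in> S \<Longrightarrow> b \<in> S \<Longrightarrow> triple_set \<subseteq> S"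
proof -
  obtain a b where ab: "a \<in> triple_set" "b \<in> triple_set"
    and gen: "\<And>x. x \<in> triple_set \<Longrightarrow> \<exists>i j::int. x = of_int i * a + of_int j * b"
    by (rule discrete_complex_two_generators[OF triple_set_discrete]) blast
  show thesis
  proof (rule that[OF ab])
    fix S assume S: "0 \<in> S" "\<And>x y. x \<in> S \<Longrightarrow> y \<in> S \<Longrightarrow> x - y \<in> S" "a \<in> S" "b \<in> S"
    show "triple_set \<subseteq> S"
    proof
      fix x assume "x \<in> triple_set"
      then obtain i j :: int where "x = of_int i * a + of_int j * b" using gen by blast
      then show "x \<in> S" using complex_additive_int[OF S] by simp
    qed
  qed
qed

lemma W_group_props: "finitely_presented W_group" "torsion_free W_group" "solvable W_group" "comm_group W_group"
proof -
  obtain a b where ab: "a \<in> triple_set" "b \<in> triple_set"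
    "\<And>S. 0 \<in> S \<Longrightarrow> (\<And>x y. x \<in> S \<Longrightarrow> y \<in> S \<Longrightarrow> x - y \<in> S) \<Longrightarrow> a \<in> S \<Longrightarrow> b \<in> S \<Longrightarrow> triple_set \<subseteq> S"
    by (rule W_generators) blast
  have "AG.polycyclic triple_set"
  proof (rule AG.polycyclic_if_fg_over_commutators[OF AG.polycyclic.trivial W_subgroup, of "{a, b}"])
    show "triple_set \<subseteq> S" if S: "subgroup S complex_add_group" "{a, b} \<subseteq> S" for S
    proof (rule ab(3))
      show "0 \<in> S" using subgroup.one_closed[OF S(1)] by simp
      show "x - y \<in> S" if "x \<in> S" "y \<in> S" for x y
        using subgroup.m_closed[OF S(1) that(1) subgroup.m_inv_closed[OF S(1) that(2)]] by simp
    qed (use S(2) in auto)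
  qed (use ab subgroup.one_closed[OF W_subgroup] in auto)
  then show "finitely_presented W_group" by (rule AG.polycyclic_imp_finitely_presented)
  show "solvable W_group"
    by (intro AG.solvable_if_solvable_seq AG.solvable_seq_over_commutators[OF solvable_seq.unity W_subgroup]) simp
  have pow: "x [^]\<^bsub>W_group\<^esub> n = of_nat n * x" for x and n :: nat
    by (induction n) (simp_all add: algebra_simps)
  show "torsion_free W_group" unfolding torsion_free_def by (simp add: pow)
  show "comm_group W_group" by (rule group.group_comm_groupI[OF W_group_group]) simp
qed

text \<open>The additive group \<open>triple_set\<close> is isomorphic to \<open>H\<close> and
  supplies its abstract properties; coordinates modulo 3 give index at most 9.\<close>

theorem virtually_Ell:
  assumes irr: "X0 \<in> \<Delta>" "\<And>n::nat. n > 0 \<Longrightarrow> (X0$1$1) ^ n \<noteq> 1"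
  obtains H where "subgroup H (PSL3_sub G)" "finite (rcosets\<^bsub>PSL3_sub G\<^esub> H)"
    "finitely_presented (PSL3_sub H)" "torsion_free (PSL3_sub H)" "solvable (PSL3_sub H)"
    "comm_group (PSL3_sub H)" "group_rank (PSL3_sub H) \<le> 2" "\<exists>h\<in>H. irrational_ellipto_parabolic h"
    "\<exists>W \<mu>. subgroup W complex_add_group \<and> discrete W \<and>
      \<mu> \<in> hom (complex_add_group\<lparr>carrier := W\<rparr>) circle_group \<and> conjugate_in_PSL3 H (Ell W \<mu>)"
proof -
  define H where "H = ell_emb ` triple_set"
  note iso = injective_hom_iso[OF W_group_group ell_emb_hom ell_emb_inj]
  have H: "subgroup H PSL3" and iso': "ell_emb \<in> iso W_group (PSL3_sub H)"
    using iso by (simp_all add: H_def)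
  have gH: "group (PSL3_sub H)" by (rule group.subgroup_imp_group[OF group_PSL3 H])
  have HG: "H \<subseteq> G" using emb_in_G[OF ell_matrix_in] by (auto simp: H_def ell_emb_def)
  obtain a b where ab: "a \<in> translation_set" "b \<in> translation_set"
    and gen: "\<And>x. x \<in> translation_set \<Longrightarrow> \<exists>i j::int. x = of_int i * a + of_int j * b"
    by (rule two_generators) blast
  define idx where "idx x = (SOME ij. x = of_int (fst ij) * a + of_int (snd ij) * b)" for x :: complex
  have idx: "x = of_int (fst (idx x)) * a + of_int (snd (idx x)) * b" if x: "x \<in> translation_set" for x
  proof -
    obtain i j :: int where "x = of_int i * a + of_int j * b" using gen[OF x] by blast
    then have "x = of_int (fst (i, j)) * a + of_int (snd (i, j)) * b" by simp
    then show ?thesis unfolding idx_def by (rule someI[of "\<lambda>ij. x = of_int (fst ij) * a + of_int (snd ij) * b"])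
  qed
  define \<phi> where "\<phi> A = (fst (idx (transl (P ** A ** Q))) mod 3, snd (idx (transl (P ** A ** Q))) mod 3)" for A
  have "\<phi> ` lift G \<subseteq> {0..<3} \<times> {0..<3}" by (auto simp: \<phi>_def)
  then have fin: "finite (\<phi> ` lift G)" by (rule finite_subset) simp
  interpret T: discrete_additive translation_set by (rule translation_set_discrete)
  have index: "proj (A ** cofactor3 B) \<in> H"
    if A: "A \<in> lift G" and B: "B \<in> lift G" and e: "\<phi> A = \<phi> B" for A B
  proof -
    let ?A = "P ** A ** Q" and ?B = "P ** B ** Q" and ?C = "P ** (A ** cofactor3 B) ** Q"
    note C = quotient_lift[OF A B]
    have D: "?A \<in> \<Delta>" "?B \<in> \<Delta>" "?C \<in> \<Delta>" using A B C(1) by blast+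
    have tC: "transl ?C = transl ?A - transl ?B" using transl_mult[OF D(3,2)] C(2) by simp
    have m: "fst (idx (transl ?A)) mod 3 = fst (idx (transl ?B)) mod 3"
      "snd (idx (transl ?A)) mod 3 = snd (idx (transl ?B)) mod 3" using e by (simp_all add: \<phi>_def)
    obtain k l where k: "fst (idx (transl ?A)) - fst (idx (transl ?B)) = 3 * k"
      and l: "snd (idx (transl ?A)) - snd (idx (transl ?B)) = 3 * l"
      using m by (metis dvdE mod_eq_dvd_iff)
    have mem: "transl ?A \<in> translation_set" "transl ?B \<in> translation_set"
      using D unfolding translation_set_def by blast+
    have "transl ?C = of_int (fst (idx (transl ?A)) - fst (idx (transl ?B))) * a
        + of_int (snd (idx (transl ?A)) - snd (idx (transl ?B))) * b"
      unfolding tC using idx[OF mem(1)] idx[OF mem(2)] by (simp add: algebra_simps)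
    then have tC3: "transl ?C = 3 * (of_int k * a + of_int l * b)" unfolding k l by (simp add: algebra_simps)
    have "of_int k * a + of_int l * b \<in> translation_set"
      by (rule complex_additive_int[OF T.zero T.diff ab])
    then obtain Z where Z1: "Z \<in> \<Delta>" "of_int k * a + of_int l * b = transl Z"
      unfolding translation_set_def by blast
    then have Z: "Z \<in> \<Delta>" "transl ?C = 3 * transl Z" using tC3 by (simp_all only:)
    \<comment> \<open>Equal residues make the translation of the quotient three times that of some
      \<open>Z\<close>, so the quotient is the cube of \<open>Z\<close> up to a scalar.\<close>
    let ?E = "ell_matrix (3 * transl Z)"
    have E: "?E \<in> \<Delta>" by (rule ell_matrix_in[OF triple_setI[OF Z(1)]])
    have "transl ?E = transl ?C"
      unfolding ell_matrix_cube[OF Z(1)] Z(2)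
      using transl_mult[OF conj.mult[OF Z(1) Z(1)] Z(1)] transl_mult[OF Z(1) Z(1)] by simp
    then obtain c where c: "c ^ 3 = 1" "?C = mat c ** ?E" using transl_eq[OF D(3) E] by metis
    have "proj (A ** cofactor3 B) = emb ?C" by (rule C(3)[symmetric])
    also have "\<dots> = ell_emb (3 * transl Z)" unfolding c(2) emb_scale[OF c(1)] ell_emb_def ..
    finally show ?thesis unfolding H_def using triple_setI[OF Z(1)] by blast
  qed
  note fi = finite_index[OF G H HG fin index]
  have props: "finitely_presented (PSL3_sub H) \<and> torsion_free (PSL3_sub H) \<and> solvable (PSL3_sub H)"
    by (rule iso_transfer[OF W_group_group gH iso' W_group_props(1-3)])
  have comm: "comm_group (PSL3_sub H)"
  proof -
    have "W_group \<cong> PSL3_sub H" using iso' unfolding is_iso_def by blast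
    then show ?thesis using comm_group.iso_imp_comm_group[OF W_group_props(4)] gH group.is_monoid by blast
  qed
  have rank: "group_rank (PSL3_sub H) \<le> 2"
  proof -
    obtain c d where cd: "c \<in> triple_set" "d \<in> triple_set"
      "\<And>S. 0 \<in> S \<Longrightarrow> (\<And>x y. x \<in> S \<Longrightarrow> y \<in> S \<Longrightarrow> x - y \<in> S) \<Longrightarrow> c \<in> S \<Longrightarrow> d \<in> S \<Longrightarrow> triple_set \<subseteq> S"
      by (rule W_generators) blast
    interpret i: group_hom W_group "PSL3_sub H" ell_emb
      using W_group_group gH iso' by (simp add: group_hom_def group_hom_axioms_def iso_def)
    have sub: "{c, d} \<subseteq> carrier W_group" using cd by simp
    have genW: "generate W_group {c, d} = triple_set"
    proof
      show "generate W_group {c, d} \<subseteq> triple_set"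
        using i.G.generate_incl[OF sub] by simp
      have s: "subgroup (generate W_group {c, d}) W_group" by (rule i.G.generate_is_subgroup[OF sub])
      have s': "subgroup (generate W_group {c, d}) complex_add_group"
        by (rule AG.incl_subgroup[OF W_subgroup s])
      show "triple_set \<subseteq> generate W_group {c, d}"
      proof (rule cd(3))
        show "0 \<in> generate W_group {c, d}" using subgroup.one_closed[OF s'] by simp
        show "x - y \<in> generate W_group {c, d}"
          if "x \<in> generate W_group {c, d}" "y \<in> generate W_group {c, d}" for x y
          using subgroup.m_closed[OF s' that(1) subgroup.m_inv_closed[OF s' that(2)]] by simp
      qed (auto intro: generate.incl)
    qed
    have "generate (PSL3_sub H) (ell_emb ` {c, d}) = H"
      using i.generate_img[OF sub] genW by (simp add: H_def)
    moreover have "ell_emb ` {c, d} \<subseteq> H" using cd by (auto simp: H_def)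
    ultimately have "group_rank (PSL3_sub H) \<le> enat (card (ell_emb ` {c, d}))"
      unfolding group_rank_def by (intro Inf_lower) auto
    also have "card (ell_emb ` {c, d}) \<le> card {c, d}" by (rule card_image_le) simp
    also have "\<dots> \<le> 2" by (simp add: card_insert_if)
    finally show ?thesis by (simp add: numeral_eq_enat order_trans)
  qed
  have irrational: "\<exists>h\<in>H. irrational_ellipto_parabolic h"
  proof
    define u where "u = 3 * transl X0"
    define l where "l = multiplier u"
    have u: "u \<in> triple_set" unfolding u_def by (rule triple_setI[OF irr(1)])
    show "ell_emb u \<in> H" using u by (auto simp: H_def)
    have l: "l = (X0$1$1) ^ 3" unfolding l_def u_def by (rule multiplier_eq[OF irr(1)])
    have lroot: "l ^ n \<noteq> 1" if "n > 0" for n :: nat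
      using irr(2)[of "3 * n"] that by (simp add: l power_mult)
    have l1: "cmod l = 1" unfolding l_def by (rule multiplier_unit[OF u])
    have l0: "l \<noteq> 0" using l1 by auto
    have u0: "u \<noteq> 0"
    proof
      assume "u = 0"
      then have "transl X0 = 0" by (simp add: u_def)
      then obtain c where "c ^ 3 = 1" "X0 = mat c" using transl_zero[OF irr(1)] by blast
      then show False using irr(2)[of 3] by (simp add: mat_entry)
    qed
    \<comment> \<open>Rescaling the first basis vector turns the off-diagonal entry
      \<open>l * u\<close> into the 1 of the Jordan form.\<close>
    define R S :: cmat3 where
      "R = vector [vector [l * u, 0, 0], vector [0, 1, 0], vector [0, 0, 1]]" and
      "S = vector [vector [1 / (l * u), 0, 0], vector [0, 1, 0], vector [0, 0, 1]]"
    have RS: "mutual_inverse R S"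
      using l0 u0 by (simp add: mutual_inverse_def vec_eq_iff forall_3 matrix_mult_entry3 mat_entry R_def S_def)
    have "ell_matrix u = R ** ep_jordan_form l ** S"
      using l0 u0
      by (simp add: vec_eq_iff forall_3 matrix_mult_entry3 ell_matrix_def ep_jordan_form_def R_def S_def flip: l_def)
    then have "Q ** ell_matrix u ** P = (Q ** R) ** ep_jordan_form l ** (S ** P)"
      by (simp add: matrix_mul_assoc)
    moreover have "mutual_inverse (Q ** R) (S ** P)"
      by (rule mutual_inverse_mult[OF mutual_inverse_sym[OF PQ] RS])
    ultimately have "similar_matrices (Q ** ell_matrix u ** P) (ep_jordan_form l)"
      unfolding similar_matrices_iff by blast
    moreover have "Q ** ell_matrix u ** P \<in> ell_emb u" unfolding ell_emb_def emb_def by (rule proj_self)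
    ultimately have "ellipto_parabolic_with l (ell_emb u)"
      unfolding ellipto_parabolic_with_def using l1 lroot[of 1] by auto
    then show "irrational_ellipto_parabolic (ell_emb u)"
      unfolding irrational_ellipto_parabolic_def using lroot by blast
  qed
  have "multiplier \<in> hom W_group circle_group"
    by (rule homI) (simp_all add: multiplier_unit multiplier_add circle_group_def)
  moreover have "conjugate_in_PSL3 H (Ell triple_set multiplier)"
  proof -
    have "conjugate_in_PSL3 (emb ` ell_matrix ` triple_set) (proj ` ell_matrix ` triple_set)"
      by (rule conjugate_emb) (use det_ell_matrix in auto)
    then show ?thesis by (simp add: image_image H_def ell_emb_def Ell_def ell_matrix_def)
  qed
  moreover have "discrete triple_set" by (rule discrete_additive.discrete[OF triple_set_discrete])
  ultimately show thesis using that[OF fi] props comm rank irrational W_subgroup by blast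
qed

end

theorem theorem5p20:
  fixes G :: "cmat3 set set"
  assumes "subgroup G PSL3"
    and "discrete_in_PSL3 G"
    and "purely_parabolic G"
  shows "virtually (\<lambda>H. finitely_presented (PSL3_sub H) \<and> torsion_free (PSL3_sub H)
                        \<and> solvable (PSL3_sub H)) G
    \<and> virtually (\<lambda>H.
        ((\<forall>h\<in>H. unipotent h) \<and>
         (\<exists>K. subgroup K Heis3 \<and> conjugate_in_PSL3 H (proj ` K)))
      \<or> (comm_group (PSL3_sub H) \<and> group_rank (PSL3_sub H) \<le> 2 \<and>
         (\<exists>h\<in>H. irrational_ellipto_parabolic h) \<and>
         (\<exists>W \<mu>. subgroup W complex_add_group \<and> discrete W \<and>
            \<mu> \<in> hom (complex_add_group\<lparr>carrier := W\<rparr>) circle_group \<and>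
            conjugate_in_PSL3 H (Ell W \<mu>)))) G"
proof -
  have lift: "parabolic_lift (lift G)" by (rule parabolic_lift_lift[OF assms])
  have conjugated: "\<exists>P Q. conjugated_lift G P Q \<and> (\<forall>A\<in>lift G. P ** A ** Q = R ** A ** S)"
    if "mutual_inverse R S" for R S
  proof -
    obtain P Q where PQ: "mutual_inverse P Q" "det P = 1" "\<And>A. P ** A ** Q = R ** A ** S"
      by (rule normalize_det[OF \<open>mutual_inverse R S\<close>]) blast
    then have "conjugated_lift G P Q" using assms(1) lift by (intro conjugated_lift.intro)
    then show ?thesis using PQ(3) by blast
  qed
  obtain R S where RS: "mutual_inverse R S" "\<forall>A\<in>lift G. upper (R ** A ** S)"
    using parabolic_monoid.triangularizable[OF parabolic_lift.axioms(1)[OF lift]]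
    unfolding triangularizable_def by blast
  obtain P Q where PQ: "conjugated_lift G P Q" "\<forall>A\<in>lift G. P ** A ** Q = R ** A ** S"
    using conjugated[OF RS(1)] by blast
  interpret C: conjugated_lift G P Q by (rule PQ(1))
  have up: "upper X" if "X \<in> C.\<Delta>" for X using that RS(2) PQ(2) by auto
  interpret U: upper_parabolic_lift C.\<Delta> by unfold_locales (rule up)
  show ?thesis
  proof (cases "finite (ratios ` C.\<Delta>)")
    case True
    obtain H where H: "subgroup H (PSL3_sub G)" "finite (rcosets\<^bsub>PSL3_sub G\<^esub> H)"
      "finitely_presented (PSL3_sub H)" "torsion_free (PSL3_sub H)" "solvable (PSL3_sub H)"
      "\<forall>h\<in>H. unipotent h" "\<exists>K. subgroup K Heis3 \<and> conjugate_in_PSL3 H (proj ` K)"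
      by (rule C.virtually_unipotent[OF up True])
    show ?thesis unfolding virtually_def by (intro conjI exI[of _ H] H disjI1)
  next
    case False
    then obtain R' S' where RS': "mutual_inverse R' S'" "\<forall>X\<in>C.\<Delta>. ell_form (R' ** X ** S')"
      using U.finite_ratios_or_ell_form by blast
    have "mutual_inverse (R' ** P) (Q ** S')" by (rule mutual_inverse_mult[OF RS'(1) C.PQ])
    then obtain P' Q' where PQ': "conjugated_lift G P' Q'"
      "\<forall>A\<in>lift G. P' ** A ** Q' = (R' ** P) ** A ** (Q ** S')"
      using conjugated by blast
    interpret C': conjugated_lift G P' Q' by (rule PQ'(1))
    have "ell_form X" if "X \<in> C'.\<Delta>" for X
      using that RS'(2) PQ'(2) by (auto simp flip: conj_conj)
    then interpret E: ell_lift G P' Q' by unfold_locales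
    show ?thesis
    proof (cases "\<exists>X0\<in>C'.\<Delta>. \<forall>n::nat. n > 0 \<longrightarrow> (X0$1$1) ^ n \<noteq> 1")
      case True
      then obtain X0 where X0: "X0 \<in> C'.\<Delta>" "\<And>n::nat. n > 0 \<Longrightarrow> (X0$1$1) ^ n \<noteq> 1" by blast
      obtain H where H: "subgroup H (PSL3_sub G)" "finite (rcosets\<^bsub>PSL3_sub G\<^esub> H)"
        "finitely_presented (PSL3_sub H)" "torsion_free (PSL3_sub H)" "solvable (PSL3_sub H)"
        "comm_group (PSL3_sub H)" "group_rank (PSL3_sub H) \<le> 2" "\<exists>h\<in>H. irrational_ellipto_parabolic h"
        "\<exists>W \<mu>. subgroup W complex_add_group \<and> discrete W \<and>
          \<mu> \<in> hom (complex_add_group\<lparr>carrier := W\<rparr>) circle_group \<and> conjugate_in_PSL3 H (Ell W \<mu>)"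
        by (rule E.virtually_Ell[OF X0])
      show ?thesis unfolding virtually_def by (intro conjI exI[of _ H] H disjI2)
    next
      \<comment> \<open>If every eigenvalue of the split group is a root of unity, the ratios are
        finite in these coordinates and the unipotent alternative holds.\<close>
      case False
      then have "\<And>X. X \<in> C'.\<Delta> \<Longrightarrow> \<exists>n::nat. n > 0 \<and> (X$1$1) ^ n = 1" by blast
      then have fin: "finite (ratios ` C'.\<Delta>)" by (rule E.rational_finite_ratios)
      obtain H where H: "subgroup H (PSL3_sub G)" "finite (rcosets\<^bsub>PSL3_sub G\<^esub> H)"
        "finitely_presented (PSL3_sub H)" "torsion_free (PSL3_sub H)" "solvable (PSL3_sub H)"
        "\<forall>h\<in>H. unipotent h" "\<exists>K. subgroup K Heis3 \<and> conjugate_in_PSL3 H (proj ` K)"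
        by (rule C'.virtually_unipotent[OF E.U.up fin])
      show ?thesis unfolding virtually_def by (intro conjI exI[of _ H] H disjI1)
    qed
  qed
qed

end
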